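(* Let $\mathbf{W}=\{\mathbf{W}(t):t\ge 0\}$ be standard planar Brownian motion started at the origin, and for $t\ge 0$ let $\mathsf{A}(t)$ be the area of $\mathrm{H}(t)=\operatorname{conv}\{\mathbf{W}(s):s\in[0,t]\}$. Let $\Theta^{\mathsf{A}}=\inf\{t\ge 0:\mathsf{A}(t)>1\}$. Then $$0.6366\approx\frac{2}{\pi}\le \mathbb{E}\left[\Theta^{\mathsf{A}}\right]\le 2\sqrt{2\mathfrak{r}}\approx 1.6651,$$ where $\mathfrak{r}=\mathbb{E}\left[\min\{\Theta^{R_1},\Theta^{R_2}\}\right]$ and $\Theta^{R_i}$ is the first time the range of the $i$-th coordinate of $\mathbf{W}$ exceeds $1$.
   Context: Standard planar Brownian motion is $\mathbf{W}(t)=(W_1(t),W_2(t))$ with $W_1,W_2$ independent one-dimensional standard Brownian motions started at $0$. $\operatorname{conv}A$ is the convex hull of $A\subset\mathbb{R}^2$. For $i=1,2$, $R_i(t)=\sup_{0\le s\le t}W_i(s)-\inf_{0\le s\le t}W_i(s)$ and $\Theta^{R_i}=\inf\{t\ge 0:R_i(t)>1\}$. The constant $\mathfrak{r}$ satisfies $$\mathfrak{r}=\frac12-\frac{2}{\pi}\int_0^\infty\left(1-\frac{4}{(\cos t+\cosh t)^2}\right)\frac{1}{t^3}\,dt\approx 0.346554.$$ The symbol $\approx$ only indicates a numerical approximation of the exact expression. *)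

theory Defs
  imports "HOL-Probability.Probability"
begin

text \<open>
  One-dimensional standard Brownian motion with time set \<open>[0, \<infinity>)\<close>. The parameter of
  \<^const>\<open>normal_density\<close> is the standard deviation, not the variance. The start at the origin
  and the path continuity are required almost surely.
\<close>

locale standard_brownian_motion = prob_space M
  for M :: "'a measure" and B :: "real \<Rightarrow> 'a \<Rightarrow> real" +
  assumes measurable: "\<And>t. 0 \<le> t \<Longrightarrow> B t \<in> borel_measurable M"
    and start: "AE \<omega> in M. B 0 \<omega> = 0"
    and indep_increments:
      "\<And>(n::nat) (t::nat \<Rightarrow> real). 0 \<le> t 0 \<Longrightarrow> (\<forall>i<n. t i \<le> t (Suc i)) \<Longrightarrow>
         indep_vars (\<lambda>_. borel) (\<lambda>i \<omega>. B (t (Suc i)) \<omega> - B (t i) \<omega>) {..<n}"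
    and normal_increments:
      "\<And>s t. 0 \<le> s \<Longrightarrow> s < t \<Longrightarrow>
         distributed M lborel (\<lambda>\<omega>. B t \<omega> - B s \<omega>) (\<lambda>x. ennreal (normal_density 0 (sqrt (t - s)) x))"
    and continuous_paths: "AE \<omega> in M. continuous_on {0..} (\<lambda>t. B t \<omega>)"

text \<open>
  Independence of the two coordinates is independence as processes, i.e. as random elements of
  the product space indexed by \<open>[0, \<infinity>)\<close>.
\<close>

locale standard_planar_brownian_motion =
  prob_space M +
  fst: standard_brownian_motion M "\<lambda>t \<omega>. fst (W t \<omega>)" +
  snd: standard_brownian_motion M "\<lambda>t \<omega>. snd (W t \<omega>)"
  for M :: "'a measure" and W :: "real \<Rightarrow> 'a \<Rightarrow> real \<times> real" +
  assumes indep_coordinates: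
    "indep_var (Pi\<^sub>M {0..} (\<lambda>_. borel)) (\<lambda>\<omega>. \<lambda>t\<in>{0..}. fst (W t \<omega>))
               (Pi\<^sub>M {0..} (\<lambda>_. borel)) (\<lambda>\<omega>. \<lambda>t\<in>{0..}. snd (W t \<omega>))"

definition path_range :: "(real \<Rightarrow> real) \<Rightarrow> real \<Rightarrow> real" where
  "path_range w t = (SUP s\<in>{0..t}. w s) - (INF s\<in>{0..t}. w s)"

definition hull_area :: "(real \<Rightarrow> real \<times> real) \<Rightarrow> real \<Rightarrow> real" where
  "hull_area w t = measure lborel (convex hull (w ` {0..t}))"

text \<open>The value is \<open>\<infinity>\<close> if \<open>f\<close> never exceeds \<open>1\<close>.\<close>

definition exceed_one_time :: "(real \<Rightarrow> real) \<Rightarrow> ennreal" where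
  "exceed_one_time f = (INF t\<in>{t. 0 \<le> t \<and> f t > 1}. ennreal t)"

definition area_time :: "(real \<Rightarrow> 'a \<Rightarrow> real \<times> real) \<Rightarrow> 'a \<Rightarrow> ennreal" where
  "area_time W \<omega> = exceed_one_time (hull_area (\<lambda>t. W t \<omega>))"

definition range_time :: "(real \<Rightarrow> 'a \<Rightarrow> real) \<Rightarrow> 'a \<Rightarrow> ennreal" where
  "range_time B \<omega> = exceed_one_time (path_range (\<lambda>t. B t \<omega>))"

text \<open>
  The constant \<open>\<rr>\<close>, as a real number. The conversion \<^const>\<open>enn2real\<close> sends
  \<open>\<infinity>\<close> to \<open>0\<close>, so a positive lower bound on this number entails that the
  expectation is finite.
\<close>

definition mean_min_range_time :: "'a measure \<Rightarrow> (real \<Rightarrow> 'a \<Rightarrow> real \<times> real) \<Rightarrow> real" where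
  "mean_min_range_time M W =
     enn2real (\<integral>\<^sup>+ \<omega>. min (range_time (\<lambda>t \<omega>. fst (W t \<omega>)) \<omega>)
                          (range_time (\<lambda>t \<omega>. snd (W t \<omega>)) \<omega>) \<partial>M)"

end

theory Submission
  imports Defs
begin

text \<open>
  Both bounds are obtained for Gaussian walks sampled from \<open>W\<close> along grids, and Brownian scaling is the
  fact that the law of the normalised increments does not depend on the mesh.

  Lower bound: by scaling the mean exceedance time is the mean of \<open>1 / A(1)\<close>, hence at least \<open>1 / E A(1)\<close>
  by convexity. For a convex set with support function \<open>h\<close> the area is
  \<open>\<integral> (h(\<theta>)\<^sup>2 - h'(\<theta>)\<^sup>2) d\<theta> / 2\<close> over the circle; the part of a large disc outside the set is swept, twice, by its tangent
  half lines. In a fixed direction \<open>h\<close> is the maximum of one coordinate and \<open>h'\<close> is the value of the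
  independent other coordinate at the argmax, whose mean time is \<open>1/2\<close>. So \<open>E A(1) = \<pi> (1 - 1/2)\<close>.

  Upper bound: at the first time a coordinate range exceeds \<open>a\<close>, of mean \<open>a\<^sup>2 \<rr>\<close>, the path contains the end
  points of a chord of length at least \<open>a\<close>. The area exceeds \<open>1\<close> once the later path has range \<open>2 / a\<close>
  orthogonally to this chord, which takes mean time \<open>(2 / a)\<^sup>2 / 2\<close>. Minimise over \<open>a\<close>.
\<close>

section \<open>Lebesgue measure in the plane\<close>

text \<open>The second stage of the upper bound restarts the path at a random time and looks in a
  random direction. For a walk this strong Markov step becomes a finite computation: the event that
  the exit happens at step m with chord partner i is decided by the first m increments, which also
  fix the direction, while the later increments are independent of them and rotation invariant. The
  price is the overshoot of the walk; it is absorbed by a margin \<open>b\<close>, and the mesh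
  tends to 0 before \<open>b\<close> does. Measurability shapes the lower bound. The hull area of
  the sampled path is replaced by a measurable majorant, the value of the support function formula,
  and the exceedance time is always compared with measurable functions above or below it. The area
  formula enters as an inequality, obtained from disjointness of the swept sectors. The convexity
  step uses the tangent to 1/A at A = \<pi>/2, that is 1/A \<ge> 4/\<pi> - 4A/\<pi>^2, which
  explains the constants 4/\<pi> and 4/\<pi>^2.\<close>

lemma nn_integral_plane:
  fixes f :: "real \<times> real \<Rightarrow> ennreal"
  assumes [measurable]: "f \<in> borel_measurable borel"
  shows "(\<integral>\<^sup>+ v. f v \<partial>lborel) = (\<integral>\<^sup>+ x. \<integral>\<^sup>+ y. f (x, y) \<partial>lborel \<partial>lborel)"
    by (subst lborel_prod[symmetric], subst lborel.nn_integral_fst[symmetric])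
     (simp_all add: lborel_prod)

lemma nn_integral_plane_swap:
  fixes f :: "real \<Rightarrow> real \<Rightarrow> ennreal"
  assumes [measurable]: "case_prod f \<in> borel_measurable borel"
  shows "(\<integral>\<^sup>+ x. \<integral>\<^sup>+ y. f x y \<partial>lborel \<partial>lborel) = (\<integral>\<^sup>+ y. \<integral>\<^sup>+ x. f x y \<partial>lborel \<partial>lborel)"
  proof -
  have "case_prod f \<in> borel_measurable (lborel \<Otimes>\<^sub>M lborel)"
    by (simp add: lborel_prod)
  then show ?thesis
    using lborel_pair.Fubini'[of f] by simp
qed

text \<open>Gaussian elimination reduces the planar change of variables to two one-dimensional
  affine substitutions, with factors \<open>e\<close> and \<open>a\<close>, separated by exchanges
  of the order of integration. If \<open>a = 0\<close> the columns are swapped, since then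
  \<open>b\<close> cannot vanish.\<close>

lemma nn_integral_plane_linear:
  fixes f :: "real \<times> real \<Rightarrow> ennreal"
  assumes [measurable]: "f \<in> borel_measurable borel" and nz: "a * d - b * c \<noteq> 0"
  shows "(\<integral>\<^sup>+ v. f v \<partial>lborel)
    = ennreal \<bar>a * d - b * c\<bar> * (\<integral>\<^sup>+ x. \<integral>\<^sup>+ y. f (a * x + b * y, c * x + d * y) \<partial>lborel \<partial>lborel)"
proof -
  have meas: "(\<lambda>(x, y). f (a' * x + b' * y, c' * x + d' * y)) \<in> borel_measurable borel" for a' b' c' d'
    by (simp add: borel_prod[symmetric])
  have *: "(\<integral>\<^sup>+ v. f v \<partial>lborel)
    = ennreal \<bar>a * d - b * c\<bar> * (\<integral>\<^sup>+ x. \<integral>\<^sup>+ y. f (a * x + b * y, c * x + d * y) \<partial>lborel \<partial>lborel)"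
    if a: "a \<noteq> 0" and nz: "a * d - b * c \<noteq> 0" for a b c d
  proof -
    \<comment> \<open>\<open>e\<close> is the pivot left in the second row once \<open>c\<close> is
      cleared, so that \<open>c * x + d * y = c / a * (a * x + b * y) + e * y\<close>.\<close>
    define e where "e = (a * d - b * c) / a"
    have e: "e \<noteq> 0" and ae: "\<bar>a * d - b * c\<bar> = \<bar>e\<bar> * \<bar>a\<bar>"
      using a nz by (auto simp: e_def abs_divide)
    have "(\<integral>\<^sup>+ v. f v \<partial>lborel) = (\<integral>\<^sup>+ u. \<integral>\<^sup>+ w. f (u, w) \<partial>lborel \<partial>lborel)"
      by (rule nn_integral_plane) simp
    also have "\<dots> = (\<integral>\<^sup>+ u. ennreal \<bar>e\<bar> * (\<integral>\<^sup>+ y. f (u, c / a * u + e * y) \<partial>lborel) \<partial>lborel)"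
      by (intro nn_integral_cong nn_integral_real_affine e) simp
    also have "\<dots> = ennreal \<bar>e\<bar> * (\<integral>\<^sup>+ u. (\<integral>\<^sup>+ y. f (u, c / a * u + e * y) \<partial>lborel) \<partial>lborel)"
      by (intro nn_integral_cmult) simp
    also have "(\<integral>\<^sup>+ u. (\<integral>\<^sup>+ y. f (u, c / a * u + e * y) \<partial>lborel) \<partial>lborel)
        = (\<integral>\<^sup>+ y. (\<integral>\<^sup>+ u. f (u, c / a * u + e * y) \<partial>lborel) \<partial>lborel)"
      by (rule nn_integral_plane_swap) (simp add: borel_prod[symmetric])
    also have "\<dots> = (\<integral>\<^sup>+ y. ennreal \<bar>a\<bar> * (\<integral>\<^sup>+ x. f (b * y + a * x, c / a * (b * y + a * x) + e * y) \<partial>lborel) \<partial>lborel)"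
      by (intro nn_integral_cong nn_integral_real_affine a) simp
    also have "\<dots> = ennreal \<bar>a\<bar> * (\<integral>\<^sup>+ y. (\<integral>\<^sup>+ x. f (b * y + a * x, c / a * (b * y + a * x) + e * y) \<partial>lborel) \<partial>lborel)"
      by (intro nn_integral_cmult) simp
    also have "(\<integral>\<^sup>+ y. (\<integral>\<^sup>+ x. f (b * y + a * x, c / a * (b * y + a * x) + e * y) \<partial>lborel) \<partial>lborel)
       = (\<integral>\<^sup>+ y. (\<integral>\<^sup>+ x. f (a * x + b * y, c * x + d * y) \<partial>lborel) \<partial>lborel)"
      using a by (intro nn_integral_cong arg_cong[of _ _ f]) (auto simp: e_def field_simps)
    also have "\<dots> = (\<integral>\<^sup>+ x. (\<integral>\<^sup>+ y. f (a * x + b * y, c * x + d * y) \<partial>lborel) \<partial>lborel)"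
      by (rule nn_integral_plane_swap[symmetric]) (rule meas)
    finally show ?thesis
      unfolding ae by (simp add: ennreal_mult mult.assoc)
  qed
  show ?thesis
  proof (cases "a = 0")
    case False
    then show ?thesis using nz by (rule *)
  next
    case True
    then have b: "b \<noteq> 0" "b * c - a * d \<noteq> 0" using nz by auto
    have "(\<integral>\<^sup>+ x. \<integral>\<^sup>+ y. f (b * x + a * y, d * x + c * y) \<partial>lborel \<partial>lborel)
      = (\<integral>\<^sup>+ y. \<integral>\<^sup>+ x. f (b * x + a * y, d * x + c * y) \<partial>lborel \<partial>lborel)"
      by (rule nn_integral_plane_swap) (rule meas)
    with *[OF b] show ?thesis
      by (simp add: add.commute abs_minus_commute)
  qed
qed

section \<open>Triangles inside a convex hull\<close>

definition cross2 :: "real \<times> real \<Rightarrow> real \<times> real \<Rightarrow> real" where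
  "cross2 u v = fst u * snd v - snd u * fst v"

text \<open>In affine coordinates along the two edges at \<open>A\<close> the triangle is the
  standard simplex, of area 1/2; the determinant of the edges is the Jacobian.\<close>

lemma emeasure_triangle:
  assumes nz: "cross2 (B - A) (C - A) \<noteq> 0"
  shows "emeasure lborel (convex hull {A, B, C}) = ennreal (\<bar>cross2 (B - A) (C - A)\<bar> / 2)"
proof -
  define T where "T = convex hull {A, B, C}"
  define a where "a = fst (B - A)"
  define b where "b = fst (C - A)"
  define c where "c = snd (B - A)"
  define d where "d = snd (C - A)"
  have det: "a * d - b * c = cross2 (B - A) (C - A)"
    by (simp add: a_def b_def c_def d_def cross2_def mult.commute)
  have [measurable]: "T \<in> sets borel"
    unfolding T_def by (intro borel_compact compact_convex_hull) auto
  have mem: "A + (a * x + b * y, c * x + d * y) \<in> T \<longleftrightarrow> 0 \<le> x \<and> 0 \<le> y \<and> x + y \<le> 1" for x y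
  proof -
    have "A + (a * x + b * y, c * x + d * y) \<in> T \<longleftrightarrow>
       (\<exists>p q. 0 \<le> p \<and> 0 \<le> q \<and> p + q \<le> 1 \<and> A + (a * x + b * y, c * x + d * y) = A + p *\<^sub>R (B - A) + q *\<^sub>R (C - A))"
      unfolding T_def convex_hull_3_alt by (auto simp: add.assoc)
    also have "\<dots> \<longleftrightarrow> (\<exists>p q. 0 \<le> p \<and> 0 \<le> q \<and> p + q \<le> 1 \<and> p = x \<and> q = y)"
    proof (intro iff_exI conj_cong refl)
      fix p q
      have "A + (a * x + b * y, c * x + d * y) = A + p *\<^sub>R (B - A) + q *\<^sub>R (C - A) \<longleftrightarrow>
        a * (x - p) + b * (y - q) = 0 \<and> c * (x - p) + d * (y - q) = 0"
        by (auto simp: prod_eq_iff a_def b_def c_def d_def algebra_simps)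
      also have "\<dots> \<longleftrightarrow> p = x \<and> q = y"
      proof
        assume *: "a * (x - p) + b * (y - q) = 0 \<and> c * (x - p) + d * (y - q) = 0"
        have "(a * d - b * c) * (x - p) = d * (a * (x - p) + b * (y - q)) - b * (c * (x - p) + d * (y - q))"
          "(a * d - b * c) * (y - q) = a * (c * (x - p) + d * (y - q)) - c * (a * (x - p) + b * (y - q))"
          by (simp_all add: algebra_simps)
        with * nz det show "p = x \<and> q = y"
          by auto
      qed auto
      finally show "(A + (a * x + b * y, c * x + d * y) = A + p *\<^sub>R (B - A) + q *\<^sub>R (C - A)) = (p = x \<and> q = y)" .
    qed
    also have "\<dots> \<longleftrightarrow> 0 \<le> x \<and> 0 \<le> y \<and> x + y \<le> 1"
      by auto
    finally show ?thesis .
  qed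
  have "emeasure lborel T = (\<integral>\<^sup>+ v. indicator T v \<partial>lborel)"
    by simp
  also have "\<dots> = (\<integral>\<^sup>+ v. indicator T (A + v) \<partial>lborel)"
    by (subst lborel_distr_plus[of A, symmetric], subst nn_integral_distr) auto
  also have "\<dots> = ennreal \<bar>a * d - b * c\<bar> *
      (\<integral>\<^sup>+ x. \<integral>\<^sup>+ y. indicator T (A + (a * x + b * y, c * x + d * y)) \<partial>lborel \<partial>lborel)"
    using nz det by (intro nn_integral_plane_linear) auto
  also have "(\<integral>\<^sup>+ x. \<integral>\<^sup>+ y. indicator T (A + (a * x + b * y, c * x + d * y)) \<partial>lborel \<partial>lborel)
     = (\<integral>\<^sup>+ x. \<integral>\<^sup>+ y. indicator {0..1} x * indicator {0..1-x::real} y \<partial>lborel \<partial>lborel)"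
    by (intro nn_integral_cong) (auto simp: indicator_def mem)
  also have "\<dots> = (\<integral>\<^sup>+ x. ennreal (1 - x) * indicator {0..1} x \<partial>lborel)"
    by (intro nn_integral_cong) (auto simp: nn_integral_cmult split: split_indicator)
  also have "\<dots> = ennreal ((1 - 1\<^sup>2/2) - (0 - 0\<^sup>2/2))"
    by (intro nn_integral_FTC_Icc[where F="\<lambda>x. x - x\<^sup>2/2"]) (auto intro!: derivative_eq_intros)
  finally have "emeasure lborel T = ennreal (\<bar>a * d - b * c\<bar> * ((1 - 1\<^sup>2/2) - (0 - 0\<^sup>2/2)))"
    by (subst ennreal_mult) auto
  then show ?thesis
    unfolding T_def det by (simp only:) simp
qed

lemma emeasure_triangle_le:
  "ennreal (\<bar>cross2 (B - A) (C - A)\<bar> / 2) \<le> emeasure lborel (convex hull {A, B, C})"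
  by (cases "cross2 (B - A) (C - A) = 0") (auto simp: emeasure_triangle)

text \<open>\<open>L X\<close> is the signed height of \<open>X\<close> over the line
  \<open>AB\<close>, times the length of \<open>AB\<close>. If \<open>P\<close> and \<open>Q\<close>
  lie strictly on opposite sides, the triangles \<open>ABP\<close> and \<open>ABQ\<close> meet only
  in that line and their areas add. Otherwise the larger of the two triangles alone has enough
  area.\<close>

lemma hull_area_ge_cross2:
  fixes S :: "(real \<times> real) set"
  assumes S: "A \<in> S" "B \<in> S" "P \<in> S" "Q \<in> S" and meas: "convex hull S \<in> sets borel"
  shows "ennreal (\<bar>cross2 (B - A) (P - Q)\<bar> / 2) \<le> emeasure lborel (convex hull S)"
proof -
  define L where "L X = cross2 (B - A) (X - A)" for X
  have L: "cross2 (B - A) (P - Q) = L P - L Q"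
    by (simp add: L_def cross2_def algebra_simps)
  have sub: "convex hull {A, B, X} \<subseteq> convex hull S" if "X \<in> S" for X
    using S that by (intro hull_mono) auto
  have one: "ennreal (\<bar>L X\<bar> / 2) \<le> emeasure lborel (convex hull S)" if "X \<in> S" for X
    using emeasure_triangle_le[of B A X] emeasure_mono[OF sub[OF that], of lborel] meas
    by (auto simp: L_def)
  have tri[measurable]: "convex hull {A, B, X} \<in> sets borel" for X
    by (intro borel_compact compact_convex_hull) auto
  have two: "ennreal ((L X - L Y) / 2) \<le> emeasure lborel (convex hull S)"
    if X: "X \<in> S" "L X > 0" and Y: "Y \<in> S" "L Y < 0" for X Y
  proof -
    have AB: "A \<noteq> B" using X by (auto simp: L_def cross2_def)
    have Lform: "L Z = (- snd (B - A), fst (B - A)) \<bullet> Z - (- snd (B - A), fst (B - A)) \<bullet> A" for Z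
      by (simp add: L_def cross2_def inner_prod_def algebra_simps)
    define H where "H = {Z. (- snd (B - A), fst (B - A)) \<bullet> Z = (- snd (B - A), fst (B - A)) \<bullet> A}"
    have "negligible H"
      unfolding H_def using AB by (intro negligible_hyperplane) (auto simp: prod_eq_iff)
    moreover have "closed H" unfolding H_def by (rule closed_hyperplane)
    ultimately have H: "H \<in> null_sets lborel"
      by (auto simp: negligible_iff_null_sets null_sets_def borel_closed)
    have LAB: "L A = 0" "L B = 0"
      by (simp_all add: L_def cross2_def)
    have half: "{Z. L Z \<ge> 0} = {Z. (- snd (B - A), fst (B - A)) \<bullet> Z \<ge> (- snd (B - A), fst (B - A)) \<bullet> A}"
      "{Z. L Z \<le> 0} = {Z. (- snd (B - A), fst (B - A)) \<bullet> Z \<le> (- snd (B - A), fst (B - A)) \<bullet> A}"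
      unfolding Lform by auto
    have "convex {Z. L Z \<ge> 0}" "convex {Z. L Z \<le> 0}"
      by (simp_all only: half convex_halfspace_ge convex_halfspace_le)
    then have "convex hull {A, B, X} \<subseteq> {Z. L Z \<ge> 0}" "convex hull {A, B, Y} \<subseteq> {Z. L Z \<le> 0}"
      using X Y LAB by (intro hull_minimal; simp)+
    then have int: "convex hull {A, B, X} \<inter> convex hull {A, B, Y} \<subseteq> H"
      by (force simp: H_def Lform)
    have "ennreal ((L X - L Y) / 2) = emeasure lborel (convex hull {A, B, X}) + emeasure lborel (convex hull {A, B, Y})"
      using X Y by (auto simp: emeasure_triangle L_def ennreal_plus[symmetric] simp del: ennreal_plus)
    also have "\<dots> = emeasure lborel (convex hull {A, B, X}) + emeasure lborel (convex hull {A, B, Y} - H)"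
      using H by (simp add: emeasure_Diff_null_set)
    also have "\<dots> = emeasure lborel (convex hull {A, B, X} \<union> (convex hull {A, B, Y} - H))"
      using int H by (intro plus_emeasure) (auto simp: null_sets_def)
    also have "\<dots> \<le> emeasure lborel (convex hull S)"
      using sub[OF X(1)] sub[OF Y(1)] meas by (intro emeasure_mono) auto
    finally show ?thesis .
  qed
  consider "L P > 0" "L Q < 0" | "L P < 0" "L Q > 0" | "\<bar>L P - L Q\<bar> \<le> \<bar>L P\<bar>" | "\<bar>L P - L Q\<bar> \<le> \<bar>L Q\<bar>"
    by linarith
  then show ?thesis
  proof cases
    case 1 then show ?thesis using two[of P Q] S by (auto simp: L)
  next
    case 2 then show ?thesis using two[of Q P] S by (auto simp: L abs_if)
  next
    case 3 then show ?thesis using one[of P] S unfolding L by (meson divide_right_mono ennreal_leI order_trans zero_le_numeral)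
  next
    case 4 then show ?thesis using one[of Q] S unfolding L by (meson divide_right_mono ennreal_leI order_trans zero_le_numeral)
  qed
qed

text \<open>The integrand is the derivative of the angle with respect to the slope, and the slopes
  cover a half circle of directions.\<close>

lemma nn_integral_cauchy: "(\<integral>\<^sup>+ s. ennreal (1 / (1 + s\<^sup>2)) \<partial>lborel) = ennreal pi"
proof -
  have half: "(\<integral>\<^sup>+ s. ennreal (1 / (1 + s\<^sup>2)) * indicator {0..} s \<partial>lborel) = ennreal (pi / 2)"
    by (subst nn_integral_FTC_atLeast[where F=arctan and T="pi/2"])
       (auto intro!: derivative_eq_intros tendsto_arctan_at_top simp: add_nonneg_eq_0_iff inverse_eq_divide)
  have "(\<integral>\<^sup>+ s. ennreal (1 / (1 + s\<^sup>2)) * indicator {..<0} s \<partial>lborel)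
     = (\<integral>\<^sup>+ s. ennreal (1 / (1 + s\<^sup>2)) * indicator {0<..} s \<partial>lborel)"
    by (subst nn_integral_real_affine[where c="-1" and t=0]) (auto intro!: nn_integral_cong simp: indicator_def)
  also have "\<dots> = (\<integral>\<^sup>+ s. ennreal (1 / (1 + s\<^sup>2)) * indicator {0..} s \<partial>lborel)"
    using AE_lborel_singleton[of "0::real"]
    by (intro nn_integral_cong_AE) (auto simp: indicator_def elim!: eventually_mono)
  finally have neg: "(\<integral>\<^sup>+ s. ennreal (1 / (1 + s\<^sup>2)) * indicator {..<0} s \<partial>lborel) = ennreal (pi / 2)"
    using half by simp
  have "(\<integral>\<^sup>+ s. ennreal (1 / (1 + s\<^sup>2)) \<partial>lborel) =
     (\<integral>\<^sup>+ s. ennreal (1 / (1 + s\<^sup>2)) * indicator {0..} s + ennreal (1 / (1 + s\<^sup>2)) * indicator {..<0} s \<partial>lborel)"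
    by (intro nn_integral_cong) (auto simp: indicator_def)
  also have "\<dots> = ennreal (pi / 2) + ennreal (pi / 2)"
    by (subst nn_integral_add) (auto simp: half neg)
  finally show ?thesis
    by (simp add: ennreal_plus[symmetric] del: ennreal_plus)
qed

section \<open>Area of a convex hull by sweeping tangents\<close>

text \<open>Ties go to the last index, so every sequence has exactly one such \<open>j\<close>. Sums
  of terms guarded by \<open>last_max\<close> then select a single term for every outcome, not
  merely almost surely.\<close>

definition last_max :: "nat \<Rightarrow> (nat \<Rightarrow> real) \<Rightarrow> nat \<Rightarrow> bool" where
  "last_max n f j \<longleftrightarrow> j \<le> n \<and> (\<forall>i\<le>n. f i \<le> f j) \<and> (\<forall>i\<le>n. j < i \<longrightarrow> f i < f j)"

lemma last_max_unique: "last_max n f i \<Longrightarrow> last_max n f j \<Longrightarrow> i = j"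
  unfolding last_max_def by (metis leD linorder_neqE_nat)

lemma last_max_exists: "\<exists>j. last_max n f j"
proof -
  define A where "A = {j. j \<le> n \<and> (\<forall>i\<le>n. f i \<le> f j)}"
  have fin: "finite A" unfolding A_def by (rule finite_subset[of _ "{..n}"]) auto
  have "Max (f ` {..n}) \<in> f ` {..n}" by (intro Max_in) auto
  then obtain j where "j \<le> n" "f j = Max (f ` {..n})" by fastforce
  then have "j \<in> A" by (auto simp: A_def)
  define m where "m = Max A"
  have m: "m \<in> A" and ub: "i \<in> A \<Longrightarrow> i \<le> m" for i
    unfolding m_def using fin \<open>j \<in> A\<close> Max_in[of A] by (metis empty_iff, simp)
  have "f i < f m" if i: "i \<le> n" "m < i" for i
  proof (rule ccontr)
    assume "\<not> f i < f m"
    then have "f k \<le> f i" if "k \<le> n" for k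
      using m that unfolding A_def by (auto intro: order_trans)
    then have "i \<in> A" using i by (auto simp: A_def)
    with ub i show False by force
  qed
  with m have "last_max n f m" by (auto simp: last_max_def A_def)
  then show ?thesis by blast
qed

lemma sum_last_max:
  fixes g :: "nat \<Rightarrow> 'a :: comm_monoid_add"
  assumes "last_max n f j"
  shows "(\<Sum>i\<le>n. if last_max n f i then g i else 0) = g j"
proof -
  have "(\<Sum>i\<le>n. if last_max n f i then g i else 0) = (\<Sum>i\<le>n. if i = j then g i else 0)"
    using last_max_unique[of n f _ j] assms by (intro sum.cong if_cong) blast+
  also have "\<dots> = g j"
    using assms by (simp add: last_max_def)
  finally show ?thesis .
qed

text \<open>The line through \<open>(x, y)\<close> with slope \<open>s\<close>, parametrised by the
  horizontal displacement \<open>r\<close>, meets the disc in the interval around \<open>- p\<close>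
  of half length \<open>q\<close>. As \<open>(x, y)\<close> lies in the disc, 0 belongs to this
  interval and the integral is \<open>p\<^sup>2 + q\<^sup>2\<close>. The right side is written with
  the normal and tangential components of \<open>(x, y)\<close> for the slope \<open>s\<close>,
  which become h and h' at a point of tangency.\<close>

lemma nn_integral_abs_chord:
  fixes x y s R :: real
  assumes "x\<^sup>2 + y\<^sup>2 \<le> R"
  shows "(\<integral>\<^sup>+ r. ennreal \<bar>r\<bar> * indicator {r. (x + r)\<^sup>2 + (y + r * s)\<^sup>2 \<le> R} r \<partial>lborel)
    = ennreal ((R - (y - s * x)\<^sup>2 / (1 + s\<^sup>2) + (x + s * y)\<^sup>2 / (1 + s\<^sup>2)) / (1 + s\<^sup>2))"
proof -
  define c where "c = 1 + s\<^sup>2"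
  have c: "c > 0" by (simp add: c_def add_pos_nonneg)
  define p where "p = (x + s * y) / c"
  define q where "q = sqrt (p\<^sup>2 + (R - x\<^sup>2 - y\<^sup>2) / c)"
  have rad: "0 \<le> p\<^sup>2 + (R - x\<^sup>2 - y\<^sup>2) / c" using assms c by auto
  have q2: "q\<^sup>2 = p\<^sup>2 + (R - x\<^sup>2 - y\<^sup>2) / c" unfolding q_def using rad by simp
  have qp: "\<bar>p\<bar> \<le> q" unfolding q_def using assms c by (intro real_le_rsqrt) auto
  have eq: "{r. (x + r)\<^sup>2 + (y + r * s)\<^sup>2 \<le> R} = {- p - q .. - p + q}"
  proof -
    have "(x + r)\<^sup>2 + (y + r * s)\<^sup>2 \<le> R \<longleftrightarrow> - p - q \<le> r \<and> r \<le> - p + q" for r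
    proof -
      have cp: "c * p = x + s * y" using c by (simp add: p_def)
      have "c * q\<^sup>2 = c * p\<^sup>2 + (R - x\<^sup>2 - y\<^sup>2)" using c by (simp add: q2 distrib_left)
      then have "(x + r)\<^sup>2 + (y + r * s)\<^sup>2 - R = c * r\<^sup>2 + 2 * r * (c * p) + c * p\<^sup>2 - c * q\<^sup>2"
        unfolding cp by (simp add: c_def power2_eq_square algebra_simps)
      also have "\<dots> = c * ((r + p)\<^sup>2 - q\<^sup>2)"
        by (simp add: power2_eq_square algebra_simps)
      finally have "(x + r)\<^sup>2 + (y + r * s)\<^sup>2 \<le> R \<longleftrightarrow> c * ((r + p)\<^sup>2 - q\<^sup>2) \<le> 0" by linarith
      also have "\<dots> \<longleftrightarrow> (r + p)\<^sup>2 \<le> q\<^sup>2" using c by (simp add: mult_le_0_iff)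
      also have "\<dots> \<longleftrightarrow> \<bar>r + p\<bar> \<le> q" using qp abs_le_square_iff[of "r + p" q] by auto
      finally show ?thesis by auto
    qed
    then show ?thesis by (intro set_eqI) (simp only: mem_Collect_eq atLeastAtMost_iff)
  qed
  have "(\<integral>\<^sup>+ r. ennreal \<bar>r\<bar> * indicator {- p - q .. - p + q} r \<partial>lborel)
     = (\<integral>\<^sup>+ r. ennreal (-r) * indicator {- p - q .. 0} r + ennreal r * indicator {0 .. - p + q} r \<partial>lborel)"
    using qp by (intro nn_integral_cong) (auto split: split_indicator)
  also have "\<dots> = (\<integral>\<^sup>+ r. ennreal (-r) * indicator {- p - q .. 0} r \<partial>lborel) + (\<integral>\<^sup>+ r. ennreal r * indicator {0 .. - p + q} r \<partial>lborel)"
    by (intro nn_integral_add) auto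
  also have "(\<integral>\<^sup>+ r. ennreal (-r) * indicator {- p - q .. 0} r \<partial>lborel) = ennreal (- 0\<^sup>2/2 - (- (- p - q)\<^sup>2/2))"
    using qp by (intro nn_integral_FTC_Icc[where F="\<lambda>x. - x\<^sup>2/2"]) (auto intro!: derivative_eq_intros)
  also have "(\<integral>\<^sup>+ r. ennreal r * indicator {0 .. - p + q} r \<partial>lborel) = ennreal ((- p + q)\<^sup>2/2 - 0\<^sup>2/2)"
    using qp by (intro nn_integral_FTC_Icc[where F="\<lambda>x. x\<^sup>2/2"]) (auto intro!: derivative_eq_intros)
  also have "ennreal (- 0\<^sup>2/2 - (- (- p - q)\<^sup>2/2)) + ennreal ((- p + q)\<^sup>2/2 - 0\<^sup>2/2) = ennreal (p\<^sup>2 + q\<^sup>2)"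
  proof -
    have "- 0\<^sup>2/2 - (- (- p - q)\<^sup>2/2) = (p + q)\<^sup>2 / 2" "(- p + q)\<^sup>2/2 - 0\<^sup>2/2 = (p - q)\<^sup>2 / 2"
      "p\<^sup>2 + q\<^sup>2 = (p + q)\<^sup>2 / 2 + (p - q)\<^sup>2 / 2"
      by (simp_all add: power2_eq_square field_simps)
    then show ?thesis by (simp only: ennreal_plus zero_le_power2 divide_nonneg_pos zero_less_numeral)
  qed
  also have "p\<^sup>2 + q\<^sup>2 = (R - (y - s * x)\<^sup>2 / (1 + s\<^sup>2) + (x + s * y)\<^sup>2 / (1 + s\<^sup>2)) / (1 + s\<^sup>2)"
  proof -
    define u where "u = (x + s * y)\<^sup>2"
    have "(y - s * x)\<^sup>2 = c * (x\<^sup>2 + y\<^sup>2) - u"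
      by (simp add: c_def u_def power2_eq_square algebra_simps)
    then have *: "(y - s * x)\<^sup>2 / c = x\<^sup>2 + y\<^sup>2 - u / c"
      using c by (simp add: diff_divide_distrib)
    have "p\<^sup>2 = u / c / c"
      by (simp add: p_def u_def power_divide power2_eq_square)
    then show ?thesis
      unfolding q2 c_def[symmetric] u_def[symmetric] *
      by (simp add: add_divide_distrib diff_divide_distrib)
  qed
  finally show ?thesis unfolding eq .
qed

text \<open>Polar coordinates around \<open>x\<close>, with directions measured by their slope.\<close>

lemma emeasure_sector_pair:
  fixes x :: "real \<times> real" and R :: real and C :: "real set"
  assumes C[measurable]: "C \<in> sets borel" and x: "fst x ^ 2 + snd x ^ 2 \<le> R"
  defines "S \<equiv> \<lambda>\<epsilon>. {y. 0 < \<epsilon> * (fst y - fst x) \<and> (snd y - snd x) / (fst y - fst x) \<in> C \<and> fst y ^ 2 + snd y ^ 2 \<le> R}"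
  shows "S \<epsilon> \<in> sets borel"
    and "emeasure lborel (S 1) + emeasure lborel (S (-1)) =
     (\<integral>\<^sup>+ s. ennreal ((R - (snd x - s * fst x)\<^sup>2 / (1 + s\<^sup>2) + (fst x + s * snd x)\<^sup>2 / (1 + s\<^sup>2)) / (1 + s\<^sup>2))
        * indicator C s \<partial>lborel)"
proof -
  have S_meas[measurable]: "S \<epsilon> \<in> sets borel" for \<epsilon>
  proof -
    have "S \<epsilon> = {y\<in>space (borel \<Otimes>\<^sub>M borel). 0 < \<epsilon> * (fst y - fst x) \<and> (snd y - snd x) / (fst y - fst x) \<in> C \<and> fst y ^ 2 + snd y ^ 2 \<le> R}"
      by (simp add: S_def space_pair_measure)
    also have "\<dots> \<in> sets (borel \<Otimes>\<^sub>M borel)"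
      by measurable
    finally show ?thesis unfolding borel_prod .
  qed
  then show "S \<epsilon> \<in> sets borel" .
  have "emeasure lborel (S 1) + emeasure lborel (S (-1)) = emeasure lborel (S 1 \<union> S (-1))"
    by (intro plus_emeasure) (auto simp del: mult_1 mult_minus1, auto simp: S_def)
  also have "\<dots> = (\<integral>\<^sup>+ u. \<integral>\<^sup>+ w. indicator (S 1 \<union> S (-1)) (u, w) \<partial>lborel \<partial>lborel)"
    by (subst nn_integral_plane[symmetric]) auto
  also have "\<dots> = (\<integral>\<^sup>+ r. \<integral>\<^sup>+ w. indicator (S 1 \<union> S (-1)) (fst x + 1 * r, w) \<partial>lborel \<partial>lborel)"
    by (subst nn_integral_real_affine[of _ 1 "fst x"]) auto
  also have "\<dots> = (\<integral>\<^sup>+ r. \<integral>\<^sup>+ s. ennreal \<bar>r\<bar> * (indicator {r. (fst x + r)\<^sup>2 + (snd x + r * s)\<^sup>2 \<le> R} r * indicator C s) \<partial>lborel \<partial>lborel)"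
  proof (rule nn_integral_cong_AE, rule AE_mp[OF AE_lborel_singleton[of 0]], intro AE_I2 impI)
    fix r :: real assume r: "r \<noteq> 0"
    have "(\<integral>\<^sup>+ w. indicator (S 1 \<union> S (-1)) (fst x + 1 * r, w) \<partial>lborel)
      = ennreal \<bar>r\<bar> * (\<integral>\<^sup>+ s. indicator (S 1 \<union> S (-1)) (fst x + 1 * r, snd x + r * s) \<partial>lborel)"
      by (rule nn_integral_real_affine) (auto simp: r)
    also have "(\<lambda>s. indicator (S 1 \<union> S (-1)) (fst x + 1 * r, snd x + r * s))
      = (\<lambda>s. indicator {r. (fst x + r)\<^sup>2 + (snd x + r * s)\<^sup>2 \<le> R} r * indicator C s :: ennreal)"
      using r by (auto simp: fun_eq_iff indicator_def S_def)
    also have "ennreal \<bar>r\<bar> * (\<integral>\<^sup>+ s. indicator {r. (fst x + r)\<^sup>2 + (snd x + r * s)\<^sup>2 \<le> R} r * indicator C s \<partial>lborel)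
      = (\<integral>\<^sup>+ s. ennreal \<bar>r\<bar> * (indicator {r. (fst x + r)\<^sup>2 + (snd x + r * s)\<^sup>2 \<le> R} r * indicator C s) \<partial>lborel)"
      by (subst nn_integral_cmult) (auto simp: indicator_def)
    finally show "(\<integral>\<^sup>+ w. indicator (S 1 \<union> S (-1)) (fst x + 1 * r, w) \<partial>lborel)
      = (\<integral>\<^sup>+ s. ennreal \<bar>r\<bar> * (indicator {r. (fst x + r)\<^sup>2 + (snd x + r * s)\<^sup>2 \<le> R} r * indicator C s) \<partial>lborel)" .
  qed
  also have "\<dots> = (\<integral>\<^sup>+ s. \<integral>\<^sup>+ r. ennreal \<bar>r\<bar> * (indicator {r. (fst x + r)\<^sup>2 + (snd x + r * s)\<^sup>2 \<le> R} r * indicator C s) \<partial>lborel \<partial>lborel)"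
    by (rule nn_integral_plane_swap) (simp add: borel_prod[symmetric] indicator_def)
  also have "\<dots> = (\<integral>\<^sup>+ s. ennreal ((R - (snd x - s * fst x)\<^sup>2 / (1 + s\<^sup>2) + (fst x + s * snd x)\<^sup>2 / (1 + s\<^sup>2)) / (1 + s\<^sup>2))
        * indicator C s \<partial>lborel)"
    by (intro nn_integral_cong, subst nn_integral_abs_chord[OF x, symmetric], subst nn_integral_multc[symmetric])
       (auto simp: mult.assoc)
  finally show "emeasure lborel (S 1) + emeasure lborel (S (-1)) =
     (\<integral>\<^sup>+ s. ennreal ((R - (snd x - s * fst x)\<^sup>2 / (1 + s\<^sup>2) + (fst x + s * snd x)\<^sup>2 / (1 + s\<^sup>2)) / (1 + s\<^sup>2))
        * indicator C s \<partial>lborel)" .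
qed


lemma measurable_last_max[measurable]:
  assumes "\<And>i. i \<le> n \<Longrightarrow> (\<lambda>w. f w i) \<in> borel_measurable N"
  shows "Measurable.pred N (\<lambda>w. last_max n (f w) j)"
proof (cases "j \<le> n")
  case True
  have "Measurable.pred N (\<lambda>w. \<forall>i\<in>{..n}. f w i \<le> f w j)" "Measurable.pred N (\<lambda>w. \<forall>i\<in>{j<..n}. f w i < f w j)"
    using assms True by (auto intro!: pred_intros_finite borel_measurable_pred_less borel_measurable_le borel_measurable_less simp: pred_def)
  moreover have "(\<lambda>w. last_max n (f w) j) = (\<lambda>w. (\<forall>i\<in>{..n}. f w i \<le> f w j) \<and> (\<forall>i\<in>{j<..n}. f w i < f w j))"
    using True by (auto simp: last_max_def fun_eq_iff)
  ultimately show ?thesis by simp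
qed (simp add: last_max_def)

text \<open>For each \<open>\<tau>\<close> the sectors
  \<open>S (\<tau> * \<sigma>) \<sigma> j\<close> avoid the hull and one another up to its frontier,
  a null set, so their total area is at most that of \<open>D - P\<close>. The two values of
  \<open>\<tau>\<close> together account for both half lines of every tangent, and twice the disc
  has area \<open>2 * pi * R\<close>.\<close>

lemma emeasure_hull_sweep:
  fixes x :: "nat \<Rightarrow> real \<times> real"
  assumes R: "\<And>k. k \<le> n \<Longrightarrow> (fst (x k))\<^sup>2 + (snd (x k))\<^sup>2 \<le> R"
  defines "v \<equiv> \<lambda>\<sigma> s k. \<sigma> * (snd (x k) - s * fst (x k))"
  shows "2 * emeasure lborel (convex hull (x ` {..n})) +
     (\<Sum>\<sigma>\<in>{1,-1}. \<Sum>j\<le>n. \<integral>\<^sup>+ s. ennreal ((R - (snd (x j) - s * fst (x j))\<^sup>2 / (1 + s\<^sup>2)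
          + (fst (x j) + s * snd (x j))\<^sup>2 / (1 + s\<^sup>2)) / (1 + s\<^sup>2)) * indicator {s. last_max n (v \<sigma> s) j} s \<partial>lborel)
     \<le> ennreal (2 * pi * R)"
proof -
  define P where "P = convex hull (x ` {..n})"
  define D where "D = cball (0 :: real \<times> real) (sqrt R)"
  define C where "C = (\<lambda>\<sigma> j. {s. last_max n (v \<sigma> s) j})"
  define S where "S = (\<lambda>\<epsilon> \<sigma> j. {y. 0 < \<epsilon> * (fst y - fst (x j)) \<and> (snd y - snd (x j)) / (fst y - fst (x j)) \<in> C \<sigma> j
      \<and> (fst y)\<^sup>2 + (snd y)\<^sup>2 \<le> R})"
  have R0: "0 \<le> R" using R[of 0] by (meson le0 order_trans sum_power2_ge_zero)
  have compP: "compact P" unfolding P_def by (intro compact_convex_hull finite_imp_compact) auto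
  have [measurable]: "P \<in> sets borel" "D \<in> sets borel"
    using compP by (auto simp: D_def borel_compact)
  have memD: "y \<in> D \<longleftrightarrow> (fst y)\<^sup>2 + (snd y)\<^sup>2 \<le> R" for y
    using R0 by (cases y) (auto simp: D_def norm_Pair real_sqrt_le_iff)
  have PD: "P \<subseteq> D"
    unfolding P_def using R by (intro hull_minimal) (auto simp: memD D_def[symmetric] intro: convex_cball, simp add: D_def convex_cball)
  have xP: "x k \<in> P" if "k \<le> n" for k
    unfolding P_def using that by (intro hull_inc) auto
  have C[measurable]: "C \<sigma> j \<in> sets borel" for \<sigma> j
  proof -
    have "C \<sigma> j = {s\<in>space borel. last_max n (v \<sigma> s) j}" by (simp add: C_def)
    also have "\<dots> \<in> sets borel" unfolding v_def by measurable
    finally show ?thesis .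
  qed
  have S[measurable]: "S \<epsilon> \<sigma> j \<in> sets borel" if "j \<le> n" for \<epsilon> \<sigma> j
    using emeasure_sector_pair(1)[OF C R[OF that]] unfolding S_def .
  have fr: "frontier P \<in> null_sets lborel"
    using negligible_convex_frontier[of P] convex_convex_hull
    by (auto simp: P_def negligible_iff_null_sets null_sets_def borel_closed frontier_closed)
  have E: "emeasure lborel D = ennreal (pi * R)"
    using R0 by (simp add: D_def emeasure_cball eval_unit_ball_vol)

  have rep: "\<exists>s r. y = x j + (r, r * s) \<and> 0 < \<tau> * \<sigma> * r \<and> last_max n (v \<sigma> s) j"
    if "y \<in> S (\<tau> * \<sigma>) \<sigma> j" for \<tau> \<sigma> y j
    using that
    by (intro exI[of _ "(snd y - snd (x j)) / (fst y - fst (x j))"] exI[of _ "fst y - fst (x j)"])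
       (auto simp: S_def C_def prod_eq_iff)
  have below: "\<sigma> * ((- s, 1) \<bullet> z) \<le> \<sigma> * ((- s, 1) \<bullet> y)"
    if "y = x j + (r, r * s)" "last_max n (v \<sigma> s) j" "z \<in> P" for y s r j \<sigma> z
  proof -
    define w where "w = \<sigma> *\<^sub>R (- s, 1 :: real)"
    have "P \<subseteq> {z. w \<bullet> z \<le> w \<bullet> y}"
      unfolding P_def
    proof (rule hull_minimal)
      show "x ` {..n} \<subseteq> {z. w \<bullet> z \<le> w \<bullet> y}"
        using that(1,2) by (auto simp: w_def inner_prod_def last_max_def v_def algebra_simps)
    qed (rule convex_halfspace_le)
    with that(3) have "w \<bullet> z \<le> w \<bullet> y" by blast
    then show ?thesis by (simp add: w_def del: scaleR_Pair)
  qed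
  have outside: "y \<notin> interior P" if y: "y = x j + (r, r * s)" and L: "last_max n (v \<sigma> s) j" and \<sigma>: "\<sigma> \<in> {1, -1}" for y s r j \<sigma>
  proof
    assume "y \<in> interior P"
    then obtain e where e: "e > 0" "ball y e \<subseteq> P" by (auto simp: mem_interior)
    define z where "z = y + (0, \<sigma> * (e / 2))"
    have "z \<in> P" using e \<sigma> by (intro subsetD[OF e(2)]) (auto simp: z_def dist_norm norm_Pair)
    from below[OF y L this] \<sigma> e(1) show False
      by (auto simp: z_def inner_prod_def algebra_simps)
  qed
  \<comment> \<open>\<open>\<sigma>\<close> tells on which side of the tangent the hull lies. For fixed \<open>\<tau>\<close>, only one of the two tangents
    through an outer point reaches it on the half line of sign \<open>\<tau> * \<sigma>\<close>.\<close>
  have sep: "\<sigma> = \<sigma>' \<and> j = j'"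
    if S1: "y \<in> S (\<tau> * \<sigma>) \<sigma> j" and S2: "y \<in> S (\<tau> * \<sigma>') \<sigma>' j'" and nf: "y \<notin> frontier P"
      and \<sigma>: "\<sigma> \<in> {1, -1}" "\<sigma>' \<in> {1, -1}" "\<tau> \<in> {1, -1}" for \<tau> \<sigma> \<sigma>' y j j'
  proof -
    obtain s r where 1: "y = x j + (r, r * s)" "0 < \<tau> * \<sigma> * r" "last_max n (v \<sigma> s) j"
      using rep[OF S1] by blast
    obtain s' r' where 2: "y = x j' + (r', r' * s')" "0 < \<tau> * \<sigma>' * r'" "last_max n (v \<sigma>' s') j'"
      using rep[OF S2] by blast
    have j: "j \<le> n" "j' \<le> n" using 1 2 by (auto simp: last_max_def)
    have "\<sigma> * ((- s, 1) \<bullet> (y - x j')) \<ge> 0" "\<sigma>' * ((- s', 1) \<bullet> (y - x j)) \<ge> 0"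
      using below[OF 1(1,3) xP[OF j(2)]] below[OF 2(1,3) xP[OF j(1)]]
      by (auto simp: inner_diff_right right_diff_distrib)
    moreover have "y - x j' = (r', r' * s')" "y - x j = (r, r * s)"
      using 1(1) 2(1) by (metis add_diff_cancel_left')+
    ultimately have ge: "\<sigma> * r' * (s' - s) \<ge> 0" "\<sigma>' * r * (s - s') \<ge> 0"
      by (auto simp: inner_prod_def algebra_simps)
    \<comment> \<open>\<open>\<sigma> * r'\<close> and \<open>\<sigma>' * r\<close> both have the
      sign of \<open>\<tau> * \<sigma> * \<sigma>'\<close>, so the two inequalities bound
      \<open>s' - s\<close> by 0 from both sides.\<close>
    have s: "s = s'"
      using ge \<sigma> 1(2) 2(2) by (auto simp: zero_le_mult_iff mult_le_0_iff)
    show ?thesis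
    proof (cases "\<sigma> = \<sigma>'")
      case True
      then show ?thesis using 1(3) 2(3) s last_max_unique by blast
    next
      case False
      then have rr: "r * r' < 0"
        using \<sigma> 1(2) 2(2) by (auto simp: mult_less_0_iff zero_less_mult_iff)
      \<comment> \<open>Equal slopes and opposite signs of \<open>r\<close> and \<open>r'\<close>
        put \<open>y\<close> on the segment between the two points of tangency; \<open>u\<close> is
        the weight that cancels the two displacements.\<close>
      define u where "u = r' / (r' - r)"
      have u: "0 \<le> u" "u \<le> 1" "r' - r \<noteq> 0"
        using rr by (auto simp: u_def field_simps zero_le_divide_iff divide_le_eq mult_less_0_iff)
      have "u * r + (1 - u) * r' = r' - u * (r' - r)" by (simp add: algebra_simps)
      also have "\<dots> = 0" using u(3) by (simp add: u_def)
      finally have "u * r + (1 - u) * r' = 0" .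
      moreover have "u * (r * s) + (1 - u) * (r' * s) = (u * r + (1 - u) * r') * s" by (simp add: algebra_simps)
      ultimately have z: "u *\<^sub>R (r, r * s) + (1 - u) *\<^sub>R (r', r' * s) = (0::real\<times>real)"
        by (simp add: prod_eq_iff)
      have "y = u *\<^sub>R y + (1 - u) *\<^sub>R y" by (simp add: algebra_simps)
      also have "\<dots> = u *\<^sub>R (x j + (r, r * s)) + (1 - u) *\<^sub>R (x j' + (r', r' * s))"
        using 1(1) 2(1) s by metis
      also have "\<dots> = u *\<^sub>R x j + (1 - u) *\<^sub>R x j' + (u *\<^sub>R (r, r * s) + (1 - u) *\<^sub>R (r', r' * s))"
        by (simp only: scaleR_add_right) (simp add: add_ac)
      finally have "y = u *\<^sub>R x j + (1 - u) *\<^sub>R x j'" unfolding z by simp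
      moreover have "\<dots> \<in> P"
        using convexD[of P "x j" "x j'" u "1 - u"] xP j u convex_convex_hull by (auto simp: P_def)
      ultimately have "y \<in> P" by simp
      moreover have "y \<notin> interior P" using outside[OF 1(1,3)] \<sigma> by blast
      ultimately have "y \<in> frontier P"
        using compact_imp_closed[OF compP] by (simp add: frontier_def)
      with nf show ?thesis by blast
    qed
  qed
  have sweep: "(\<Sum>\<sigma>\<in>{1,-1}. \<Sum>j\<le>n. emeasure lborel (S (\<tau> * \<sigma>) \<sigma> j)) \<le> emeasure lborel (D - P)"
    if \<tau>: "\<tau> \<in> {1, -1}" for \<tau>
  proof -
    define I where "I = {1, -1 :: real} \<times> {..n}"
    define T where "T = (\<lambda>(\<sigma>, j). S (\<tau> * \<sigma>) \<sigma> j - frontier P)"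
    have "(\<Sum>\<sigma>\<in>{1,-1}. \<Sum>j\<le>n. emeasure lborel (S (\<tau> * \<sigma>) \<sigma> j)) = (\<Sum>(\<sigma>, j)\<in>I. emeasure lborel (S (\<tau> * \<sigma>) \<sigma> j))"
      unfolding I_def by (rule sum.cartesian_product)
    also have "\<dots> = (\<Sum>a\<in>I. emeasure lborel (T a))"
      using fr S by (intro sum.cong) (auto simp: T_def I_def emeasure_Diff_null_set)
    also have "\<dots> = emeasure lborel (\<Union>a\<in>I. T a)"
    proof (rule sum_emeasure)
      show "disjoint_family_on T I"
        unfolding disjoint_family_on_def
      proof (intro ballI impI)
        fix a b assume ab: "a \<in> I" "b \<in> I" "a \<noteq> b"
        show "T a \<inter> T b = {}"
        proof (rule ccontr)
          assume "T a \<inter> T b \<noteq> {}"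
          then obtain y where "y \<in> T a" "y \<in> T b" by blast
          then have "fst a = fst b \<and> snd a = snd b"
            using ab(1,2) by (intro sep[OF _ _ _ _ _ \<tau>, of y]) (auto simp: T_def I_def)
          with ab(3) show False by (simp add: prod_eq_iff)
        qed
      qed
      show "T ` I \<subseteq> sets lborel"
        using S fr by (auto simp: T_def I_def)
    qed (simp add: I_def)
    also have "\<dots> \<le> emeasure lborel (D - P)"
    proof (rule emeasure_mono)
      show "(\<Union>a\<in>I. T a) \<subseteq> D - P"
      proof
        fix y assume "y \<in> (\<Union>a\<in>I. T a)"
        then obtain \<sigma> j where y: "\<sigma> \<in> {1, -1}" "y \<in> S (\<tau> * \<sigma>) \<sigma> j" "y \<notin> frontier P"
          unfolding T_def I_def by blast
        then have "y \<notin> interior P" using rep[OF y(2)] outside by blast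
        then have "y \<notin> P" using y(3) compact_imp_closed[OF compP] by (auto simp: frontier_def)
        moreover have "y \<in> D" using y(2) by (auto simp: S_def memD)
        ultimately show "y \<in> D - P" by blast
      qed
    qed simp
    finally show ?thesis .
  qed
  have "(\<Sum>\<sigma>\<in>{1,-1}. \<Sum>j\<le>n. \<integral>\<^sup>+ s. ennreal ((R - (snd (x j) - s * fst (x j))\<^sup>2 / (1 + s\<^sup>2)
          + (fst (x j) + s * snd (x j))\<^sup>2 / (1 + s\<^sup>2)) / (1 + s\<^sup>2)) * indicator (C \<sigma> j) s \<partial>lborel)
     = (\<Sum>\<sigma>\<in>{1,-1}. \<Sum>j\<le>n. emeasure lborel (S 1 \<sigma> j) + emeasure lborel (S (-1) \<sigma> j))"
    using emeasure_sector_pair(2)[OF C R] unfolding S_def by (intro sum.cong refl) auto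
  also have "\<dots> = (\<Sum>\<sigma>\<in>{1,-1}. \<Sum>j\<le>n. emeasure lborel (S (1 * \<sigma>) \<sigma> j)) +
      (\<Sum>\<sigma>\<in>{1,-1}. \<Sum>j\<le>n. emeasure lborel (S (-1 * \<sigma>) \<sigma> j))"
    by (simp add: sum.distrib add_ac)
  also have "\<dots> \<le> emeasure lborel (D - P) + emeasure lborel (D - P)"
    by (intro add_mono sweep) auto
  finally have "2 * emeasure lborel P + (\<Sum>\<sigma>\<in>{1,-1}. \<Sum>j\<le>n. \<integral>\<^sup>+ s. ennreal ((R - (snd (x j) - s * fst (x j))\<^sup>2 / (1 + s\<^sup>2)
          + (fst (x j) + s * snd (x j))\<^sup>2 / (1 + s\<^sup>2)) / (1 + s\<^sup>2)) * indicator (C \<sigma> j) s \<partial>lborel)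
     \<le> 2 * emeasure lborel P + (emeasure lborel (D - P) + emeasure lborel (D - P))"
    by (rule add_left_mono)
  also have "\<dots> = 2 * (emeasure lborel P + emeasure lborel (D - P))"
    by (simp add: distrib_left mult_2 add_ac)
  also have "emeasure lborel P + emeasure lborel (D - P) = emeasure lborel D"
    using PD by (subst plus_emeasure) (auto simp: Un_absorb1)
  also have "2 * \<dots> = ennreal (2 * pi * R)"
    using R0 by (simp add: E mult.assoc ennreal_mult flip: ennreal_numeral)
  finally show ?thesis
    unfolding P_def C_def .
qed

section \<open>Gaussian random walks\<close>

definition gauss :: "real measure" where
  "gauss = density lborel std_normal_density"

definition gauss2 :: "(real \<times> real) measure" where
  "gauss2 = gauss \<Otimes>\<^sub>M gauss"

definition gauss_seq :: "nat \<Rightarrow> (nat \<Rightarrow> real) measure" where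
  "gauss_seq n = Pi\<^sub>M {..<n} (\<lambda>_. gauss)"

definition gauss2_seq :: "nat \<Rightarrow> (nat \<Rightarrow> real \<times> real) measure" where
  "gauss2_seq n = Pi\<^sub>M {..<n} (\<lambda>_. gauss2)"

lemma sets_gauss[measurable_cong, simp]: "sets gauss = sets borel"
  and space_gauss[simp]: "space gauss = UNIV"
  by (simp_all add: gauss_def)

lemma sets_gauss2[measurable_cong, simp]: "sets gauss2 = sets borel"
  and space_gauss2[simp]: "space gauss2 = UNIV"
proof -
  have "sets gauss2 = sets (borel \<Otimes>\<^sub>M borel :: (real \<times> real) measure)"
    unfolding gauss2_def by (intro sets_pair_measure_cong) simp_all
  then show "sets gauss2 = sets borel" unfolding borel_prod .
qed (simp add: gauss2_def space_pair_measure)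

lemma borel_measurable_fst_snd[measurable (raw)]:
  fixes f :: "'b \<Rightarrow> real \<times> real"
  assumes "f \<in> borel_measurable N"
  shows "(\<lambda>x. fst (f x)) \<in> borel_measurable N" "(\<lambda>x. snd (f x)) \<in> borel_measurable N"
  using measurable_compose[OF assms measurable_fst[of "borel :: real measure" "borel :: real measure", unfolded borel_prod]]
    measurable_compose[OF assms measurable_snd[of "borel :: real measure" "borel :: real measure", unfolded borel_prod]] by auto

lemma prob_space_gauss: "prob_space gauss"
  unfolding gauss_def by (rule prob_space_normal_density) simp

interpretation gauss: prob_space gauss
  by (rule prob_space_gauss)

interpretation gauss_pair: pair_prob_space gauss gauss ..

interpretation gauss2: prob_space gauss2
  unfolding gauss2_def by (rule gauss_pair.prob_space_axioms)

interpretation gauss_seq: prob_space "gauss_seq n" for n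
  unfolding gauss_seq_def by (intro prob_space_PiM prob_space_gauss)

interpretation gauss2_seq: prob_space "gauss2_seq n" for n
  unfolding gauss2_seq_def by (intro prob_space_PiM gauss2.prob_space_axioms)

lemma measurable_gauss_seq_component[measurable]:
  "k < n \<Longrightarrow> (\<lambda>z. z k) \<in> gauss_seq n \<rightarrow>\<^sub>M borel"
  "k < n \<Longrightarrow> (\<lambda>z. z k) \<in> gauss2_seq n \<rightarrow>\<^sub>M borel"
  unfolding gauss_seq_def gauss2_seq_def
  by (auto intro!: measurable_component_singleton simp: measurable_cong_sets[OF refl sets_gauss[symmetric]]
      measurable_cong_sets[OF refl sets_gauss2[symmetric]])

lemma nn_integral_gauss2:
  assumes [measurable]: "f \<in> borel_measurable borel"
  shows "(\<integral>\<^sup>+ v. f v \<partial>gauss2) = (\<integral>\<^sup>+ x. \<integral>\<^sup>+ y. f (x, y) \<partial>gauss \<partial>gauss)"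
  unfolding gauss2_def
  by (subst gauss.nn_integral_fst[symmetric]) (auto simp: measurable_cong_sets[OF sets_gauss2[unfolded gauss2_def] refl])

text \<open>The planar Gaussian density depends on the norm only, and the matrix is orthogonal with
  determinant \<open>a\<^sup>2 + b\<^sup>2 = 1\<close>.\<close>

lemma nn_integral_gauss2_rotation:
  assumes [measurable]: "f \<in> borel_measurable borel" and ab: "a\<^sup>2 + b\<^sup>2 = 1"
  shows "(\<integral>\<^sup>+ v. f (a * fst v + b * snd v, - b * fst v + a * snd v) \<partial>gauss2) = (\<integral>\<^sup>+ v. f v \<partial>gauss2)"
proof -
  define g where "g v = f v * ennreal (std_normal_density (fst v) * std_normal_density (snd v))" for v
  have [measurable]: "g \<in> borel_measurable borel"
    unfolding g_def by measurable
  have dens: "(\<integral>\<^sup>+ v. h v \<partial>gauss2) = (\<integral>\<^sup>+ x. \<integral>\<^sup>+ y. h (x, y) * ennreal (std_normal_density x * std_normal_density y) \<partial>lborel \<partial>lborel)"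
    if [measurable]: "h \<in> borel_measurable borel" for h
    by (subst nn_integral_gauss2)
       (auto simp: gauss_def nn_integral_density ennreal_mult mult_ac nn_integral_cmult[symmetric]
             intro!: nn_integral_cong)
  have rot: "(a * x + b * y)\<^sup>2 + (- b * x + a * y)\<^sup>2 = x\<^sup>2 + y\<^sup>2" for x y
  proof -
    have "(a * x + b * y)\<^sup>2 + (- b * x + a * y)\<^sup>2 = (a\<^sup>2 + b\<^sup>2) * (x\<^sup>2 + y\<^sup>2)"
      by (simp add: power2_eq_square algebra_simps)
    then show ?thesis by (simp add: ab)
  qed
  have phi: "std_normal_density x * std_normal_density y = exp (- (x\<^sup>2 + y\<^sup>2) / 2) / (2 * pi)" for x y
    by (simp add: std_normal_density_def exp_add[symmetric] add_divide_distrib diff_divide_distrib)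
  have det: "a * a - b * (- b) = 1" using ab by (simp add: power2_eq_square)
  have "(\<integral>\<^sup>+ v. f v \<partial>gauss2) = (\<integral>\<^sup>+ v. g v \<partial>lborel)"
    by (subst dens, simp, subst nn_integral_plane) (simp_all add: g_def)
  also have "\<dots> = (\<integral>\<^sup>+ x. \<integral>\<^sup>+ y. g (a * x + b * y, - b * x + a * y) \<partial>lborel \<partial>lborel)"
    by (subst nn_integral_plane_linear[of g a a b "- b"]) (simp_all only: det, simp_all)
  also have "\<dots> = (\<integral>\<^sup>+ v. f (a * fst v + b * snd v, - b * fst v + a * snd v) \<partial>gauss2)"
    by (subst dens) (simp_all add: g_def phi rot[simplified])
  finally show ?thesis by simp
qed

lemma nn_integral_gauss2_inner:
  assumes [measurable]: "f \<in> borel_measurable borel" and ab: "a\<^sup>2 + b\<^sup>2 = 1"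
  shows "(\<integral>\<^sup>+ v. f (a * fst v + b * snd v) \<partial>gauss2) = (\<integral>\<^sup>+ x. f x \<partial>gauss)"
  using nn_integral_gauss2_rotation[OF _ ab, of "\<lambda>v. f (fst v)"]
  by (simp add: nn_integral_gauss2 gauss.emeasure_space_1[simplified])

text \<open>The standard normal moments of orders 1, 2 and 4 are 0, 1 and 3. Polynomials of this
  shape arise in the one-step estimate for \<open>exit_potential\<close>, with the quartic as error
  term.\<close>

lemma gauss_poly:
  assumes nonneg: "\<And>x. 0 \<le> c0 + c1 * x + c2 * x\<^sup>2 + c4 * x ^ 4"
  shows "(\<integral>\<^sup>+ x. ennreal (c0 + c1 * x + c2 * x\<^sup>2 + c4 * x ^ 4) \<partial>gauss) = ennreal (c0 + c2 + 3 * c4)"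
    and "0 \<le> c0 + c2 + 3 * c4"
proof -
  have 0: "has_bochner_integral lborel (\<lambda>x. std_normal_density x * c0) c0"
    using has_bochner_integral_mult_left[of c0 lborel "\<lambda>x. std_normal_density x * x ^ (2 * 0)"] std_normal_moment_even[of 0] by fastforce
  have 1: "has_bochner_integral lborel (\<lambda>x. std_normal_density x * x * c1) 0"
    using has_bochner_integral_mult_left[of c1 lborel "\<lambda>x. std_normal_density x * x ^ (2 * 0 + 1)"] std_normal_moment_odd[of 0] by fastforce
  have 2: "has_bochner_integral lborel (\<lambda>x. std_normal_density x * x\<^sup>2 * c2) c2"
    using has_bochner_integral_mult_left[of c2 lborel "\<lambda>x. std_normal_density x * x ^ (2 * 1)"] std_normal_moment_even[of 1] by fastforce
  have 4: "has_bochner_integral lborel (\<lambda>x. std_normal_density x * x ^ 4 * c4) (3 * c4)"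
    using has_bochner_integral_mult_left[of c4 lborel "\<lambda>x. std_normal_density x * x ^ (2 * 2)"] std_normal_moment_even[of 2]
    by (fastforce simp: fact_numeral)
  have *: "has_bochner_integral lborel (\<lambda>x. std_normal_density x * (c0 + c1 * x + c2 * x\<^sup>2 + c4 * x ^ 4)) (c0 + c2 + 3 * c4)"
    using has_bochner_integral_add[OF has_bochner_integral_add[OF 0 1] has_bochner_integral_add[OF 2 4]]
    by (simp add: algebra_simps)
  show "0 \<le> c0 + c2 + 3 * c4"
    unfolding has_bochner_integral_integral_eq[OF *, symmetric]
    using nonneg by (intro Bochner_Integration.integral_nonneg) (auto intro!: mult_nonneg_nonneg)
  have "(\<integral>\<^sup>+ x. ennreal (std_normal_density x * (c0 + c1 * x + c2 * x\<^sup>2 + c4 * x ^ 4)) \<partial>lborel) = ennreal (c0 + c2 + 3 * c4)"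
    using nonneg * by (subst nn_integral_eq_integral) (auto simp: has_bochner_integral_iff)
  then show "(\<integral>\<^sup>+ x. ennreal (c0 + c1 * x + c2 * x\<^sup>2 + c4 * x ^ 4) \<partial>gauss) = ennreal (c0 + c2 + 3 * c4)"
    using nonneg by (simp add: gauss_def nn_integral_density ennreal_mult)
qed

lemma gauss_square: "(\<integral>\<^sup>+ x. ennreal ((c + x)\<^sup>2) \<partial>gauss) = ennreal (c\<^sup>2 + 1)"
proof -
  have *: "c\<^sup>2 + 2 * c * x + 1 * x\<^sup>2 + 0 * x ^ 4 = (c + x)\<^sup>2" for x
    by (simp add: power2_eq_square algebra_simps)
  show ?thesis using gauss_poly(1)[of "c\<^sup>2" "2 * c" 1 0] unfolding * by simp
qed

section \<open>Symmetries of Gaussian sequences\<close>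

interpretation gauss_prod: product_sigma_finite "\<lambda>_::nat. gauss"
  by (simp add: product_sigma_finite_def gauss.sigma_finite_measure_axioms)

interpretation gauss2_prod: product_sigma_finite "\<lambda>_::nat. gauss2"
  by (simp add: product_sigma_finite_def gauss2.sigma_finite_measure_axioms)

lemma gauss_seq_Suc:
  assumes "f \<in> borel_measurable (gauss_seq (Suc n))"
  shows "(\<integral>\<^sup>+ z. f z \<partial>gauss_seq (Suc n)) = (\<integral>\<^sup>+ z. \<integral>\<^sup>+ x. f (z(n := x)) \<partial>gauss \<partial>gauss_seq n)"
  using assms gauss_prod.product_nn_integral_insert[of "{..<n}" n f]
  by (simp add: gauss_seq_def lessThan_Suc)

lemma gauss2_seq_Suc:
  assumes "f \<in> borel_measurable (gauss2_seq (Suc n))"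
  shows "(\<integral>\<^sup>+ z. f z \<partial>gauss2_seq (Suc n)) = (\<integral>\<^sup>+ z. \<integral>\<^sup>+ x. f (z(n := x)) \<partial>gauss2 \<partial>gauss2_seq n)"
  using assms gauss2_prod.product_nn_integral_insert[of "{..<n}" n f]
  by (simp add: gauss2_seq_def lessThan_Suc)

lemma measurable_seq_upd[measurable]:
  "(\<lambda>(z, x). z(n := x)) \<in> gauss_seq n \<Otimes>\<^sub>M borel \<rightarrow>\<^sub>M gauss_seq (Suc n)"
  "(\<lambda>(z, x). z(n := x)) \<in> gauss2_seq n \<Otimes>\<^sub>M borel \<rightarrow>\<^sub>M gauss2_seq (Suc n)"
  unfolding gauss_seq_def gauss2_seq_def lessThan_Suc
  using measurable_add_dim[of n "{..<n}" "\<lambda>_. gauss"] measurable_add_dim[of n "{..<n}" "\<lambda>_. gauss2"]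
  by (simp_all add: measurable_cong_sets[OF sets_pair_measure_cong[OF refl sets_gauss] refl]
       measurable_cong_sets[OF sets_pair_measure_cong[OF refl sets_gauss2] refl])

text \<open>One coordinate at a time: the last one is integrated against \<open>N\<close>, where
  \<open>T\<close> may be dropped, and the others fall under the induction hypothesis.\<close>

lemma nn_integral_PiM_map:
  fixes N :: "'b measure"
  assumes N: "prob_space N" and T[measurable]: "T \<in> N \<rightarrow>\<^sub>M N" and pres: "distr N N T = N"
    and f[measurable]: "f \<in> borel_measurable (Pi\<^sub>M {..<n} (\<lambda>_. N))"
  shows "(\<integral>\<^sup>+ z. f (\<lambda>k\<in>{..<n}. T (z k)) \<partial>Pi\<^sub>M {..<n} (\<lambda>_. N)) = (\<integral>\<^sup>+ z. f z \<partial>Pi\<^sub>M {..<n::nat} (\<lambda>_. N))"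
  using f
proof (induction n arbitrary: f)
  case 0
  show ?case by (simp add: PiM_empty nn_integral_count_space_finite)
next
  case (Suc n)
  interpret N: prob_space N by fact
  interpret P: product_sigma_finite "\<lambda>_::nat. N"
    by (simp add: product_sigma_finite_def N.sigma_finite_measure_axioms)
  have f[measurable]: "f \<in> borel_measurable (Pi\<^sub>M (insert n {..<n}) (\<lambda>_. N))"
    using Suc.prems by (simp add: lessThan_Suc)
  have rT[measurable]: "(\<lambda>z. \<lambda>k\<in>I. T (z k)) \<in> Pi\<^sub>M I (\<lambda>_. N) \<rightarrow>\<^sub>M Pi\<^sub>M I (\<lambda>_. N)" for I :: "nat set"
    by (intro measurable_restrict) measurable
  have upd[measurable]: "(\<lambda>(z, x). z(n := x)) \<in> Pi\<^sub>M {..<n} (\<lambda>_. N) \<Otimes>\<^sub>M N \<rightarrow>\<^sub>M Pi\<^sub>M (insert n {..<n}) (\<lambda>_. N)"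
    using measurable_add_dim[of n "{..<n}" "\<lambda>_. N"] by simp
  have "(\<integral>\<^sup>+ z. f (\<lambda>k\<in>{..<Suc n}. T (z k)) \<partial>Pi\<^sub>M {..<Suc n} (\<lambda>_. N))
      = (\<integral>\<^sup>+ z. \<integral>\<^sup>+ x. f (\<lambda>k\<in>insert n {..<n}. T ((z(n := x)) k)) \<partial>N \<partial>Pi\<^sub>M {..<n} (\<lambda>_. N))"
    unfolding lessThan_Suc by (rule P.product_nn_integral_insert) auto
  also have "\<dots> = (\<integral>\<^sup>+ z. \<integral>\<^sup>+ x. f ((\<lambda>k\<in>{..<n}. T (z k))(n := x)) \<partial>N \<partial>Pi\<^sub>M {..<n} (\<lambda>_. N))"
  proof (rule nn_integral_cong)
    fix z assume z: "z \<in> space (Pi\<^sub>M {..<n} (\<lambda>_. N))"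
    let ?z = "\<lambda>k\<in>{..<n}. T (z k)"
    have z': "?z \<in> space (Pi\<^sub>M {..<n} (\<lambda>_. N))"
      using measurable_space[OF rT z] .
    have m: "(\<lambda>x. f (?z(n := x))) \<in> borel_measurable N"
      using measurable_compose[OF measurable_compose[OF measurable_Pair1'[OF z'] upd] f] by simp
    have "(\<integral>\<^sup>+ x. f (\<lambda>k\<in>insert n {..<n}. T ((z(n := x)) k)) \<partial>N) = (\<integral>\<^sup>+ x. f (?z(n := T x)) \<partial>N)"
      by (intro nn_integral_cong arg_cong[of _ _ f]) (auto simp: fun_eq_iff)
    also have "\<dots> = (\<integral>\<^sup>+ x. f (?z(n := x)) \<partial>distr N N T)"
      using m by (simp add: nn_integral_distr)
    finally show "(\<integral>\<^sup>+ x. f (\<lambda>k\<in>insert n {..<n}. T ((z(n := x)) k)) \<partial>N) = (\<integral>\<^sup>+ x. f (?z(n := x)) \<partial>N)"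
      by (simp add: pres)
  qed
  also have "\<dots> = (\<integral>\<^sup>+ z. \<integral>\<^sup>+ x. f (z(n := x)) \<partial>N \<partial>Pi\<^sub>M {..<n} (\<lambda>_. N))"
    by (rule Suc.IH) measurable
  also have "\<dots> = (\<integral>\<^sup>+ z. f z \<partial>Pi\<^sub>M {..<Suc n} (\<lambda>_. N))"
    unfolding lessThan_Suc by (rule P.product_nn_integral_insert[symmetric]) auto
  finally show ?case .
qed

lemma gauss2_seq_rotation:
  assumes f: "f \<in> borel_measurable (gauss2_seq n)" and ab: "a\<^sup>2 + b\<^sup>2 = 1"
  shows "(\<integral>\<^sup>+ z. f (\<lambda>k\<in>{..<n}. (a * fst (z k) + b * snd (z k), - b * fst (z k) + a * snd (z k))) \<partial>gauss2_seq n)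
     = (\<integral>\<^sup>+ z. f z \<partial>gauss2_seq n)"
  unfolding gauss2_seq_def
proof (rule nn_integral_PiM_map[OF gauss2.prob_space_axioms])
  let ?T = "\<lambda>v. (a * fst v + b * snd v, - b * fst v + a * snd v)"
  show T: "?T \<in> gauss2 \<rightarrow>\<^sub>M gauss2" by simp
  show "distr gauss2 gauss2 ?T = gauss2"
  proof (rule measure_eqI)
    fix A assume "A \<in> sets (distr gauss2 gauss2 ?T)"
    then have A[measurable]: "A \<in> sets borel" by simp
    have "emeasure (distr gauss2 gauss2 ?T) A = (\<integral>\<^sup>+ v. indicator A v \<partial>distr gauss2 gauss2 ?T)"
      by simp
    also have "\<dots> = (\<integral>\<^sup>+ v. indicator A (?T v) \<partial>gauss2)"
      by (rule nn_integral_distr) (use T A in \<open>auto intro!: borel_measurable_indicator\<close>)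
    also have "\<dots> = emeasure gauss2 A"
      by (subst nn_integral_gauss2_rotation[OF _ ab]) auto
    finally show "emeasure (distr gauss2 gauss2 ?T) A = emeasure gauss2 A" .
  qed simp
qed (use f in \<open>simp add: gauss2_seq_def\<close>)

text \<open>The reversed and negated increments are again independent standard normal. Their partial
  sums are the walk read backwards relative to its end point, see \<open>psum_reversed\<close>; this
  exchanges first and last maxima and turns a maximum into a drawdown.\<close>

lemma gauss_seq_reversal:
  assumes f[measurable]: "f \<in> borel_measurable (gauss_seq n)"
  shows "(\<integral>\<^sup>+ z. f (\<lambda>k\<in>{..<n}. - z (n - 1 - k)) \<partial>gauss_seq n) = (\<integral>\<^sup>+ z. f z \<partial>gauss_seq n)"
proof -
  have f'[measurable]: "f \<in> borel_measurable (Pi\<^sub>M {..<n} (\<lambda>_. gauss))"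
    using f by (simp add: gauss_seq_def)
  have neg: "(\<integral>\<^sup>+ x. h (- x) \<partial>gauss) = (\<integral>\<^sup>+ x. h x \<partial>gauss)" if [measurable]: "h \<in> borel_measurable borel" for h :: "real \<Rightarrow> ennreal"
    using nn_integral_gauss2_inner[of h 1 0] nn_integral_gauss2_inner[of "\<lambda>x. h (- x)" "-1" 0] by simp
  have "(\<integral>\<^sup>+ z. f z \<partial>gauss_seq n) = (\<integral>\<^sup>+ z. f (\<lambda>k\<in>{..<n}. - z k) \<partial>gauss_seq n)"
    unfolding gauss_seq_def
  proof (rule nn_integral_PiM_map[OF prob_space_gauss, symmetric])
    show T: "uminus \<in> gauss \<rightarrow>\<^sub>M gauss" by simp
    show "distr gauss gauss uminus = gauss"
    proof (rule measure_eqI)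
      fix A assume "A \<in> sets (distr gauss gauss uminus)"
      then have A[measurable]: "A \<in> sets borel" by simp
      have "emeasure (distr gauss gauss uminus) A = (\<integral>\<^sup>+ v. indicator A v \<partial>distr gauss gauss uminus)"
        by simp
      also have "\<dots> = (\<integral>\<^sup>+ v. indicator A (- v) \<partial>gauss)"
        by (rule nn_integral_distr) (use T A in \<open>auto intro!: borel_measurable_indicator\<close>)
      also have "\<dots> = emeasure gauss A"
        by (subst neg) auto
      finally show "emeasure (distr gauss gauss uminus) A = emeasure gauss A" .
    qed simp
  qed simp
  also have "\<dots> = (\<integral>\<^sup>+ z. f (\<lambda>k\<in>{..<n}. - z k) \<partial>distr (gauss_seq n) (gauss_seq n) (\<lambda>z. \<lambda>k\<in>{..<n}. z (n - 1 - k)))"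
    unfolding gauss_seq_def
    by (subst distr_PiM_reindex[of "{..<n}" "\<lambda>_. gauss" "\<lambda>k. n - 1 - k" "{..<n}"])
       (auto intro!: prob_space_gauss inj_onI)
  also have "\<dots> = (\<integral>\<^sup>+ z. f (\<lambda>k\<in>{..<n}. - z (n - 1 - k)) \<partial>gauss_seq n)"
    unfolding gauss_seq_def
    by (subst nn_integral_distr)
       (auto intro!: measurable_restrict measurable_compose[OF _ f'] nn_integral_cong arg_cong[of _ _ f] borel_measurable_uminus
          measurable_component_singleton)
  finally show ?thesis by simp
qed

lemma gauss2_seq_split:
  assumes "f \<in> borel_measurable (gauss2_seq n)"
  shows "(\<integral>\<^sup>+ z. f z \<partial>gauss2_seq n) = (\<integral>\<^sup>+ x. \<integral>\<^sup>+ y. f (\<lambda>k\<in>{..<n}. (x k, y k)) \<partial>gauss_seq n \<partial>gauss_seq n)"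
  using assms
proof (induction n arbitrary: f)
  case 0
  show ?case by (simp add: gauss_seq_def gauss2_seq_def PiM_empty nn_integral_count_space_finite)
next
  case (Suc n)
  note [measurable] = Suc.prems
  have zip[measurable]: "(\<lambda>(x, y). \<lambda>k\<in>{..<m}. (x k, y k)) \<in> gauss_seq m \<Otimes>\<^sub>M gauss_seq m \<rightarrow>\<^sub>M gauss2_seq m" for m
    unfolding gauss2_seq_def split_def
    by (intro measurable_restrict) (simp add: measurable_cong_sets[OF refl sets_gauss2])
  have zupd: "(\<lambda>k\<in>{..<Suc n}. ((x(n := a)) k, (y(n := b)) k)) = (\<lambda>k\<in>{..<n}. (x k, y k))(n := (a, b))" for x y :: "nat \<Rightarrow> real" and a b
    by (auto simp: fun_eq_iff)
  interpret sw: pair_sigma_finite "gauss_seq n" gauss ..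
  have "(\<integral>\<^sup>+ z. f z \<partial>gauss2_seq (Suc n)) = (\<integral>\<^sup>+ z. \<integral>\<^sup>+ v. f (z(n := v)) \<partial>gauss2 \<partial>gauss2_seq n)"
    by (rule gauss2_seq_Suc) fact
  also have "\<dots> = (\<integral>\<^sup>+ x. \<integral>\<^sup>+ y. \<integral>\<^sup>+ v. f ((\<lambda>k\<in>{..<n}. (x k, y k))(n := v)) \<partial>gauss2 \<partial>gauss_seq n \<partial>gauss_seq n)"
    by (rule Suc.IH) measurable
  also have "\<dots> = (\<integral>\<^sup>+ x. \<integral>\<^sup>+ y. \<integral>\<^sup>+ a. \<integral>\<^sup>+ b. f ((\<lambda>k\<in>{..<n}. (x k, y k))(n := (a, b))) \<partial>gauss \<partial>gauss \<partial>gauss_seq n \<partial>gauss_seq n)"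
    by (intro nn_integral_cong nn_integral_gauss2) measurable
  also have "\<dots> = (\<integral>\<^sup>+ x. \<integral>\<^sup>+ a. \<integral>\<^sup>+ y. \<integral>\<^sup>+ b. f ((\<lambda>k\<in>{..<n}. (x k, y k))(n := (a, b))) \<partial>gauss \<partial>gauss_seq n \<partial>gauss \<partial>gauss_seq n)"
    by (intro nn_integral_cong sw.Fubini'[symmetric]) measurable
  also have "\<dots> = (\<integral>\<^sup>+ x. \<integral>\<^sup>+ a. \<integral>\<^sup>+ y. f (\<lambda>k\<in>{..<Suc n}. ((x(n := a)) k, y k)) \<partial>gauss_seq (Suc n) \<partial>gauss \<partial>gauss_seq n)"
    unfolding zupd[symmetric]
    by (intro nn_integral_cong gauss_seq_Suc[symmetric]) measurable
  also have "\<dots> = (\<integral>\<^sup>+ x. \<integral>\<^sup>+ y. f (\<lambda>k\<in>{..<Suc n}. (x k, y k)) \<partial>gauss_seq (Suc n) \<partial>gauss_seq (Suc n))"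
    by (intro gauss_seq_Suc[symmetric]) measurable
  finally show ?case .
qed

section \<open>The expected area of the hull of a Gaussian walk\<close>

definition psum :: "(nat \<Rightarrow> 'a::comm_monoid_add) \<Rightarrow> nat \<Rightarrow> 'a" where
  "psum x k = (\<Sum>i<k. x i)"

lemma psum_0[simp]: "psum x 0 = 0" and psum_Suc: "psum x (Suc k) = psum x k + x k"
  by (simp_all add: psum_def add.commute)

lemma psum_cong: "(\<And>i. i < k \<Longrightarrow> x i = y i) \<Longrightarrow> psum x k = psum y k"
  by (simp add: psum_def)

lemma psum_upd[simp]: "k \<le> n \<Longrightarrow> psum (x(n := a)) k = psum x k"
  by (rule psum_cong) auto

lemma psum_upd_Suc: "psum (x(n := a)) (Suc n) = psum x n + a"
  by (simp add: psum_Suc)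

lemma measurable_psum[measurable]:
  "k \<le> n \<Longrightarrow> (\<lambda>x. psum x k) \<in> borel_measurable (gauss_seq n)"
  "k \<le> n \<Longrightarrow> (\<lambda>x. psum x k) \<in> borel_measurable (gauss2_seq n)"
  unfolding psum_def by (auto intro!: borel_measurable_sum)

text \<open>The running maximum minus the current value, as a recursion of Lindley type that makes
  the effect of a single step explicit. \<open>drawdown_attained\<close> and
  \<open>drawdown_ge\<close> recover the maximum.\<close>

primrec drawdown :: "(nat \<Rightarrow> real) \<Rightarrow> nat \<Rightarrow> real" where
  "drawdown x 0 = 0"
| "drawdown x (Suc k) = max (drawdown x k - x k) 0"

lemma drawdown_nonneg[simp]: "0 \<le> drawdown x k"
  by (cases k) auto

lemma drawdown_cong: "(\<And>i. i < k \<Longrightarrow> x i = y i) \<Longrightarrow> drawdown x k = drawdown y k"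
  by (induction k) auto

lemma drawdown_upd[simp]: "k \<le> n \<Longrightarrow> drawdown (x(n := a)) k = drawdown x k"
  by (rule drawdown_cong) auto

lemma drawdown_attained: "\<exists>i\<le>k. drawdown x k = psum x i - psum x k"
proof (induction k)
  case (Suc k)
  then obtain i where "i \<le> k" "drawdown x k = psum x i - psum x k" by blast
  then show ?case
    by (cases "drawdown x k - x k \<ge> 0") (auto simp: psum_Suc intro: exI[of _ i] exI[of _ "Suc k"])
qed simp

lemma drawdown_ge: "i \<le> k \<Longrightarrow> psum x i - psum x k \<le> drawdown x k"
proof (induction k)
  case (Suc k)
  then show ?case by (cases "i = Suc k") (auto simp: psum_Suc le_max_iff_disj)
qed simp

lemma measurable_drawdown[measurable]:
  "k \<le> n \<Longrightarrow> (\<lambda>x. drawdown x k) \<in> borel_measurable (gauss_seq n)"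
proof (induction k)
  case (Suc k)
  then have [measurable]: "(\<lambda>x. drawdown x k) \<in> borel_measurable (gauss_seq n)" "(\<lambda>x. x k) \<in> borel_measurable (gauss_seq n)"
    by auto
  show ?case by simp
qed simp

lemma nn_integral_psum_square:
  "k \<le> n \<Longrightarrow> (\<integral>\<^sup>+ x. ennreal ((psum x k)\<^sup>2) \<partial>gauss_seq n) = ennreal (real k)"
proof (induction n arbitrary: k)
  case (Suc n)
  have "(\<integral>\<^sup>+ x. ennreal ((psum x k)\<^sup>2) \<partial>gauss_seq (Suc n)) =
     (\<integral>\<^sup>+ x. \<integral>\<^sup>+ a. ennreal ((psum (x(n := a)) k)\<^sup>2) \<partial>gauss \<partial>gauss_seq n)"
    using Suc.prems by (intro gauss_seq_Suc) measurable
  also have "\<dots> = ennreal (real k)"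
  proof (cases "k \<le> n")
    case True
    then show ?thesis using Suc.IH[OF True] by (simp add: gauss.emeasure_space_1[simplified])
  next
    case False
    with Suc.prems have k: "k = Suc n" by simp
    have "(\<integral>\<^sup>+ x. \<integral>\<^sup>+ a. ennreal ((psum (x(n := a)) k)\<^sup>2) \<partial>gauss \<partial>gauss_seq n) = (\<integral>\<^sup>+ x. ennreal ((psum x n)\<^sup>2) + 1 \<partial>gauss_seq n)"
      unfolding k psum_upd_Suc gauss_square by simp
    also have "\<dots> = ennreal (real n) + 1"
      by (subst nn_integral_add) (auto simp: Suc.IH gauss_seq.emeasure_space_1)
    finally show ?thesis by (simp add: k add.commute)
  qed
  finally show ?case .
qed simp

text \<open>Clipping at 0 can only lower the square, and an independent standard normal step raises
  the mean square by exactly 1.\<close>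

lemma nn_integral_drawdown_square:
  "(\<integral>\<^sup>+ x. ennreal ((drawdown x n)\<^sup>2) \<partial>gauss_seq n) \<le> ennreal (real n)"
proof (induction n)
  case (Suc n)
  have "(\<integral>\<^sup>+ x. ennreal ((drawdown x (Suc n))\<^sup>2) \<partial>gauss_seq (Suc n)) =
     (\<integral>\<^sup>+ x. \<integral>\<^sup>+ a. ennreal ((drawdown (x(n := a)) (Suc n))\<^sup>2) \<partial>gauss \<partial>gauss_seq n)"
    by (intro gauss_seq_Suc) measurable
  also have "\<dots> \<le> (\<integral>\<^sup>+ x. \<integral>\<^sup>+ a. ennreal ((- drawdown x n + a)\<^sup>2) \<partial>gauss \<partial>gauss_seq n)"
  proof (intro nn_integral_mono ennreal_leI)
    fix x :: "nat \<Rightarrow> real" and a :: real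
    have "(max (drawdown x n - a) 0)\<^sup>2 \<le> (drawdown x n - a)\<^sup>2"
      by (auto simp: max_def)
    then show "(drawdown (x(n := a)) (Suc n))\<^sup>2 \<le> (- drawdown x n + a)\<^sup>2"
      by (simp add: power2_commute)
  qed
  also have "\<dots> = (\<integral>\<^sup>+ x. ennreal ((drawdown x n)\<^sup>2) + 1 \<partial>gauss_seq n)"
    unfolding gauss_square by simp
  also have "\<dots> = (\<integral>\<^sup>+ x. ennreal ((drawdown x n)\<^sup>2) \<partial>gauss_seq n) + 1"
    by (subst nn_integral_add) (auto simp: gauss_seq.emeasure_space_1)
  also have "\<dots> \<le> ennreal (real n) + 1"
    using Suc.IH by (intro add_right_mono)
  finally show ?case by (simp add: add.commute)
qed simp

lemma psum_reversed:
  fixes x :: "nat \<Rightarrow> real"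
  assumes "k \<le> n"
  shows "psum (\<lambda>i\<in>{..<n}. - x (n - 1 - i)) k = psum x (n - k) - psum x n"
  using assms
proof (induction k)
  case (Suc k)
  have "n - k = Suc (n - Suc k)" using Suc.prems by simp
  then have "psum x (n - k) = psum x (n - Suc k) + x (n - Suc k)" by (simp add: psum_Suc)
  then show ?case using Suc by (simp add: psum_Suc)
qed simp

text \<open>Encoded through the reversed sequence, so that time reversal exchanges it with
  \<open>last_max\<close>. The bound \<open>j \<le> n\<close> guards against truncated
  subtraction.\<close>

definition first_max :: "nat \<Rightarrow> (nat \<Rightarrow> real) \<Rightarrow> nat \<Rightarrow> bool" where
  "first_max n f j \<longleftrightarrow> last_max n (\<lambda>k. f (n - k)) (n - j) \<and> j \<le> n"

lemma first_max_le_last_max: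
  assumes "first_max n f i" "last_max n f j"
  shows "i \<le> j"
proof (rule ccontr)
  assume "\<not> i \<le> j"
  then have ij: "j < i" by simp
  have i: "i \<le> n" and l: "last_max n (\<lambda>k. f (n - k)) (n - i)" using assms(1) by (auto simp: first_max_def)
  from l have "f (n - (n - j)) < f (n - (n - i))"
    using ij i unfolding last_max_def by (auto dest: spec[of _ "n - j"])
  moreover have "f i < f j \<or> f i \<le> f j" using assms(2) i by (auto simp: last_max_def)
  ultimately show False using ij i by simp
qed

lemma last_max_shift: "last_max n (\<lambda>k. f k - c) j = last_max n f j"
  by (simp add: last_max_def)

lemma last_max_congI: "(\<And>k. k \<le> n \<Longrightarrow> f k = g k) \<Longrightarrow> last_max n f j = last_max n g j"
  by (auto simp: last_max_def)

text \<open>By time reversal the first maximum has the law of \<open>n\<close> minus the last one,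
  and the first maximum is never later than the last. With T the last index, n = E T + E (n - T) is
  therefore at most 2 E T.\<close>

lemma last_max_prob:
  defines "L \<equiv> \<lambda>n j. \<integral>\<^sup>+ x. (if last_max n (psum x) j then 1 else 0) \<partial>gauss_seq n"
  shows "(\<Sum>j\<le>n. L n j) = 1" and "ennreal (real n / 2) \<le> (\<Sum>j\<le>n. ennreal (real j) * L n j)"
proof -
  define F where "F = (\<lambda>j. \<integral>\<^sup>+ x. (if first_max n (psum x) j then 1 else 0) \<partial>gauss_seq n)"
  have [measurable]: "Measurable.pred (gauss_seq n) (\<lambda>x. last_max n (psum x) j)" for j
    by measurable
  have [measurable]: "Measurable.pred (gauss_seq n) (\<lambda>x. first_max n (psum x) j)" for j
    unfolding first_max_def by measurable
  have ind: "(\<Sum>j\<le>n. (if last_max n (psum x) j then 1 else 0)) = (1::ennreal)" for x :: "nat \<Rightarrow> real"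
    using last_max_exists[of n "psum x"] sum_last_max[of n "psum x" _ "\<lambda>_. 1::ennreal"] by auto
  have "(\<Sum>j\<le>n. L n j) = (\<integral>\<^sup>+ x. (\<Sum>j\<le>n. (if last_max n (psum x) j then 1 else 0)) \<partial>gauss_seq n)"
    unfolding L_def by (rule nn_integral_sum[symmetric]) measurable
  also have "\<dots> = 1" by (simp add: ind gauss_seq.emeasure_space_1)
  finally show L1: "(\<Sum>j\<le>n. L n j) = 1" .
  have FL: "F (n - j) = L n j" if j: "j \<le> n" for j
  proof -
    have "L n j = (\<integral>\<^sup>+ x. (if last_max n (psum (\<lambda>k\<in>{..<n}. - x (n - 1 - k))) j then 1 else 0) \<partial>gauss_seq n)"
      unfolding L_def by (rule gauss_seq_reversal[symmetric]) measurable
    also have "\<dots> = F (n - j)"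
      unfolding F_def
    proof (intro nn_integral_cong if_cong refl)
      fix x :: "nat \<Rightarrow> real"
      have "last_max n (psum (\<lambda>k\<in>{..<n}. - x (n - 1 - k))) j = last_max n (\<lambda>k. psum x (n - k) - psum x n) j"
        by (rule last_max_congI) (rule psum_reversed)
      then show "last_max n (psum (\<lambda>k\<in>{..<n}. - x (n - 1 - k))) j = first_max n (psum x) (n - j)"
        using j by (simp add: last_max_shift first_max_def)
    qed
    finally show ?thesis ..
  qed
  have "(\<Sum>j\<le>n. ennreal (real j) * F j) = (\<integral>\<^sup>+ x. (\<Sum>j\<le>n. ennreal (real j) * (if first_max n (psum x) j then 1 else 0)) \<partial>gauss_seq n)"
    unfolding F_def by (subst nn_integral_sum) (auto simp: nn_integral_cmult)
  also have "\<dots> \<le> (\<integral>\<^sup>+ x. (\<Sum>j\<le>n. ennreal (real j) * (if last_max n (psum x) j then 1 else 0)) \<partial>gauss_seq n)"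
  proof (rule nn_integral_mono)
    fix x :: "nat \<Rightarrow> real"
    obtain l where l: "last_max n (psum x) l" using last_max_exists by blast
    obtain m where m: "last_max n (\<lambda>k. psum x (n - k)) m" using last_max_exists by blast
    then have m': "m \<le> n" by (simp add: last_max_def)
    have fm: "first_max n (psum x) j \<longleftrightarrow> j = n - m \<and> j \<le> n" for j
      using m m' last_max_unique[OF m, of "n - j"] by (auto simp: first_max_def)
    have "(\<Sum>j\<le>n. ennreal (real j) * (if first_max n (psum x) j then 1 else 0)) = (\<Sum>j\<le>n. if j = n - m then ennreal (real j) else 0)"
      by (intro sum.cong) (auto simp: fm)
    also have "\<dots> = ennreal (real (n - m))" by simp
    also have "\<dots> \<le> ennreal (real l)"
      using first_max_le_last_max[OF _ l, of "n - m"] fm by (intro ennreal_leI) simp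
    also have "\<dots> = (\<Sum>j\<le>n. ennreal (real j) * (if last_max n (psum x) j then 1 else 0))"
      using sum_last_max[OF l, of "\<lambda>j. ennreal (real j)"] by (simp add: if_distrib cong: if_cong)
    finally show "(\<Sum>j\<le>n. ennreal (real j) * (if first_max n (psum x) j then 1 else 0)) \<le> (\<Sum>j\<le>n. ennreal (real j) * (if last_max n (psum x) j then 1 else 0))" .
  qed
  also have "\<dots> = (\<Sum>j\<le>n. ennreal (real j) * L n j)"
    unfolding L_def by (subst nn_integral_sum) (auto simp: nn_integral_cmult)
  finally have le: "(\<Sum>j\<le>n. ennreal (real j) * F j) \<le> (\<Sum>j\<le>n. ennreal (real j) * L n j)" .
  have "(\<Sum>j\<le>n. ennreal (real j) * F j) = (\<Sum>j\<le>n. ennreal (real (n - j)) * F (n - j))"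
    by (rule sum.reindex_bij_witness[of _ "\<lambda>j. n - j" "\<lambda>j. n - j"]) auto
  also have "\<dots> = (\<Sum>j\<le>n. ennreal (real (n - j)) * L n j)"
    by (intro sum.cong) (auto simp: FL)
  finally have F: "(\<Sum>j\<le>n. ennreal (real j) * F j) = (\<Sum>j\<le>n. ennreal (real (n - j)) * L n j)" .
  have "ennreal (real n) = (\<Sum>j\<le>n. ennreal (real n) * L n j)"
    by (simp add: sum_distrib_left[symmetric] L1)
  also have "\<dots> = (\<Sum>j\<le>n. ennreal (real j) * L n j) + (\<Sum>j\<le>n. ennreal (real (n - j)) * L n j)"
    unfolding sum.distrib[symmetric] distrib_right[symmetric]
    by (intro sum.cong refl arg_cong2[of _ _ _ _ "(*)"]) (auto simp flip: ennreal_plus)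
  also have "\<dots> \<le> 2 * (\<Sum>j\<le>n. ennreal (real j) * L n j)"
    unfolding mult_2 using le F by (intro add_left_mono) simp
  finally have "2 * ennreal (real n / 2) \<le> 2 * (\<Sum>j\<le>n. ennreal (real j) * L n j)"
    by (subst ennreal_mult''[symmetric, of _ 2, simplified]) (simp_all add: mult.commute)
  then show "ennreal (real n / 2) \<le> (\<Sum>j\<le>n. ennreal (real j) * L n j)"
    by (subst (asm) ennreal_mult_le_mult_iff) auto
qed

section \<open>Mean squares of both coordinates at the argmax of one of them\<close>

lemma fst_psum: "fst (psum z k) = psum (\<lambda>i. fst (z i)) k"
  and snd_psum: "snd (psum z k) = psum (\<lambda>i. snd (z i)) k"
  by (simp_all add: psum_def fst_sum snd_sum)

text \<open>The squared radius of a disc around the origin that contains the walk, by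
  Cauchy-Schwarz. It is invariant under rotations, and its explicit mean cancels from the final
  bound for the area.\<close>

definition sq_bound :: "nat \<Rightarrow> (nat \<Rightarrow> real \<times> real) \<Rightarrow> real" where
  "sq_bound n z = real n * (\<Sum>k<n. (fst (z k))\<^sup>2 + (snd (z k))\<^sup>2)"

lemma measurable_sq_bound[measurable]: "sq_bound n \<in> borel_measurable (gauss2_seq n)"
proof -
  have "(\<lambda>z. sq_bound n z) \<in> borel_measurable (gauss2_seq n)"
    unfolding sq_bound_def
    by (intro borel_measurable_times borel_measurable_sum borel_measurable_add borel_measurable_power borel_measurable_fst_snd) auto
  then show ?thesis .
qed

lemma sq_bound_nonneg: "0 \<le> sq_bound n z"
  by (auto simp: sq_bound_def intro!: mult_nonneg_nonneg sum_nonneg)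

lemma sq_bound:
  assumes "k \<le> n"
  shows "(fst (psum z k))\<^sup>2 + (snd (psum z k))\<^sup>2 \<le> sq_bound n z"
proof -
  have *: "(\<Sum>i<k. x i)\<^sup>2 \<le> real n * (\<Sum>i<n. (x i)\<^sup>2)" for x :: "nat \<Rightarrow> real"
  proof -
    have "(\<Sum>i<k. x i)\<^sup>2 \<le> (\<Sum>i<k. (x i)\<^sup>2) * real k"
      using sum_squared_le_sum_of_squares[of x "{..<k}"] by simp
    also have "\<dots> \<le> (\<Sum>i<n. (x i)\<^sup>2) * real n"
      using assms by (intro mult_mono sum_mono2 sum_nonneg) auto
    finally show ?thesis by (simp add: mult.commute)
  qed
  show ?thesis
    using *[of "\<lambda>i. fst (z i)"] *[of "\<lambda>i. snd (z i)"]
    by (simp add: psum_def fst_sum snd_sum sq_bound_def sum.distrib distrib_left)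
qed

lemma nn_integral_sq_bound: "(\<integral>\<^sup>+ z. ennreal (sq_bound n z) \<partial>gauss2_seq n) = ennreal (2 * (real n)\<^sup>2)"
proof -
  define Q where "Q m z = (\<Sum>k<m. (fst (z k))\<^sup>2 + (snd (z k))\<^sup>2)" for m and z :: "nat \<Rightarrow> real \<times> real"
  have Q[measurable]: "Q m \<in> borel_measurable (gauss2_seq m)" for m
  proof -
    have "(\<lambda>z. Q m z) \<in> borel_measurable (gauss2_seq m)"
      unfolding Q_def
      by (intro borel_measurable_sum borel_measurable_add borel_measurable_power borel_measurable_fst_snd) auto
    then show ?thesis .
  qed
  have Q0: "0 \<le> Q m z" for m z by (auto simp: Q_def intro!: sum_nonneg)
  have "(\<integral>\<^sup>+ z. ennreal (Q m z) \<partial>gauss2_seq m) = ennreal (2 * real m)" for m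
  proof (induction m)
    case 0
    show ?case by (simp add: Q_def)
  next
    case (Suc m)
    have upd: "Q (Suc m) (z(m := v)) = Q m z + ((fst v)\<^sup>2 + (snd v)\<^sup>2)" for z v
    proof -
      have "Q m (z(m := v)) = Q m z" unfolding Q_def by (intro sum.cong) auto
      then show ?thesis by (simp add: Q_def)
    qed
    have two: "(\<integral>\<^sup>+ v. ennreal ((fst v)\<^sup>2 + (snd v)\<^sup>2) \<partial>gauss2) = 2"
    proof -
      have one: "(\<integral>\<^sup>+ x. ennreal (x\<^sup>2) \<partial>gauss) = 1" using gauss_square[of 0] by simp
      have "(\<integral>\<^sup>+ y. ennreal (x\<^sup>2 + y\<^sup>2) \<partial>gauss) = ennreal (x\<^sup>2) + 1" for x
      proof -
        have "(\<lambda>y :: real. ennreal (y\<^sup>2)) \<in> borel_measurable gauss"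
          unfolding measurable_cong_sets[OF sets_gauss refl] by simp
        then show ?thesis
          by (simp, subst nn_integral_add) (simp_all add: one gauss.emeasure_space_1[simplified])
      qed
      then have "(\<integral>\<^sup>+ v. ennreal ((fst v)\<^sup>2 + (snd v)\<^sup>2) \<partial>gauss2) = (\<integral>\<^sup>+ x. ennreal (x\<^sup>2) + 1 \<partial>gauss)"
        by (subst nn_integral_gauss2) (auto intro!: nn_integral_cong simp del: ennreal_plus)
      also have "\<dots> = 1 + 1"
        by (subst nn_integral_add)
           (auto simp: one gauss.emeasure_space_1[simplified] measurable_cong_sets[OF sets_gauss refl])
      finally show ?thesis by simp
    qed
    have "(\<integral>\<^sup>+ z. ennreal (Q (Suc m) z) \<partial>gauss2_seq (Suc m)) =
       (\<integral>\<^sup>+ z. \<integral>\<^sup>+ v. ennreal (Q m z) + ennreal ((fst v)\<^sup>2 + (snd v)\<^sup>2) \<partial>gauss2 \<partial>gauss2_seq m)"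
      by (subst gauss2_seq_Suc) (auto simp: upd Q0 simp flip: ennreal_plus)
    also have "\<dots> = (\<integral>\<^sup>+ z. ennreal (Q m z) + 2 \<partial>gauss2_seq m)"
    proof (rule nn_integral_cong)
      fix z :: "nat \<Rightarrow> real \<times> real"
      have "(\<lambda>v. ennreal ((fst v)\<^sup>2 + (snd v)\<^sup>2)) \<in> borel_measurable gauss2"
        unfolding measurable_cong_sets[OF sets_gauss2 refl] by measurable
      then show "(\<integral>\<^sup>+ v. ennreal (Q m z) + ennreal ((fst v)\<^sup>2 + (snd v)\<^sup>2) \<partial>gauss2) = ennreal (Q m z) + 2"
        by (subst nn_integral_add) (simp_all add: gauss2.emeasure_space_1[simplified] two del: ennreal_plus)
    qed
    also have "\<dots> = ennreal (2 * real m) + 2"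
      by (subst nn_integral_add) (auto simp: Suc.IH gauss2_seq.emeasure_space_1)
    also have "\<dots> = ennreal (2 * real (Suc m))"
      by (simp add: distrib_left add.commute)
    finally show ?case .
  qed
  moreover have "ennreal (sq_bound n z) = ennreal (real n) * ennreal (Q n z)" for z
    by (simp add: sq_bound_def Q_def ennreal_mult sum_nonneg)
  ultimately have "(\<integral>\<^sup>+ z. ennreal (sq_bound n z) \<partial>gauss2_seq n) = ennreal (real n) * ennreal (2 * real n)"
    by (simp add: nn_integral_cmult)
  then show ?thesis
    by (simp add: ennreal_mult[symmetric] power2_eq_square mult_ac)
qed

lemma psum_zip:
  fixes x y :: "nat \<Rightarrow> real"
  assumes "k \<le> n"
  shows "psum (\<lambda>k\<in>{..<n}. (x k, y k)) k = (psum x k, psum y k)"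
  using assms by (auto simp: prod_eq_iff fst_psum snd_psum intro!: psum_cong)

text \<open>The maximum of the reversed walk is the drawdown of the original walk at time
  \<open>n\<close>, whose mean square is at most \<open>n\<close>.\<close>

lemma nn_integral_max_square:
  "(\<integral>\<^sup>+ x. (\<Sum>j\<le>n. if last_max n (psum x) j then ennreal ((psum x j)\<^sup>2) else 0) \<partial>gauss_seq n) \<le> ennreal (real n)"
    (is "?I \<le> _")
proof -
  have [measurable]: "Measurable.pred (gauss_seq n) (\<lambda>x. last_max n (psum x) j)" for j
    by measurable
  let ?f = "\<lambda>x. (\<Sum>j\<le>n. if last_max n (psum x) j then ennreal ((psum x j)\<^sup>2) else 0)"
  have "?I = (\<integral>\<^sup>+ x. ?f (\<lambda>k\<in>{..<n}. - x (n - 1 - k)) \<partial>gauss_seq n)"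
    by (rule gauss_seq_reversal[symmetric]) measurable
  also have "\<dots> = (\<integral>\<^sup>+ x. ennreal ((drawdown x n)\<^sup>2) \<partial>gauss_seq n)"
  proof (rule nn_integral_cong)
    fix x :: "nat \<Rightarrow> real"
    let ?x = "\<lambda>k\<in>{..<n}. - x (n - 1 - k)"
    obtain j where j: "last_max n (psum ?x) j" using last_max_exists by blast
    then have jn: "j \<le> n" and max: "i \<le> n \<Longrightarrow> psum ?x i \<le> psum ?x j" for i by (auto simp: last_max_def)
    obtain i where i: "i \<le> n" "drawdown x n = psum x i - psum x n" using drawdown_attained by blast
    have "psum ?x j \<le> drawdown x n"
      using drawdown_ge[of "n - j" n x] psum_reversed[OF jn, of x] by simp
    moreover have "drawdown x n \<le> psum ?x j"
      using max[of "n - i"] psum_reversed[of "n - i" n x] i by simp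
    ultimately have "psum ?x j = drawdown x n" by simp
    then show "?f ?x = ennreal ((drawdown x n)\<^sup>2)"
      using sum_last_max[OF j, of "\<lambda>j. ennreal ((psum ?x j)\<^sup>2)"] by simp
  qed
  also have "\<dots> \<le> ennreal (real n)" by (rule nn_integral_drawdown_square)
  finally show ?thesis .
qed

text \<open>The walk is at the last maximum of its first coordinate at a time of mean at least \<open>n / 2\<close>
  that is independent of the second coordinate.\<close>

lemma expected_support_aux:
  defines "f \<equiv> \<lambda>n z. \<Sum>j\<le>n. if last_max n (\<lambda>k. fst (psum z k)) j
      then ennreal (sq_bound n z - (fst (psum z j))\<^sup>2 + (snd (psum z j))\<^sup>2) else 0"
  shows "f n \<in> borel_measurable (gauss2_seq n)"
    and "ennreal (2 * (real n)\<^sup>2 - real n / 2) \<le> (\<integral>\<^sup>+ z. f n z \<partial>gauss2_seq n)"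
proof -
  have [measurable]: "Measurable.pred (gauss2_seq n) (\<lambda>z. last_max n (\<lambda>k. fst (psum z k)) j)" for j
    by measurable
  have [measurable]: "Measurable.pred (gauss_seq n) (\<lambda>x. last_max n (psum x) j)" for j
    by measurable
  let ?g = "\<lambda>z :: nat \<Rightarrow> real \<times> real. \<Sum>j\<le>n. if last_max n (\<lambda>k. fst (psum z k)) j then ennreal ((fst (psum z j))\<^sup>2) else 0"
  let ?h = "\<lambda>z :: nat \<Rightarrow> real \<times> real. \<Sum>j\<le>n. if last_max n (\<lambda>k. fst (psum z k)) j then ennreal ((snd (psum z j))\<^sup>2) else 0"
  have "(\<lambda>z. f n z) \<in> borel_measurable (gauss2_seq n)"
    unfolding f_def by measurable
  then show f[measurable]: "f n \<in> borel_measurable (gauss2_seq n)" .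
  have g[measurable]: "?g \<in> borel_measurable (gauss2_seq n)" by measurable
  have h[measurable]: "?h \<in> borel_measurable (gauss2_seq n)" by measurable
  \<comment> \<open>The term of interest contains a difference. It is moved into an identity between
    sums, because subtraction in \<open>ennreal\<close> truncates; that the difference is
    nonnegative comes from \<open>sq_bound\<close>.\<close>
  have eq: "f n z + ?g z = ennreal (sq_bound n z) + ?h z" for z
  proof -
    obtain j where j: "last_max n (\<lambda>k. fst (psum z k)) j" using last_max_exists by blast
    then have "j \<le> n" by (simp add: last_max_def)
    from sq_bound[OF this, of z] have "(fst (psum z j))\<^sup>2 + (snd (psum z j))\<^sup>2 \<le> sq_bound n z" .
    then have "0 \<le> sq_bound n z - (fst (psum z j))\<^sup>2"
      by (smt (verit) zero_le_power2)
    then show ?thesis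
      unfolding f_def sum_last_max[OF j, of "\<lambda>j. ennreal (_ j)"]
      by (subst (1 2) ennreal_plus[symmetric]) (auto simp: sq_bound_nonneg)
  qed
  have "(\<integral>\<^sup>+ z. ?g z \<partial>gauss2_seq n) = (\<integral>\<^sup>+ x. \<integral>\<^sup>+ y. ?g (\<lambda>k\<in>{..<n}. (x k, y k)) \<partial>gauss_seq n \<partial>gauss_seq n)"
    by (rule gauss2_seq_split) fact
  also have "\<dots> = (\<integral>\<^sup>+ x. (\<Sum>j\<le>n. if last_max n (psum x) j then ennreal ((psum x j)\<^sup>2) else 0) \<partial>gauss_seq n)"
  proof (rule nn_integral_cong)
    fix x :: "nat \<Rightarrow> real"
    have "?g (\<lambda>k\<in>{..<n}. (x k, y k)) = (\<Sum>j\<le>n. if last_max n (psum x) j then ennreal ((psum x j)\<^sup>2) else 0)" for y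
      by (intro sum.cong if_cong last_max_congI) (auto simp: psum_zip)
    then show "(\<integral>\<^sup>+ y. ?g (\<lambda>k\<in>{..<n}. (x k, y k)) \<partial>gauss_seq n) = (\<Sum>j\<le>n. if last_max n (psum x) j then ennreal ((psum x j)\<^sup>2) else 0)"
      by (simp add: gauss_seq.emeasure_space_1)
  qed
  also have "\<dots> \<le> ennreal (real n)" by (rule nn_integral_max_square)
  finally have g_le: "(\<integral>\<^sup>+ z. ?g z \<partial>gauss2_seq n) \<le> ennreal (real n)" .
  have "(\<integral>\<^sup>+ z. ?h z \<partial>gauss2_seq n) = (\<integral>\<^sup>+ x. \<integral>\<^sup>+ y. ?h (\<lambda>k\<in>{..<n}. (x k, y k)) \<partial>gauss_seq n \<partial>gauss_seq n)"
    by (rule gauss2_seq_split) fact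
  also have "\<dots> = (\<integral>\<^sup>+ x. (\<Sum>j\<le>n. ennreal (real j) * (if last_max n (psum x) j then 1 else 0)) \<partial>gauss_seq n)"
  proof (rule nn_integral_cong)
    fix x :: "nat \<Rightarrow> real"
    have "(\<integral>\<^sup>+ y. ?h (\<lambda>k\<in>{..<n}. (x k, y k)) \<partial>gauss_seq n) =
       (\<integral>\<^sup>+ y. (\<Sum>j\<le>n. ennreal ((psum y j)\<^sup>2) * (if last_max n (psum x) j then 1 else 0)) \<partial>gauss_seq n)"
    proof (intro nn_integral_cong sum.cong refl)
      fix y :: "nat \<Rightarrow> real" and j assume j: "j \<in> {..n}"
      have "last_max n (\<lambda>k. fst (psum (\<lambda>k\<in>{..<n}. (x k, y k)) k)) j = last_max n (psum x) j"
        by (intro last_max_congI) (simp add: psum_zip)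
      then show "(if last_max n (\<lambda>k. fst (psum (\<lambda>k\<in>{..<n}. (x k, y k)) k)) j then ennreal ((snd (psum (\<lambda>k\<in>{..<n}. (x k, y k)) j))\<^sup>2) else 0)
         = ennreal ((psum y j)\<^sup>2) * (if last_max n (psum x) j then 1 else 0)"
        using j by (simp add: psum_zip)
    qed
    also have "\<dots> = (\<Sum>j\<le>n. (\<integral>\<^sup>+ y. ennreal ((psum y j)\<^sup>2) * (if last_max n (psum x) j then 1 else 0) \<partial>gauss_seq n))"
      by (rule nn_integral_sum) (auto intro!: borel_measurable_times_ennreal measurable_compose[OF _ measurable_ennreal] borel_measurable_power measurable_psum)
    \<comment> \<open>With \<open>x\<close> fixed the index of the maximum is a constant, so the
      independent second coordinate contributes its variance at that time.\<close>
    also have "\<dots> = (\<Sum>j\<le>n. ennreal (real j) * (if last_max n (psum x) j then 1 else 0))"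
      by (intro sum.cong refl) (auto simp: nn_integral_psum_square)
    finally show "(\<integral>\<^sup>+ y. ?h (\<lambda>k\<in>{..<n}. (x k, y k)) \<partial>gauss_seq n) = (\<Sum>j\<le>n. ennreal (real j) * (if last_max n (psum x) j then 1 else 0))" .
  qed
  also have "\<dots> = (\<Sum>j\<le>n. ennreal (real j) * (\<integral>\<^sup>+ x. (if last_max n (psum x) j then 1 else 0) \<partial>gauss_seq n))"
    by (subst nn_integral_sum) (auto simp: nn_integral_cmult)
  also have "\<dots> \<ge> ennreal (real n / 2)" by (rule last_max_prob(2))
  finally have h_ge: "ennreal (real n / 2) \<le> (\<integral>\<^sup>+ z. ?h z \<partial>gauss2_seq n)" .
  \<comment> \<open>The means collected: \<open>2 * n\<^sup>2\<close> from the radius, at most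
    \<open>n\<close> from the squared maximum, at least \<open>n / 2\<close> from the other
    coordinate.\<close>
  have "ennreal (2 * (real n)\<^sup>2 - real n / 2) + ennreal (real n) = ennreal (2 * (real n)\<^sup>2) + ennreal (real n / 2)"
  proof -
    have "real n * 1 \<le> real n * real n" by (cases n) (auto intro!: mult_left_mono)
    then have "real n \<le> 4 * (real n)\<^sup>2" unfolding power2_eq_square by linarith
    then show ?thesis by (subst (1 2) ennreal_plus[symmetric]) auto
  qed
  also have "\<dots> \<le> (\<integral>\<^sup>+ z. ennreal (sq_bound n z) \<partial>gauss2_seq n) + (\<integral>\<^sup>+ z. ?h z \<partial>gauss2_seq n)"
    using h_ge by (intro add_mono) (simp_all add: nn_integral_sq_bound)
  also have "\<dots> = (\<integral>\<^sup>+ z. f n z \<partial>gauss2_seq n) + (\<integral>\<^sup>+ z. ?g z \<partial>gauss2_seq n)"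
    by (subst (1 2) nn_integral_add[symmetric]) (auto simp: eq)
  also have "\<dots> \<le> (\<integral>\<^sup>+ z. f n z \<partial>gauss2_seq n) + ennreal (real n)"
    using g_le by (rule add_left_mono)
  finally show "ennreal (2 * (real n)\<^sup>2 - real n / 2) \<le> (\<integral>\<^sup>+ z. f n z \<partial>gauss2_seq n)"
    by (simp add: ennreal_add_left_cancel_le add.commute[of _ "ennreal (real n)"])
qed


section \<open>Averaging the swept area over all directions\<close>

lemma last_max_mult: "0 < c \<Longrightarrow> last_max n (\<lambda>k. c * f k) j = last_max n f j"
  by (simp add: last_max_def)

text \<open>Rotating every increment preserves the law and \<open>sq_bound\<close>, and turns the
  component in direction \<open>(a, b)\<close> into the first coordinate.\<close>

lemma expected_support:
  assumes ab: "a\<^sup>2 + b\<^sup>2 = 1"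
  defines "X \<equiv> \<lambda>z k. a * fst (psum z k) + b * snd (psum z k)"
    and "Y \<equiv> \<lambda>z k. - b * fst (psum z k) + a * snd (psum z k)"
  shows "ennreal (2 * (real n)\<^sup>2 - real n / 2)
    \<le> (\<integral>\<^sup>+ z. (\<Sum>j\<le>n. if last_max n (X z) j then ennreal (sq_bound n z - (X z j)\<^sup>2 + (Y z j)\<^sup>2) else 0) \<partial>gauss2_seq n)"
proof -
  define f where "f z = (\<Sum>j\<le>n. if last_max n (\<lambda>k. fst (psum z k)) j
      then ennreal (sq_bound n z - (fst (psum z j))\<^sup>2 + (snd (psum z j))\<^sup>2) else 0)" for z :: "nat \<Rightarrow> real \<times> real"
  define r where "r z = (\<lambda>k\<in>{..<n}. (a * fst (z k) + b * snd (z k), - b * fst (z k) + a * snd (z k)))" for z :: "nat \<Rightarrow> real \<times> real"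
  have r: "psum (r z) k = (X z k, Y z k)" if "k \<le> n" for z k
    using that by (auto simp: r_def X_def Y_def psum_def prod_eq_iff fst_sum snd_sum sum_distrib_left sum.distrib sum_negf sum_subtractf)
  have rot: "(a * x + b * y)\<^sup>2 + (- b * x + a * y)\<^sup>2 = x\<^sup>2 + y\<^sup>2" for x y
  proof -
    have "(a * x + b * y)\<^sup>2 + (- b * x + a * y)\<^sup>2 = (a\<^sup>2 + b\<^sup>2) * (x\<^sup>2 + y\<^sup>2)"
      by (simp add: power2_eq_square algebra_simps)
    then show ?thesis by (simp add: ab)
  qed
  have sq: "sq_bound n (r z) = sq_bound n z" for z
    unfolding sq_bound_def by (intro arg_cong2[of _ _ _ _ "(*)"] refl sum.cong) (simp add: r_def rot[simplified])
  have "f (r z) = (\<Sum>j\<le>n. if last_max n (X z) j then ennreal (sq_bound n z - (X z j)\<^sup>2 + (Y z j)\<^sup>2) else 0)" for z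
    unfolding f_def sq by (intro sum.cong if_cong last_max_congI) (simp_all add: r)
  then have "(\<integral>\<^sup>+ z. (\<Sum>j\<le>n. if last_max n (X z) j then ennreal (sq_bound n z - (X z j)\<^sup>2 + (Y z j)\<^sup>2) else 0) \<partial>gauss2_seq n)
     = (\<integral>\<^sup>+ z. f (r z) \<partial>gauss2_seq n)" by simp
  also have "\<dots> = (\<integral>\<^sup>+ z. f z \<partial>gauss2_seq n)"
    unfolding r_def using expected_support_aux(1)[of n]
    by (intro gauss2_seq_rotation ab) (simp add: f_def[abs_def])
  also have "\<dots> \<ge> ennreal (2 * (real n)\<^sup>2 - real n / 2)"
    unfolding f_def by (rule expected_support_aux(2))
  finally show ?thesis .
qed

text \<open>For the unit normal \<open>\<sigma> * (- s, 1) / sqrt (1 + s\<^sup>2)\<close> the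
  numerator is the squared radius minus the squared normal component plus the squared tangential
  component of the supporting point. The outer division by \<open>1 + s\<^sup>2\<close> turns the
  slope element into the angle element.\<close>

definition sweep_integrand :: "nat \<Rightarrow> real \<Rightarrow> nat \<Rightarrow> (nat \<Rightarrow> real \<times> real) \<Rightarrow> real \<Rightarrow> ennreal" where
  "sweep_integrand n \<sigma> j z s = ennreal ((sq_bound n z - (snd (psum z j) - s * fst (psum z j))\<^sup>2 / (1 + s\<^sup>2)
      + (fst (psum z j) + s * snd (psum z j))\<^sup>2 / (1 + s\<^sup>2)) / (1 + s\<^sup>2))
      * indicator {s. last_max n (\<lambda>k. \<sigma> * (snd (psum z k) - s * fst (psum z k))) j} s"

definition sweep_area :: "nat \<Rightarrow> (nat \<Rightarrow> real \<times> real) \<Rightarrow> ennreal" where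
  "sweep_area n z = (\<Sum>\<sigma>\<in>{1,-1}. \<Sum>j\<le>n. \<integral>\<^sup>+ s. sweep_integrand n \<sigma> j z s \<partial>lborel)"

text \<open>A measurable upper bound for the area of the hull, equal to
  \<open>\<integral> (h(\<theta>)\<^sup>2 - h'(\<theta>)\<^sup>2) d\<theta> / 2\<close> for the support function \<open>h\<close>.\<close>

definition hull_bound :: "nat \<Rightarrow> (nat \<Rightarrow> real \<times> real) \<Rightarrow> real" where
  "hull_bound n z = (2 * pi * sq_bound n z - enn2real (sweep_area n z)) / 2"

lemma measurable_sweep_integrand:
  assumes "j \<le> n"
  shows "(\<lambda>(z, s). sweep_integrand n \<sigma> j z s) \<in> borel_measurable (gauss2_seq n \<Otimes>\<^sub>M lborel)"
proof -
  have [measurable]: "(\<lambda>p. psum (fst p) k) \<in> borel_measurable (gauss2_seq n \<Otimes>\<^sub>M lborel)" if "k \<le> n" for k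
    using measurable_compose[OF measurable_fst measurable_psum(2)[OF that]] .
  have [measurable]: "(\<lambda>p. snd p) \<in> borel_measurable (gauss2_seq n \<Otimes>\<^sub>M (lborel :: real measure))"
    using measurable_snd[of "gauss2_seq n" "lborel :: real measure"] by simp
  have m: "(\<lambda>p. fst (psum (fst p) k)) \<in> borel_measurable (gauss2_seq n \<Otimes>\<^sub>M lborel)"
    "(\<lambda>p. snd (psum (fst p) k)) \<in> borel_measurable (gauss2_seq n \<Otimes>\<^sub>M lborel)" if "k \<le> n" for k
    using that by (auto intro!: borel_measurable_fst_snd)
  note [measurable] = m
  have [measurable]: "(\<lambda>p. sq_bound n (fst p)) \<in> borel_measurable (gauss2_seq n \<Otimes>\<^sub>M lborel)"
    using measurable_compose[OF measurable_fst measurable_sq_bound] .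
  have [measurable]: "Measurable.pred (gauss2_seq n \<Otimes>\<^sub>M lborel)
      (\<lambda>p. last_max n (\<lambda>k. \<sigma> * (snd (psum (fst p) k) - snd p * fst (psum (fst p) k))) j)"
    by (rule measurable_last_max) measurable
  show ?thesis
    using assms unfolding sweep_integrand_def split_def indicator_def mem_Collect_eq by measurable
qed

lemma measurable_hull_bound[measurable]: "hull_bound n \<in> borel_measurable (gauss2_seq n)"
  and measurable_sweep_area[measurable]: "sweep_area n \<in> borel_measurable (gauss2_seq n)"
proof -
  have "(\<lambda>z. sweep_area n z) \<in> borel_measurable (gauss2_seq n)"
    unfolding sweep_area_def
    by (intro borel_measurable_sum lborel.borel_measurable_nn_integral measurable_sweep_integrand) auto
  then show [measurable]: "sweep_area n \<in> borel_measurable (gauss2_seq n)" .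
  have "(\<lambda>z. hull_bound n z) \<in> borel_measurable (gauss2_seq n)"
    unfolding hull_bound_def by measurable
  then show "hull_bound n \<in> borel_measurable (gauss2_seq n)" .
qed

lemma sweep_area_le:
  "2 * emeasure lborel (convex hull (psum z ` {..n})) + sweep_area n z \<le> ennreal (2 * pi * sq_bound n z)"
  unfolding sweep_area_def sweep_integrand_def by (rule emeasure_hull_sweep) (rule sq_bound)

text \<open>The sweep inequality forces \<open>sweep_area\<close> to be finite, so
  \<open>enn2real\<close> in the definition loses nothing. The identity has no subtraction, which
  lets both sides be integrated in \<open>ennreal\<close>.\<close>

lemma hull_bound:
  "measure lborel (convex hull (psum z ` {..n})) \<le> hull_bound n z"
  "2 * ennreal (hull_bound n z) + sweep_area n z = ennreal (2 * pi * sq_bound n z)"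
proof -
  define e where "e = emeasure lborel (convex hull (psum z ` {..n}))"
  have le: "2 * e + sweep_area n z \<le> ennreal (2 * pi * sq_bound n z)"
    unfolding e_def by (rule sweep_area_le)
  then have "e < \<top>" "sweep_area n z < \<top>"
    using le_less_trans[OF le ennreal_less_top] by (auto simp: ennreal_mult_less_top less_top[symmetric] top_unique)
  then obtain e' i where e': "e = ennreal e'" "0 \<le> e'" and i: "sweep_area n z = ennreal i" "0 \<le> i"
    by (cases e; cases "sweep_area n z") auto
  have "ennreal (2 * e' + i) \<le> ennreal (2 * pi * sq_bound n z)"
    using le e' i by (simp add: ennreal_mult)
  then have le': "2 * e' + i \<le> 2 * pi * sq_bound n z"
    using sq_bound_nonneg[of n z] by (subst (asm) ennreal_le_iff) auto
  have hb: "hull_bound n z = (2 * pi * sq_bound n z - i) / 2"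
    by (simp add: hull_bound_def i)
  show "measure lborel (convex hull (psum z ` {..n})) \<le> hull_bound n z"
    using le' e' unfolding hb measure_def e_def[symmetric] by simp
  have "0 \<le> hull_bound n z" using le' e' unfolding hb by simp
  then have "2 * ennreal (hull_bound n z) + ennreal i = ennreal (2 * hull_bound n z + i)"
    using i by (simp add: ennreal_mult)
  then show "2 * ennreal (hull_bound n z) + sweep_area n z = ennreal (2 * pi * sq_bound n z)"
    by (simp add: hb i field_simps)
qed

text \<open>After the integrals are exchanged, rotation invariance gives every slope and either side
  the same lower bound \<open>c\<close> for the mean; the angle element has total mass
  \<open>pi\<close> for each of the two sides.\<close>

lemma nn_integral_sweep_area:
  "ennreal (2 * pi * (2 * (real n)\<^sup>2 - real n / 2)) \<le> (\<integral>\<^sup>+ z. sweep_area n z \<partial>gauss2_seq n)"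
proof -
  define c where "c = 2 * (real n)\<^sup>2 - real n / 2"
  have c: "0 \<le> c"
  proof -
    have "real n * 1 \<le> real n * real n" by (cases n) (auto intro!: mult_left_mono)
    then show ?thesis unfolding c_def power2_eq_square by linarith
  qed
  interpret sw: pair_sigma_finite "gauss2_seq n" "lborel :: real measure" ..
  have meas: "(\<lambda>s. sweep_integrand n \<sigma> j z s) \<in> borel_measurable lborel" if "j \<le> n" "z \<in> space (gauss2_seq n)" for \<sigma> j z
    using measurable_compose[OF measurable_Pair1'[OF that(2)] measurable_sweep_integrand[OF that(1)]] by simp
  have meas': "(\<lambda>z. sweep_integrand n \<sigma> j z s) \<in> borel_measurable (gauss2_seq n)" if "j \<le> n" for \<sigma> j s
    using measurable_compose[OF measurable_Pair2' measurable_sweep_integrand[OF that]] by simp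
  have "(\<integral>\<^sup>+ z. sweep_area n z \<partial>gauss2_seq n)
     = (\<Sum>\<sigma>\<in>{1,-1}. \<Sum>j\<le>n. \<integral>\<^sup>+ z. \<integral>\<^sup>+ s. sweep_integrand n \<sigma> j z s \<partial>lborel \<partial>gauss2_seq n)"
    unfolding sweep_area_def
    by (subst nn_integral_sum; (intro sum.cong refl nn_integral_sum)?)
       (auto intro!: borel_measurable_sum lborel.borel_measurable_nn_integral measurable_sweep_integrand)
  also have "\<dots> = (\<Sum>\<sigma>\<in>{1,-1}. \<Sum>j\<le>n. \<integral>\<^sup>+ s. \<integral>\<^sup>+ z. sweep_integrand n \<sigma> j z s \<partial>gauss2_seq n \<partial>lborel)"
    by (intro sum.cong refl sw.Fubini'[symmetric] measurable_sweep_integrand) auto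
  also have "\<dots> = (\<Sum>\<sigma>\<in>{1,-1}. \<integral>\<^sup>+ s. \<integral>\<^sup>+ z. (\<Sum>j\<le>n. sweep_integrand n \<sigma> j z s) \<partial>gauss2_seq n \<partial>lborel)"
  proof (intro sum.cong refl)
    fix \<sigma> :: real
    have "(\<lambda>s. \<integral>\<^sup>+ z. sweep_integrand n \<sigma> j z s \<partial>gauss2_seq n) \<in> borel_measurable lborel" if "j \<le> n" for j
      using measurable_pair_swap[OF measurable_sweep_integrand[OF that, of \<sigma>]]
      by (intro gauss2_seq.borel_measurable_nn_integral) (simp add: split_def)
    then show "(\<Sum>j\<le>n. \<integral>\<^sup>+ s. \<integral>\<^sup>+ z. sweep_integrand n \<sigma> j z s \<partial>gauss2_seq n \<partial>lborel)
       = (\<integral>\<^sup>+ s. \<integral>\<^sup>+ z. (\<Sum>j\<le>n. sweep_integrand n \<sigma> j z s) \<partial>gauss2_seq n \<partial>lborel)"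
      by (subst nn_integral_sum[symmetric]) (auto intro!: nn_integral_cong nn_integral_sum[symmetric] meas')
  qed
  also have "\<dots> \<ge> (\<Sum>\<sigma>\<in>{1,-1::real}. \<integral>\<^sup>+ s. ennreal (1 / (1 + s\<^sup>2)) * ennreal c \<partial>lborel)"
  proof (intro sum_mono nn_integral_mono)
    fix \<sigma> s :: real assume \<sigma>: "\<sigma> \<in> {1, -1}"
    define d where "d = sqrt (1 + s\<^sup>2)"
    have d: "d > 0" "d\<^sup>2 = 1 + s\<^sup>2" by (simp_all add: d_def add_pos_nonneg)
    \<comment> \<open>\<open>(a, b)\<close> is the unit vector
      \<open>\<sigma> * (- s, 1) / d\<close>, normal to lines of slope \<open>s\<close>;
      \<open>X\<close> and \<open>Y\<close> are the components of the walk along it and orthogonal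
      to it.\<close>
    define a where "a = - \<sigma> * s / d"
    define b where "b = \<sigma> / d"
    have s2: "\<sigma>\<^sup>2 = 1" using \<sigma> by auto
    have ab: "a\<^sup>2 + b\<^sup>2 = 1"
      using d by (simp add: a_def b_def power_divide power_mult_distrib s2 add_divide_distrib[symmetric] add.commute add_nonneg_eq_0_iff)
    define X where "X z k = a * fst (psum z k) + b * snd (psum z k)" for z :: "nat \<Rightarrow> real \<times> real" and k
    define Y where "Y z k = - b * fst (psum z k) + a * snd (psum z k)" for z :: "nat \<Rightarrow> real \<times> real" and k
    have X: "X z k = (1 / d) * (\<sigma> * (snd (psum z k) - s * fst (psum z k)))" for z k
      by (simp add: X_def a_def b_def diff_divide_distrib algebra_simps)
    have Y: "Y z k = (1 / d) * (- \<sigma> * (fst (psum z k) + s * snd (psum z k)))" for z k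
      by (simp add: Y_def a_def b_def diff_divide_distrib add_divide_distrib algebra_simps)
    have X2: "(X z k)\<^sup>2 = (snd (psum z k) - s * fst (psum z k))\<^sup>2 / (1 + s\<^sup>2)" for z k
      unfolding X by (simp add: power_mult_distrib power_divide s2 d)
    have Y2: "(Y z k)\<^sup>2 = (fst (psum z k) + s * snd (psum z k))\<^sup>2 / (1 + s\<^sup>2)" for z k
      unfolding Y by (simp add: power_mult_distrib power_divide s2 d)
    have L: "last_max n (X z) j = last_max n (\<lambda>k. \<sigma> * (snd (psum z k) - s * fst (psum z k))) j" for z j
      unfolding X[abs_def] using d by (intro last_max_mult) simp
    have "ennreal (1 / (1 + s\<^sup>2)) * ennreal c
      \<le> ennreal (1 / (1 + s\<^sup>2)) * (\<integral>\<^sup>+ z. (\<Sum>j\<le>n. if last_max n (X z) j then ennreal (sq_bound n z - (X z j)\<^sup>2 + (Y z j)\<^sup>2) else 0) \<partial>gauss2_seq n)"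
      unfolding c_def X_def Y_def by (intro mult_left_mono expected_support ab) simp
    also have "\<dots> = (\<integral>\<^sup>+ z. ennreal (1 / (1 + s\<^sup>2)) * (\<Sum>j\<le>n. if last_max n (X z) j then ennreal (sq_bound n z - (X z j)\<^sup>2 + (Y z j)\<^sup>2) else 0) \<partial>gauss2_seq n)"
    proof (rule nn_integral_cmult[symmetric])
      have [measurable]: "(\<lambda>z. X z k) \<in> borel_measurable (gauss2_seq n)" "(\<lambda>z. Y z k) \<in> borel_measurable (gauss2_seq n)" if "k \<le> n" for k
        using that unfolding X_def Y_def by (auto intro!: borel_measurable_add borel_measurable_diff borel_measurable_times borel_measurable_fst_snd)
      show "(\<lambda>z. \<Sum>j\<le>n. if last_max n (X z) j then ennreal (sq_bound n z - (X z j)\<^sup>2 + (Y z j)\<^sup>2) else 0) \<in> borel_measurable (gauss2_seq n)"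
        by measurable
    qed
    also have "\<dots> = (\<integral>\<^sup>+ z. (\<Sum>j\<le>n. sweep_integrand n \<sigma> j z s) \<partial>gauss2_seq n)"
      unfolding sum_distrib_left
      by (intro nn_integral_cong sum.cong refl)
         (auto simp: sweep_integrand_def L X2 Y2 ennreal_mult'[symmetric] add_nonneg_nonneg)
    finally show "ennreal (1 / (1 + s\<^sup>2)) * ennreal c \<le> (\<integral>\<^sup>+ z. (\<Sum>j\<le>n. sweep_integrand n \<sigma> j z s) \<partial>gauss2_seq n)" .
  qed
  also have "(\<Sum>\<sigma>\<in>{1,-1::real}. \<integral>\<^sup>+ s. ennreal (1 / (1 + s\<^sup>2)) * ennreal c \<partial>lborel) = ennreal (2 * pi * c)"
    using c by (subst nn_integral_multc) (auto simp: nn_integral_cauchy ennreal_mult mult.assoc)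
  finally show ?thesis unfolding c_def .
qed

text \<open>The contribution of the disc cancels and half of \<open>pi * n\<close> remains. Per step
  this is \<open>pi / 2\<close>, the bound for the mean hull area at time 1.\<close>

lemma nn_integral_hull_bound: "(\<integral>\<^sup>+ z. ennreal (hull_bound n z) \<partial>gauss2_seq n) \<le> ennreal (pi / 2 * real n)"
proof -
  define c where "c = 2 * pi * (2 * (real n)\<^sup>2 - real n / 2)"
  have c: "0 \<le> c"
  proof -
    have "real n * 1 \<le> real n * real n" by (cases n) (auto intro!: mult_left_mono)
    then show ?thesis unfolding c_def power2_eq_square by (intro mult_nonneg_nonneg) auto
  qed
  define h where "h = (\<integral>\<^sup>+ z. ennreal (hull_bound n z) \<partial>gauss2_seq n)"
  have "2 * h + ennreal c \<le> 2 * h + (\<integral>\<^sup>+ z. sweep_area n z \<partial>gauss2_seq n)"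
    unfolding c_def by (intro add_left_mono nn_integral_sweep_area)
  also have "\<dots> = (\<integral>\<^sup>+ z. 2 * ennreal (hull_bound n z) + sweep_area n z \<partial>gauss2_seq n)"
    unfolding h_def by (subst nn_integral_add) (auto simp: nn_integral_cmult)
  also have "\<dots> = (\<integral>\<^sup>+ z. ennreal (2 * pi) * ennreal (sq_bound n z) \<partial>gauss2_seq n)"
    by (intro nn_integral_cong) (simp add: hull_bound(2) ennreal_mult sq_bound_nonneg)
  also have "\<dots> = ennreal (2 * pi * (2 * (real n)\<^sup>2))"
    by (subst nn_integral_cmult) (auto simp: nn_integral_sq_bound ennreal_mult[symmetric])
  finally have le: "2 * h + ennreal c \<le> ennreal (2 * pi * (2 * (real n)\<^sup>2))" .
  then have "h < \<top>"
    using le_less_trans[OF le ennreal_less_top] by (auto simp: ennreal_mult_less_top less_top[symmetric] top_unique)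
  then obtain h' where h': "h = ennreal h'" "0 \<le> h'" by (cases h) auto
  have "ennreal (2 * h' + c) \<le> ennreal (2 * pi * (2 * (real n)\<^sup>2))"
    using le h' c by (simp add: ennreal_mult)
  then have "2 * h' + c \<le> 2 * pi * (2 * (real n)\<^sup>2)"
    by (subst (asm) ennreal_le_iff) auto
  then have "h' \<le> pi / 2 * real n"
    unfolding c_def by (simp add: algebra_simps)
  then show ?thesis unfolding h_def[symmetric] h' by (rule ennreal_leI)
qed

section \<open>Exit time of the range of a Gaussian walk\<close>

text \<open>The range split into the distance to the running maximum and the distance to the running
  minimum. These two numbers are the state on which \<open>exit_potential\<close> depends.\<close>

definition walk_range :: "(nat \<Rightarrow> real) \<Rightarrow> nat \<Rightarrow> real" where
  "walk_range x k = drawdown x k + drawdown (\<lambda>i. - x i) k"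

lemma walk_range_attained: "\<exists>i\<le>k. \<exists>j\<le>k. walk_range x k = psum x i - psum x j"
proof -
  obtain i where i: "i \<le> k" "drawdown x k = psum x i - psum x k"
    using drawdown_attained by blast
  obtain j where j: "j \<le> k" "drawdown (\<lambda>i. - x i) k = psum (\<lambda>i. - x i) j - psum (\<lambda>i. - x i) k"
    using drawdown_attained by blast
  have "psum (\<lambda>i. - x i) l = - psum x l" for l by (simp add: psum_def sum_negf)
  then show ?thesis using i j by (intro exI[of _ i] exI[of _ j] conjI) (auto simp: walk_range_def)
qed

lemma walk_range_0[simp]: "walk_range x 0 = 0"
  by (simp add: walk_range_def)

lemma walk_range_cong: "(\<And>i. i < k \<Longrightarrow> x i = y i) \<Longrightarrow> walk_range x k = walk_range y k"
  unfolding walk_range_def by (intro arg_cong2[of _ _ _ _ "(+)"] drawdown_cong) auto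

text \<open>For a Brownian motion \<open>W\<close> with running extrema \<open>m\<close> and \<open>M\<close> the process
  \<open>((M - W)\<^sup>2 + (W - m)\<^sup>2) / 2 - t\<close> is a martingale; the terms containing \<open>b\<close> absorb the overshoot of the walk.\<close>

definition exit_potential :: "real \<Rightarrow> real \<Rightarrow> real \<Rightarrow> real \<Rightarrow> real" where
  "exit_potential h b p q = ((h + b)\<^sup>2 - p\<^sup>2 - q\<^sup>2) / 2 + b * (h + b - p - q)"

lemma exit_potential_nonneg:
  assumes "0 \<le> p" "0 \<le> q" "p + q \<le> h + b" "0 \<le> b"
  shows "0 \<le> exit_potential h b p q"
proof -
  have "p\<^sup>2 + q\<^sup>2 \<le> (p + q)\<^sup>2" using assms by (simp add: power2_sum)
  also have "\<dots> \<le> (h + b)\<^sup>2" using assms by (intro power_mono) auto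
  finally show ?thesis
    using assms unfolding exit_potential_def by (intro add_nonneg_nonneg mult_nonneg_nonneg) auto
qed

text \<open>The linear charge \<open>b * \<alpha>\<close> pays for
  \<open>\<alpha>\<^sup>2 / 2\<close> as long as \<open>\<alpha> \<le> 2 * b\<close>. A larger
  overshoot forces \<open>b \<le> \<bar>x\<bar>\<close>, and then
  \<open>\<alpha>\<^sup>2 \<le> x\<^sup>2 \<le> x ^ 4 / b\<^sup>2\<close>.\<close>

lemma overshoot_le:
  fixes \<alpha> b x :: real
  assumes "0 \<le> \<alpha>" "\<alpha> \<le> \<bar>x\<bar>" "0 < b"
  shows "\<alpha>\<^sup>2 / 2 - b * \<alpha> \<le> x ^ 4 / b\<^sup>2"
proof (cases "\<alpha> \<le> 2 * b")
  case True
  then have "\<alpha> * \<alpha> \<le> 2 * b * \<alpha>" using assms by (intro mult_right_mono) auto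
  then have "\<alpha>\<^sup>2 / 2 - b * \<alpha> \<le> 0" by (simp add: power2_eq_square)
  also have "0 \<le> x ^ 4 / b\<^sup>2" by simp
  finally show ?thesis .
next
  case False
  then have b: "b \<le> \<bar>x\<bar>" using assms by linarith
  have "\<alpha>\<^sup>2 \<le> x\<^sup>2" using assms power_mono[of \<alpha> "\<bar>x\<bar>" 2] by simp
  moreover have "b\<^sup>2 \<le> x\<^sup>2" using assms b power_mono[of b "\<bar>x\<bar>" 2] by simp
  then have "x\<^sup>2 * b\<^sup>2 \<le> x\<^sup>2 * x\<^sup>2" by (intro mult_left_mono) auto
  then have "x\<^sup>2 \<le> x ^ 4 / b\<^sup>2" using assms by (simp add: field_simps power2_eq_square power4_eq_xxxx)
  moreover have "0 \<le> b * \<alpha>" "0 \<le> x\<^sup>2" using assms by auto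
  ultimately show ?thesis by linarith
qed

text \<open>\<open>\<alpha>\<close> and \<open>\<beta>\<close> are the amounts by which the step
  sets a new maximum or minimum; apart from them the potential changes by exactly
  \<open>- x\<^sup>2 + x * (p - q)\<close>. In \<open>K\<close>, the term
  \<open>2 / b\<^sup>2\<close> pays for the two overshoots, or for \<open>x\<^sup>2\<close> when the
  new range exceeds even \<open>h + b\<close>; the term \<open>h / b ^ 3\<close> pays for
  \<open>x * (p - q)\<close> in that last case.\<close>

lemma exit_potential_step:
  fixes p q h b x :: real
  assumes pq: "0 \<le> p" "0 \<le> q" "p + q \<le> h" and b: "0 < b"
  defines "p' \<equiv> max (p - x) 0" and "q' \<equiv> max (q + x) 0" and "K \<equiv> 2 / b\<^sup>2 + h / b ^ 3"
  shows "(if p' + q' \<le> h then exit_potential h b p' q' else 0) \<le> exit_potential h b p q - x\<^sup>2 + x * (p - q) + K * x ^ 4"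
proof -
  define \<alpha> where "\<alpha> = max (x - p) 0"
  define \<beta> where "\<beta> = max (- x - q) 0"
  have ab: "0 \<le> \<alpha>" "0 \<le> \<beta>" "\<alpha> \<le> \<bar>x\<bar>" "\<beta> \<le> \<bar>x\<bar>" "\<alpha> + \<beta> \<le> \<bar>x\<bar>"
    using pq by (auto simp: \<alpha>_def \<beta>_def)
  have p': "p' = p - x + \<alpha>" "p'\<^sup>2 = (p - x)\<^sup>2 - \<alpha>\<^sup>2"
    by (cases "x \<le> p"; simp add: p'_def \<alpha>_def max_absorb1 max_absorb2 power2_eq_square algebra_simps)+
  have q': "q' = q + x + \<beta>" "q'\<^sup>2 = (q + x)\<^sup>2 - \<beta>\<^sup>2"
    by (cases "0 \<le> q + x"; simp add: q'_def \<beta>_def max_absorb1 max_absorb2 power2_eq_square algebra_simps)+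
  have U: "exit_potential h b p' q' = exit_potential h b p q - x\<^sup>2 + x * (p - q) + (\<alpha>\<^sup>2 / 2 - b * \<alpha>) + (\<beta>\<^sup>2 / 2 - b * \<beta>)"
    unfolding exit_potential_def p'(2) q'(2) unfolding p'(1) q'(1)
    by (simp add: power2_eq_square field_simps)
  have "(\<alpha>\<^sup>2 / 2 - b * \<alpha>) + (\<beta>\<^sup>2 / 2 - b * \<beta>) \<le> x ^ 4 / b\<^sup>2 + x ^ 4 / b\<^sup>2"
    using ab b by (intro add_mono overshoot_le) auto
  also have "\<dots> \<le> K * x ^ 4"
    unfolding K_def using pq b by (simp add: distrib_right)
  finally have U_le: "exit_potential h b p' q' \<le> exit_potential h b p q - x\<^sup>2 + x * (p - q) + K * x ^ 4"
    unfolding U by linarith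
  \<comment> \<open>Once the range exceeds \<open>h\<close> the potential is replaced by 0, so the
    right side must be nonnegative there. Within the margin this follows from nonnegativity of the
    potential; beyond it the step has size at least \<open>b\<close>.\<close>
  have "0 \<le> exit_potential h b p q - x\<^sup>2 + x * (p - q) + K * x ^ 4" if "\<not> p' + q' \<le> h"
  proof (cases "p' + q' \<le> h + b")
    case True
    then have "0 \<le> exit_potential h b p' q'"
      using b by (intro exit_potential_nonneg) (auto simp: p'_def q'_def)
    with U_le show ?thesis by linarith
  next
    case False
    then have bx: "b \<le> \<bar>x\<bar>" using ab pq unfolding p' q' by linarith
    have "b\<^sup>2 \<le> x\<^sup>2" using b bx power_mono[of b "\<bar>x\<bar>" 2] by simp
    then have "x\<^sup>2 * b\<^sup>2 \<le> x\<^sup>2 * x\<^sup>2" by (intro mult_left_mono) auto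
    then have "x\<^sup>2 \<le> x ^ 4 / b\<^sup>2"
      using b by (simp add: field_simps power2_eq_square power4_eq_xxxx)
    also have "\<dots> \<le> 2 / b\<^sup>2 * x ^ 4" by (simp add: divide_right_mono)
    finally have 1: "x\<^sup>2 \<le> 2 / b\<^sup>2 * x ^ 4" .
    have "b ^ 3 \<le> \<bar>x\<bar> ^ 3" using b bx by (intro power_mono) auto
    then have "h * (\<bar>x\<bar> * b ^ 3) \<le> h * (\<bar>x\<bar> * \<bar>x\<bar> ^ 3)"
      using pq by (intro mult_left_mono) auto
    also have "\<bar>x\<bar> * \<bar>x\<bar> ^ 3 = \<bar>x\<bar> ^ 4" by (simp only: power_Suc[symmetric]) simp
    also have "\<dots> = x ^ 4" by simp
    finally have 2: "h * \<bar>x\<bar> \<le> h / b ^ 3 * x ^ 4"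
      using b by (simp add: field_simps)
    have "\<bar>p - q\<bar> \<le> h" using pq by linarith
    then have "\<bar>x * (p - q)\<bar> \<le> \<bar>x\<bar> * h" unfolding abs_mult by (intro mult_left_mono) auto
    moreover have "0 \<le> exit_potential h b p q" using pq b by (intro exit_potential_nonneg) auto
    moreover have "K * x ^ 4 = 2 / b\<^sup>2 * x ^ 4 + h / b ^ 3 * x ^ 4" by (simp add: K_def distrib_right)
    ultimately show ?thesis
      using 1 2 abs_ge_minus_self[of "x * (p - q)"] mult.commute[of "\<bar>x\<bar>" h] by linarith
  qed
  with U_le show ?thesis by auto
qed

text \<open>The projection of a planar Gaussian step to a unit vector is standard normal. Hence the
  linear term has mean 0, \<open>- x\<^sup>2\<close> has mean \<open>- \<delta>\<close> and the
  quartic has mean \<open>3 * K * \<delta>\<^sup>2\<close>.\<close>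

lemma exit_potential_mean_step:
  fixes p q h b \<delta> :: real and u :: "real \<times> real"
  assumes pq: "0 \<le> p" "0 \<le> q" "p + q \<le> h" and b: "0 < b" and \<delta>: "0 < \<delta>" and u: "(fst u)\<^sup>2 + (snd u)\<^sup>2 = 1"
  defines "x \<equiv> \<lambda>v. sqrt \<delta> * (fst u * fst v + snd u * snd v)"
    and "K \<equiv> 2 / b\<^sup>2 + h / b ^ 3"
  assumes \<delta>K: "3 * K * \<delta> \<le> 1"
  shows "(\<integral>\<^sup>+ v. (if max (p - x v) 0 + max (q + x v) 0 \<le> h then ennreal (exit_potential h b (max (p - x v) 0) (max (q + x v) 0)) else 0) \<partial>gauss2)
      + ennreal (\<delta> * (1 - 3 * K * \<delta>)) \<le> ennreal (exit_potential h b p q)"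
proof -
  define U where "U = exit_potential h b p q"
  let ?g = "\<lambda>y. U + (sqrt \<delta> * (p - q)) * y + (- \<delta>) * y\<^sup>2 + (K * \<delta>\<^sup>2) * y ^ 4"
  have sq: "sqrt \<delta> ^ 4 = \<delta>\<^sup>2"
    using \<delta> by (simp add: power4_eq_xxxx power2_eq_square mult.assoc)
  have g: "?g y = U - (sqrt \<delta> * y)\<^sup>2 + (sqrt \<delta> * y) * (p - q) + K * (sqrt \<delta> * y) ^ 4" for y
    using \<delta> by (simp add: power_mult_distrib sq algebra_simps)
  have step: "(if max (p - x v) 0 + max (q + x v) 0 \<le> h then exit_potential h b (max (p - x v) 0) (max (q + x v) 0) else 0)
      \<le> ?g (fst u * fst v + snd u * snd v)" for v
    unfolding g unfolding U_def K_def x_def by (rule exit_potential_step[OF pq b])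
  \<comment> \<open>Every real \<open>y\<close> is the projection of the step
    \<open>y *\<^sub>R u\<close>, so the pointwise bound makes the polynomial nonnegative on the
    whole line, as \<open>gauss_poly\<close> demands.\<close>
  have g0: "0 \<le> ?g y" for y
  proof -
    have "0 \<le> (if max (p - x v) 0 + max (q + x v) 0 \<le> h then exit_potential h b (max (p - x v) 0) (max (q + x v) 0) else 0)" for v
      using b by (auto intro!: exit_potential_nonneg)
    note * = order_trans[OF this step]
    have "fst u * fst (y *\<^sub>R u) + snd u * snd (y *\<^sub>R u) = y * ((fst u)\<^sup>2 + (snd u)\<^sup>2)"
      by (simp add: power2_eq_square algebra_simps)
    with *[of "y *\<^sub>R u"] show ?thesis by (simp add: u)
  qed
  have "(\<integral>\<^sup>+ v. (if max (p - x v) 0 + max (q + x v) 0 \<le> h then ennreal (exit_potential h b (max (p - x v) 0) (max (q + x v) 0)) else 0) \<partial>gauss2)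
    \<le> (\<integral>\<^sup>+ v. ennreal (?g (fst u * fst v + snd u * snd v)) \<partial>gauss2)"
  proof (rule nn_integral_mono)
    fix v :: "real \<times> real"
    show "(if max (p - x v) 0 + max (q + x v) 0 \<le> h then ennreal (exit_potential h b (max (p - x v) 0) (max (q + x v) 0)) else 0)
      \<le> ennreal (?g (fst u * fst v + snd u * snd v))"
      using ennreal_leI[OF step[of v]] by (simp split: if_split_asm)
  qed
  also have "\<dots> = (\<integral>\<^sup>+ y. ennreal (?g y) \<partial>gauss)"
    by (rule nn_integral_gauss2_inner[OF _ u]) simp
  also have "\<dots> = ennreal (U - \<delta> + 3 * (K * \<delta>\<^sup>2))"
    using gauss_poly(1)[of U "sqrt \<delta> * (p - q)" "- \<delta>" "K * \<delta>\<^sup>2"] g0 by simp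
  finally have le: "(\<integral>\<^sup>+ v. (if max (p - x v) 0 + max (q + x v) 0 \<le> h then ennreal (exit_potential h b (max (p - x v) 0) (max (q + x v) 0)) else 0) \<partial>gauss2)
     \<le> ennreal (U - \<delta> + 3 * (K * \<delta>\<^sup>2))" .
  have c: "0 \<le> \<delta> * (1 - 3 * K * \<delta>)" using \<delta> \<delta>K by auto
  have "0 \<le> U - \<delta> + 3 * (K * \<delta>\<^sup>2)"
    using gauss_poly(2)[of U "sqrt \<delta> * (p - q)" "- \<delta>" "K * \<delta>\<^sup>2"] g0 by simp
  then have "ennreal (U - \<delta> + 3 * (K * \<delta>\<^sup>2)) + ennreal (\<delta> * (1 - 3 * K * \<delta>)) = ennreal U"
    using c by (subst ennreal_plus[symmetric]) (auto simp: algebra_simps power2_eq_square)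
  then show ?thesis
    using add_right_mono[OF le, of "ennreal (\<delta> * (1 - 3 * K * \<delta>))"] by (simp add: U_def)
qed

text \<open>Increments from step \<open>m\<close> on, in direction \<open>u\<close> and in the units
  of the path: the factor \<open>sqrt \<delta>\<close> undoes the normalisation. The shifted index
  lets \<open>drawdown\<close> and \<open>walk_range\<close> restart at \<open>m\<close>.\<close>

definition proj_steps :: "real \<Rightarrow> nat \<Rightarrow> real \<times> real \<Rightarrow> (nat \<Rightarrow> real \<times> real) \<Rightarrow> nat \<Rightarrow> real" where
  "proj_steps \<delta> m u z i = sqrt \<delta> * (fst u * fst (z (m + i)) + snd u * snd (z (m + i)))"

lemma measurable_drawdown_compose:
  assumes "\<And>i. i < k \<Longrightarrow> (\<lambda>z. f z i) \<in> borel_measurable N"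
  shows "(\<lambda>z. drawdown (f z) k) \<in> borel_measurable N"
  using assms
proof (induction k)
  case (Suc k)
  then have [measurable]: "(\<lambda>z. drawdown (f z) k) \<in> borel_measurable N" "(\<lambda>z. f z k) \<in> borel_measurable N"
    by auto
  show ?case by simp
qed simp

text \<open>A restart at a fixed step: \<open>E\<close> and \<open>u\<close> are determined by the
  first \<open>m\<close> increments, so on \<open>E\<close> the later steps in direction
  \<open>u\<close> are fresh Gaussians. At every step the mean potential of the surviving walk falls
  by at least \<open>c\<close> times the survival probability, and telescoping bounds the sum of
  these probabilities, the mean number of surviving steps.\<close>

lemma sum_alive_le:
  fixes h b \<delta> :: real and E :: "(nat \<Rightarrow> real \<times> real) \<Rightarrow> bool" and u :: "(nat \<Rightarrow> real \<times> real) \<Rightarrow> real \<times> real"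
  assumes h: "0 \<le> h" and b: "0 < b" and \<delta>: "0 < \<delta>"
  defines "K \<equiv> 2 / b\<^sup>2 + h / b ^ 3"
  assumes \<delta>K: "3 * K * \<delta> \<le> 1"
    and cong: "\<And>z z'. (\<And>i. i < m \<Longrightarrow> z i = z' i) \<Longrightarrow> E z = E z' \<and> u z = u z'"
    and E: "Measurable.pred (gauss2_seq m) E" and u: "u \<in> borel_measurable (gauss2_seq m)"
    and unit: "\<And>z. E z \<Longrightarrow> (fst (u z))\<^sup>2 + (snd (u z))\<^sup>2 = 1"
  defines "alive \<equiv> \<lambda>l z. E z \<and> walk_range (proj_steps \<delta> m (u z) z) l \<le> h"
  shows "Measurable.pred (gauss2_seq (m + l)) (alive l)"
    and "ennreal (\<delta> * (1 - 3 * K * \<delta>)) * (\<Sum>l. \<integral>\<^sup>+ z. (if alive l z then 1 else 0) \<partial>gauss2_seq (m + l))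
    \<le> ennreal (exit_potential h b 0 0) * (\<integral>\<^sup>+ z. (if E z then 1 else 0) \<partial>gauss2_seq m)"
proof -
  define c where "c = \<delta> * (1 - 3 * K * \<delta>)"
  define P where "P l z = drawdown (proj_steps \<delta> m (u z) z) l" for l z
  define Q where "Q l z = drawdown (\<lambda>i. - proj_steps \<delta> m (u z) z i) l" for l z
  have range: "walk_range (proj_steps \<delta> m (u z) z) l = P l z + Q l z" for l z
    by (simp add: walk_range_def P_def Q_def)
  have rs: "(\<lambda>z. restrict z {..<m}) \<in> gauss2_seq (m + l) \<rightarrow>\<^sub>M gauss2_seq m" for l
    unfolding gauss2_seq_def by (rule measurable_restrict_subset) auto
  have E'[measurable]: "Measurable.pred (gauss2_seq (m + l)) E" for l
  proof -
    have "E z = E (restrict z {..<m})" for z using cong[of z "restrict z {..<m}"] by simp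
    then have "E = (\<lambda>z. E (restrict z {..<m}))" by (rule ext)
    then show ?thesis using measurable_compose[OF rs E] by simp
  qed
  have u'[measurable]: "u \<in> borel_measurable (gauss2_seq (m + l))" for l
  proof -
    have "u z = u (restrict z {..<m})" for z using cong[of z "restrict z {..<m}"] by simp
    then have "u = (\<lambda>z. u (restrict z {..<m}))" by (rule ext)
    then show ?thesis using measurable_compose[OF rs u] by simp
  qed
  have steps: "(\<lambda>z. proj_steps \<delta> m (u z) z i) \<in> borel_measurable (gauss2_seq (m + l))" if "i < l" for i l
    using that unfolding proj_steps_def
    by (intro borel_measurable_times borel_measurable_add borel_measurable_const borel_measurable_fst_snd u') auto
  have PQ[measurable]: "P l \<in> borel_measurable (gauss2_seq (m + l))" "Q l \<in> borel_measurable (gauss2_seq (m + l))" for l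
    unfolding P_def[abs_def] Q_def[abs_def] using steps by (auto intro!: measurable_drawdown_compose)
  show al[measurable]: "Measurable.pred (gauss2_seq (m + l)) (alive l)" for l
    unfolding alive_def range by measurable
  define V where "V l = (\<integral>\<^sup>+ z. (if alive l z then ennreal (exit_potential h b (P l z) (Q l z)) else 0) \<partial>gauss2_seq (m + l))" for l
  have Vm: "(\<lambda>z. if alive l z then ennreal (exit_potential h b (P l z) (Q l z)) else 0) \<in> borel_measurable (gauss2_seq (m + l))" for l
    unfolding exit_potential_def by measurable
  have V0: "V 0 = ennreal (exit_potential h b 0 0) * (\<integral>\<^sup>+ z. (if E z then 1 else 0) \<partial>gauss2_seq m)"
  proof -
    have "V 0 = (\<integral>\<^sup>+ z. ennreal (exit_potential h b 0 0) * (if E z then 1 else 0) \<partial>gauss2_seq m)"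
      unfolding V_def alive_def by (auto simp: P_def Q_def h intro!: nn_integral_cong)
    then show ?thesis using E by (simp add: nn_integral_cmult)
  qed
  have step: "V (Suc l) + ennreal c * (\<integral>\<^sup>+ z. (if alive l z then 1 else 0) \<partial>gauss2_seq (m + l)) \<le> V l" for l
  proof -
    define F where "F z = (if alive (Suc l) z then ennreal (exit_potential h b (P (Suc l) z) (Q (Suc l) z)) else 0)" for z
    have F[measurable]: "F \<in> borel_measurable (gauss2_seq (Suc (m + l)))"
      unfolding F_def[abs_def] using Vm[of "Suc l"] by simp
    have FI: "(\<lambda>z. \<integral>\<^sup>+ v. F (z(m + l := v)) \<partial>gauss2) \<in> borel_measurable (gauss2_seq (m + l))"
      using measurable_compose[OF measurable_seq_upd(2)[of "m + l"] F]
      by (intro gauss2.borel_measurable_nn_integral)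
         (simp add: split_def measurable_cong_sets[OF sets_pair_measure_cong[OF refl sets_gauss2] refl])
    have "V (Suc l) = (\<integral>\<^sup>+ z. \<integral>\<^sup>+ v. F (z(m + l := v)) \<partial>gauss2 \<partial>gauss2_seq (m + l))"
      unfolding V_def add_Suc_right F_def[symmetric] by (rule gauss2_seq_Suc) (rule F)
    then have "V (Suc l) + ennreal c * (\<integral>\<^sup>+ z. (if alive l z then 1 else 0) \<partial>gauss2_seq (m + l))
       = (\<integral>\<^sup>+ z. (\<integral>\<^sup>+ v. F (z(m + l := v)) \<partial>gauss2) + ennreal c * (if alive l z then 1 else 0) \<partial>gauss2_seq (m + l))"
      using FI by (subst nn_integral_add) (auto simp: nn_integral_cmult)
    also have "\<dots> \<le> V l"
      unfolding V_def
    proof (rule nn_integral_mono)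
      fix z :: "nat \<Rightarrow> real \<times> real"
      have Eu: "E (z(m + l := v)) = E z" "u (z(m + l := v)) = u z" for v
        using cong[of "z(m + l := v)" z] by auto
      define x where "x v = sqrt \<delta> * (fst (u z) * fst v + snd (u z) * snd v)" for v
      have st: "proj_steps \<delta> m (u z) (z(m + l := v)) i = (if i = l then x v else proj_steps \<delta> m (u z) z i)" for v i
        by (simp add: proj_steps_def x_def)
      have dr: "P l (z(m + l := v)) = P l z" "Q l (z(m + l := v)) = Q l z" for v
        unfolding P_def Q_def Eu by (auto intro!: drawdown_cong simp: st)
      have PS: "P (Suc l) (z(m + l := v)) = max (P l z - x v) 0" "Q (Suc l) (z(m + l := v)) = max (Q l z + x v) 0" for v
        using dr[of v] by (simp_all add: P_def Q_def Eu st)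
      show "(\<integral>\<^sup>+ v. F (z(m + l := v)) \<partial>gauss2)
          + ennreal c * (if alive l z then 1 else 0) \<le> (if alive l z then ennreal (exit_potential h b (P l z) (Q l z)) else 0)"
      proof (cases "alive l z")
        case True
        then have z: "E z" "P l z + Q l z \<le> h" by (auto simp: alive_def range)
        have nonneg: "0 \<le> P l z" "0 \<le> Q l z" by (simp_all add: P_def Q_def)
        have F: "F (z(m + l := v)) = (if max (P l z - x v) 0 + max (Q l z + x v) 0 \<le> h
            then ennreal (exit_potential h b (max (P l z - x v) 0) (max (Q l z + x v) 0)) else 0)" for v
          unfolding F_def alive_def range Eu PS by (simp only: z(1) simp_thms)
        show ?thesis
          unfolding F if_P[OF True] mult_1_right x_def c_def K_def
          by (rule exit_potential_mean_step[OF nonneg z(2) b \<delta> unit[OF z(1)] \<delta>K[unfolded K_def]])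
      next
        case False
        \<comment> \<open>A step never shrinks the range: clipping at 0 makes the two new distances
          sum to at least \<open>P l z + Q l z\<close>. So death is permanent.\<close>
        then have "\<not> alive (Suc l) (z(m + l := v))" for v
          unfolding alive_def range Eu PS by linarith
        then have "F (z(m + l := v)) = 0" for v unfolding F_def by (simp only: if_False)
        then show ?thesis using False by simp
      qed
    qed
    finally show ?thesis .
  qed
  have sum: "V L + ennreal c * (\<Sum>l<L. \<integral>\<^sup>+ z. (if alive l z then 1 else 0) \<partial>gauss2_seq (m + l)) \<le> V 0" for L
  proof (induction L)
    case (Suc L)
    have "V (Suc L) + ennreal c * (\<Sum>l<Suc L. \<integral>\<^sup>+ z. (if alive l z then 1 else 0) \<partial>gauss2_seq (m + l))
      = (V (Suc L) + ennreal c * (\<integral>\<^sup>+ z. (if alive L z then 1 else 0) \<partial>gauss2_seq (m + L)))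
         + ennreal c * (\<Sum>l<L. \<integral>\<^sup>+ z. (if alive l z then 1 else 0) \<partial>gauss2_seq (m + l))"
      by (simp add: distrib_left add_ac)
    also have "\<dots> \<le> V L + ennreal c * (\<Sum>l<L. \<integral>\<^sup>+ z. (if alive l z then 1 else 0) \<partial>gauss2_seq (m + l))"
      by (intro add_right_mono step)
    also note Suc.IH
    finally show ?case .
  qed simp
  have "ennreal c * (\<Sum>l. \<integral>\<^sup>+ z. (if alive l z then 1 else 0) \<partial>gauss2_seq (m + l))
    = (\<Sum>l. ennreal c * (\<integral>\<^sup>+ z. (if alive l z then 1 else 0) \<partial>gauss2_seq (m + l)))"
    by simp
  also have "\<dots> \<le> V 0"
  proof (rule suminf_le_const)
    show "(\<Sum>l<L. ennreal c * (\<integral>\<^sup>+ z. (if alive l z then 1 else 0) \<partial>gauss2_seq (m + l))) \<le> V 0" for L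
      unfolding sum_distrib_left[symmetric] by (rule order_trans[OF add_increasing[OF zero_le order_refl] sum])
  qed simp
  finally show "ennreal (\<delta> * (1 - 3 * K * \<delta>)) * (\<Sum>l. \<integral>\<^sup>+ z. (if alive l z then 1 else 0) \<partial>gauss2_seq (m + l))
    \<le> ennreal (exit_potential h b 0 0) * (\<integral>\<^sup>+ z. (if E z then 1 else 0) \<partial>gauss2_seq m)"
    unfolding V0 c_def .
qed

section \<open>Discretised planar Brownian motion\<close>

context standard_planar_brownian_motion
begin

definition incr :: "real \<Rightarrow> 'a \<Rightarrow> nat \<Rightarrow> real \<times> real" where
  "incr \<delta> \<omega> k = ((fst (W (real (Suc k) * \<delta>) \<omega>) - fst (W (real k * \<delta>) \<omega>)) / sqrt \<delta>,
     (snd (W (real (Suc k) * \<delta>) \<omega>) - snd (W (real k * \<delta>) \<omega>)) / sqrt \<delta>)"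

text \<open>\<open>W 0 \<omega>\<close> is kept because the path starts at the origin only almost
  surely; ranges and hull areas are unaffected by this translation.\<close>

lemma W_grid:
  assumes "0 < \<delta>"
  shows "W (real k * \<delta>) \<omega> = W 0 \<omega> + sqrt \<delta> *\<^sub>R psum (incr \<delta> \<omega>) k"
proof (induction k)
  case (Suc k)
  have "sqrt \<delta> *\<^sub>R incr \<delta> \<omega> k = W (real (Suc k) * \<delta>) \<omega> - W (real k * \<delta>) \<omega>"
    using assms by (simp add: incr_def prod_eq_iff)
  then show ?case using Suc by (simp add: psum_Suc scaleR_add_right)
qed simp

lemma measurable_incr: "0 \<le> \<delta> \<Longrightarrow> (\<lambda>\<omega>. \<lambda>k\<in>{..<n}. incr \<delta> \<omega> k) \<in> M \<rightarrow>\<^sub>M gauss2_seq n"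
  unfolding gauss2_seq_def incr_def
  by (intro measurable_restrict) (auto simp: measurable_cong_sets[OF refl sets_gauss2] intro!: borel_measurable_Pair borel_measurable_divide borel_measurable_diff fst.measurable snd.measurable)

end

lemma (in standard_brownian_motion) distr_increments:
  assumes \<delta>: "0 < \<delta>"
  shows "distr M (gauss_seq n) (\<lambda>\<omega>. \<lambda>k\<in>{..<n}. (B (real (Suc k) * \<delta>) \<omega> - B (real k * \<delta>) \<omega>) / sqrt \<delta>) = gauss_seq n"
proof (cases "n = 0")
  case True
  \<comment> \<open>Without increments both measures are the point mass at the empty sequence; the
    characterisation of independence by a product law, applied below, concerns nonempty index
    sets.\<close>
  have "distr M (gauss_seq 0) (\<lambda>\<omega>. \<lambda>k\<in>{..<0}. (B (real (Suc k) * \<delta>) \<omega> - B (real k * \<delta>) \<omega>) / sqrt \<delta>) = gauss_seq 0"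
  proof (rule measure_eqI)
    fix A assume "A \<in> sets (distr M (gauss_seq 0) (\<lambda>\<omega>. \<lambda>k\<in>{..<0}. (B (real (Suc k) * \<delta>) \<omega> - B (real k * \<delta>) \<omega>) / sqrt \<delta>))"
    then have "A \<in> sets (Pi\<^sub>M {} (\<lambda>_. gauss))" by (simp add: gauss_seq_def)
    then have "A = {} \<or> A = {\<lambda>_. undefined}" by (auto simp: sets_PiM_empty)
    then show "emeasure (distr M (gauss_seq 0) (\<lambda>\<omega>. \<lambda>k\<in>{..<0}. (B (real (Suc k) * \<delta>) \<omega> - B (real k * \<delta>) \<omega>) / sqrt \<delta>)) A = emeasure (gauss_seq 0) A"
    proof
      assume A: "A = {\<lambda>_. undefined}"
      have A': "A = space (gauss_seq 0)" by (simp add: A gauss_seq_def space_PiM_empty)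
      have m: "(\<lambda>\<omega>. \<lambda>k\<in>{..<0}. (B (real (Suc k) * \<delta>) \<omega> - B (real k * \<delta>) \<omega>) / sqrt \<delta>) \<in> M \<rightarrow>\<^sub>M gauss_seq 0"
        unfolding gauss_seq_def by (intro measurable_restrict) simp
      show ?thesis
        unfolding A' using prob_space.emeasure_space_1[OF prob_space_distr[OF m]] gauss_seq.emeasure_space_1[of 0]
        by (simp only: space_distr)
    qed simp
  qed simp
  with True show ?thesis by simp
next
  case False
  define X where "X k \<omega> = (B (real (Suc k) * \<delta>) \<omega> - B (real k * \<delta>) \<omega>) / sqrt \<delta>" for k \<omega>
  have rv: "random_variable borel (X k)" for k
    unfolding X_def[abs_def] using \<delta> by (intro borel_measurable_divide borel_measurable_diff measurable) auto
  have X: "distr M borel (X k) = gauss" for k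
  proof -
    have "real (Suc k) * \<delta> - real k * \<delta> = \<delta>" by (simp add: algebra_simps)
    then have "distributed M lborel (\<lambda>\<omega>. B (real (Suc k) * \<delta>) \<omega> - B (real k * \<delta>) \<omega>) (\<lambda>x. ennreal (normal_density 0 (sqrt \<delta>) x))"
      using normal_increments[of "real k * \<delta>" "real (Suc k) * \<delta>"] \<delta> by simp
    then have "distributed M lborel (X k) (\<lambda>x. ennreal (std_normal_density x))"
      using normal_standard_normal_convert[of "sqrt \<delta>" "\<lambda>\<omega>. B (real (Suc k) * \<delta>) \<omega> - B (real k * \<delta>) \<omega>" 0] \<delta>
      by (simp add: X_def[abs_def])
    then have "distr M lborel (X k) = gauss"
      by (simp add: distributed_def gauss_def)
    then show ?thesis by (simp cong: distr_cong)
  qed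
  have "indep_vars (\<lambda>_. borel) (\<lambda>i \<omega>. B (real (Suc i) * \<delta>) \<omega> - B (real i * \<delta>) \<omega>) {..<n}"
    using indep_increments[of "\<lambda>k. real k * \<delta>" n] \<delta> by (auto simp: algebra_simps)
  from indep_vars_compose2[OF this, of "\<lambda>_ x. x / sqrt \<delta>" "\<lambda>_. borel"]
  have "indep_vars (\<lambda>_. borel) X {..<n}" by (simp add: X_def[abs_def])
  then have "distr M (Pi\<^sub>M {..<n} (\<lambda>_. borel)) (\<lambda>\<omega>. \<lambda>k\<in>{..<n}. X k \<omega>) = Pi\<^sub>M {..<n} (\<lambda>k. distr M borel (X k))"
    using False rv by (subst (asm) indep_vars_iff_distr_eq_PiM) auto
  also have "\<dots> = gauss_seq n" by (simp add: X gauss_seq_def)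
  finally have "distr M (Pi\<^sub>M {..<n} (\<lambda>_. borel)) (\<lambda>\<omega>. \<lambda>k\<in>{..<n}. X k \<omega>) = gauss_seq n" .
  moreover have "sets (Pi\<^sub>M {..<n} (\<lambda>_. borel)) = sets (gauss_seq n)"
    unfolding gauss_seq_def by (intro sets_PiM_cong) simp_all
  ultimately show ?thesis
    by (simp add: X_def cong: distr_cong)
qed

context standard_planar_brownian_motion
begin

text \<open>\<open>\<phi>\<close> reads the normalised increments off a whole path, so independence
  of the coordinate processes passes to the two increment sequences. That \<open>\<delta>\<close> is
  absent from the right side is the scaling property.\<close>

lemma nn_integral_incr:
  assumes \<delta>: "0 < \<delta>" and f: "f \<in> borel_measurable (gauss2_seq n)"
  shows "(\<integral>\<^sup>+ \<omega>. f (\<lambda>k\<in>{..<n}. incr \<delta> \<omega> k) \<partial>M) = (\<integral>\<^sup>+ z. f z \<partial>gauss2_seq n)"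
proof -
  define \<phi> where "\<phi> w = (\<lambda>k\<in>{..<n}. (w (real (Suc k) * \<delta>) - w (real k * \<delta>)) / sqrt \<delta>)" for w :: "real \<Rightarrow> real"
  have \<phi>: "\<phi> \<in> (Pi\<^sub>M {0..} (\<lambda>_. borel)) \<rightarrow>\<^sub>M gauss_seq n"
    unfolding \<phi>_def gauss_seq_def
    using \<delta> by (intro measurable_restrict)
       (auto simp: measurable_cong_sets[OF refl sets_gauss] intro!: borel_measurable_divide borel_measurable_diff measurable_component_singleton)
  define X where "X \<omega> = (\<lambda>k\<in>{..<n}. (fst (W (real (Suc k) * \<delta>) \<omega>) - fst (W (real k * \<delta>) \<omega>)) / sqrt \<delta>)" for \<omega>
  define Y where "Y \<omega> = (\<lambda>k\<in>{..<n}. (snd (W (real (Suc k) * \<delta>) \<omega>) - snd (W (real k * \<delta>) \<omega>)) / sqrt \<delta>)" for \<omega>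
  have "\<phi> \<circ> (\<lambda>\<omega>. \<lambda>t\<in>{0..}. fst (W t \<omega>)) = X" "\<phi> \<circ> (\<lambda>\<omega>. \<lambda>t\<in>{0..}. snd (W t \<omega>)) = Y"
    using \<delta> by (auto simp: \<phi>_def X_def Y_def fun_eq_iff)
  then have ind: "indep_var (gauss_seq n) X (gauss_seq n) Y"
    using indep_var_compose[OF indep_coordinates \<phi> \<phi>] by simp
  have dX: "distr M (gauss_seq n) X = gauss_seq n" "distr M (gauss_seq n) Y = gauss_seq n"
    unfolding X_def[abs_def] Y_def[abs_def] by (rule fst.distr_increments[OF \<delta>], rule snd.distr_increments[OF \<delta>])
  have rv: "X \<in> M \<rightarrow>\<^sub>M gauss_seq n" "Y \<in> M \<rightarrow>\<^sub>M gauss_seq n"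
    using ind by (auto dest: indep_var_rv1 indep_var_rv2)
  have joint: "distr M (gauss_seq n \<Otimes>\<^sub>M gauss_seq n) (\<lambda>\<omega>. (X \<omega>, Y \<omega>)) = gauss_seq n \<Otimes>\<^sub>M gauss_seq n"
    using ind unfolding indep_var_distribution_eq dX by simp
  have zip: "(\<lambda>(x, y). \<lambda>k\<in>{..<n}. (x k, y k)) \<in> gauss_seq n \<Otimes>\<^sub>M gauss_seq n \<rightarrow>\<^sub>M gauss2_seq n"
    unfolding gauss2_seq_def split_def
    by (intro measurable_restrict) (simp add: measurable_cong_sets[OF refl sets_gauss2])
  have fz: "(\<lambda>(x, y). f (\<lambda>k\<in>{..<n}. (x k, y k))) \<in> borel_measurable (gauss_seq n \<Otimes>\<^sub>M gauss_seq n)"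
    using measurable_compose[OF zip f] by (simp add: split_def)
  have "(\<integral>\<^sup>+ \<omega>. f (\<lambda>k\<in>{..<n}. incr \<delta> \<omega> k) \<partial>M) = (\<integral>\<^sup>+ \<omega>. (\<lambda>(x, y). f (\<lambda>k\<in>{..<n}. (x k, y k))) (X \<omega>, Y \<omega>) \<partial>M)"
    by (intro nn_integral_cong) (auto simp: X_def Y_def incr_def intro!: arg_cong[of _ _ f])
  also have "\<dots> = (\<integral>\<^sup>+ p. (\<lambda>(x, y). f (\<lambda>k\<in>{..<n}. (x k, y k))) p \<partial>distr M (gauss_seq n \<Otimes>\<^sub>M gauss_seq n) (\<lambda>\<omega>. (X \<omega>, Y \<omega>)))"
    using fz rv by (intro nn_integral_distr[symmetric]) auto
  also have "\<dots> = (\<integral>\<^sup>+ x. \<integral>\<^sup>+ y. f (\<lambda>k\<in>{..<n}. (x k, y k)) \<partial>gauss_seq n \<partial>gauss_seq n)"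
    unfolding joint using gauss_seq.nn_integral_fst[OF fz] by simp
  also have "\<dots> = (\<integral>\<^sup>+ z. f z \<partial>gauss2_seq n)"
    by (rule gauss2_seq_split[OF f, symmetric])
  finally show ?thesis .
qed

text \<open>For functions that look at the first \<open>n\<close> entries only, the restriction to
  these entries may be dropped. Survival events for different \<open>n\<close> can then be evaluated
  on one and the same sequence \<open>incr \<delta> \<omega>\<close>.\<close>

lemma nn_integral_incr':
  assumes \<delta>: "0 < \<delta>" and f: "f \<in> borel_measurable (gauss2_seq n)"
    and cong: "\<And>z z'. (\<And>i. i < n \<Longrightarrow> z i = z' i) \<Longrightarrow> f z = f z'"
  shows "(\<integral>\<^sup>+ \<omega>. f (incr \<delta> \<omega>) \<partial>M) = (\<integral>\<^sup>+ z. f z \<partial>gauss2_seq n)" "(\<lambda>\<omega>. f (incr \<delta> \<omega>)) \<in> borel_measurable M"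
proof -
  have eq: "f (incr \<delta> \<omega>) = f (\<lambda>k\<in>{..<n}. incr \<delta> \<omega> k)" for \<omega>
    by (rule cong) simp
  show "(\<integral>\<^sup>+ \<omega>. f (incr \<delta> \<omega>) \<partial>M) = (\<integral>\<^sup>+ z. f z \<partial>gauss2_seq n)"
    unfolding eq by (rule nn_integral_incr[OF \<delta> f])
  show "(\<lambda>\<omega>. f (incr \<delta> \<omega>)) \<in> borel_measurable M"
    unfolding eq using \<delta> by (intro measurable_compose[OF measurable_incr f]) simp
qed

end

section \<open>Counting and exceedance times\<close>

text \<open>For a predicate that holds up to some step and fails ever after, this is the time of
  failure. As a sum of indicators its integral is a sum of survival probabilities.\<close>

definition tally :: "(nat \<Rightarrow> bool) \<Rightarrow> ennreal" where
  "tally A = (\<Sum>k. if A k then 1 else 0)"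

lemma tally_ge: "(\<And>k. k < K \<Longrightarrow> A k) \<Longrightarrow> of_nat K \<le> tally A"
proof -
  assume A: "\<And>k. k < K \<Longrightarrow> A k"
  have "of_nat K = (\<Sum>k<K. if A k then 1 else 0 :: ennreal)" using A by simp
  also have "\<dots> \<le> tally A" unfolding tally_def by (intro sum_le_suminf) auto
  finally show ?thesis .
qed

lemma tally_le: "(\<And>k. K \<le> k \<Longrightarrow> \<not> A k) \<Longrightarrow> tally A \<le> of_nat K"
proof -
  assume A: "\<And>k. K \<le> k \<Longrightarrow> \<not> A k"
  have "tally A = (\<Sum>k<K. if A k then 1 else 0)"
    unfolding tally_def using A by (intro suminf_finite) (auto simp: not_less)
  also have "\<dots> \<le> (\<Sum>k<K. 1)" by (intro sum_mono) auto
  finally show ?thesis by simp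
qed

lemma tally_top:
  assumes "\<And>k. A k"
  shows "tally A = \<top>"
proof (rule ccontr)
  assume "tally A \<noteq> \<top>"
  then obtain n where "tally A < of_nat n"
    using ennreal_Ex_less_of_nat[of "tally A"] by (auto simp: less_top)
  with tally_ge[of n A] assms show False by (simp add: leD)
qed

lemma least_failure:
  fixes A :: "nat \<Rightarrow> bool"
  assumes "\<not> A k"
  obtains K where "\<not> A K" "\<And>j. j < K \<Longrightarrow> A j"
proof (rule that)
  show "\<not> A (LEAST k. \<not> A k)" using LeastI[of "\<lambda>k. \<not> A k", OF assms] .
  show "A j" if "j < (LEAST k. \<not> A k)" for j using not_less_Least[OF that] by simp
qed

lemma exceed_one_time_le: "0 \<le> t \<Longrightarrow> 1 < f t \<Longrightarrow> exceed_one_time f \<le> ennreal t"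
  unfolding exceed_one_time_def by (rule INF_lower) simp

lemma exceed_one_time_ge: "(\<And>s. 0 \<le> s \<Longrightarrow> 1 < f s \<Longrightarrow> t \<le> s) \<Longrightarrow> ennreal t \<le> exceed_one_time f"
  unfolding exceed_one_time_def by (rule INF_greatest) (auto intro: ennreal_leI)

lemma path_range_gt:
  assumes w: "continuous_on {0..} w" and s: "s \<in> {0..t}" "s' \<in> {0..t}" and gt: "1 < w s - w s'"
  shows "1 < path_range w t"
proof -
  have "compact (w ` {0..t})"
    by (intro compact_continuous_image continuous_on_subset[OF w]) auto
  then have b: "bdd_above (w ` {0..t})" "bdd_below (w ` {0..t})"
    by (auto dest: compact_imp_bounded bounded_imp_bdd_above bounded_imp_bdd_below)
  have "w s \<le> (SUP s\<in>{0..t}. w s)" "(INF s\<in>{0..t}. w s) \<le> w s'"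
    using b s by (auto intro: cSUP_upper cINF_lower)
  with gt show ?thesis unfolding path_range_def by linarith
qed

lemma path_range_gtD:
  assumes w: "continuous_on {0..} w" and t: "0 \<le> t" and gt: "1 < path_range w t"
  obtains s s' where "s \<in> {0..t}" "s' \<in> {0..t}" "1 < w s - w s'"
proof -
  have c: "continuous_on {0..t} w" by (rule continuous_on_subset[OF w]) auto
  obtain s where s: "s \<in> {0..t}" "\<And>x. x \<in> {0..t} \<Longrightarrow> w x \<le> w s"
    using continuous_attains_sup[of "{0..t}" w] c t by auto
  obtain s' where s': "s' \<in> {0..t}" "\<And>x. x \<in> {0..t} \<Longrightarrow> w s' \<le> w x"
    using continuous_attains_inf[of "{0..t}" w] c t by auto
  have "(SUP s\<in>{0..t}. w s) \<le> w s" using s t by (intro cSUP_least) auto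
  moreover have "w s' \<le> (INF s\<in>{0..t}. w s)" using s' t by (intro cINF_greatest) auto
  ultimately show thesis using that[OF s(1) s'(1)] gt unfolding path_range_def by linarith
qed

lemma compact_hull_path:
  fixes w :: "real \<Rightarrow> real \<times> real"
  assumes w: "continuous_on {0..} w"
  shows "compact (convex hull (w ` {0..t}))"
  by (intro compact_convex_hull compact_continuous_image continuous_on_subset[OF w]) auto

lemma hull_area_mono:
  assumes w: "continuous_on {0..} w" and st: "s \<le> t"
  shows "hull_area w s \<le> hull_area w t"
  unfolding hull_area_def
proof (rule measure_mono_fmeasurable)
  show "convex hull (w ` {0..s}) \<subseteq> convex hull (w ` {0..t})"
    using st by (intro hull_mono image_mono) auto
  show "convex hull (w ` {0..s}) \<in> sets lborel"
    using compact_hull_path[OF w] by (simp add: borel_compact)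
  show "convex hull (w ` {0..t}) \<in> fmeasurable lborel"
    using compact_hull_path[OF w, of t] emeasure_bounded_finite[OF compact_imp_bounded[OF compact_hull_path[OF w, of t]]]
    by (simp add: fmeasurable_def borel_compact)
qed

lemma hull_area_gt:
  fixes w :: "real \<Rightarrow> real \<times> real"
  assumes w: "continuous_on {0..} w" and s: "\<alpha> \<in> {0..t}" "\<beta> \<in> {0..t}" "\<gamma> \<in> {0..t}" "\<eta> \<in> {0..t}"
    and gt: "2 < \<bar>cross2 (w \<beta> - w \<alpha>) (w \<gamma> - w \<eta>)\<bar>"
  shows "1 < hull_area w t"
proof -
  have c: "compact (convex hull (w ` {0..t}))" by (rule compact_hull_path[OF w])
  have fin: "emeasure lborel (convex hull (w ` {0..t})) < \<infinity>"
    using emeasure_bounded_finite[OF compact_imp_bounded[OF c]] .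
  have "ennreal (\<bar>cross2 (w \<beta> - w \<alpha>) (w \<gamma> - w \<eta>)\<bar> / 2) \<le> emeasure lborel (convex hull (w ` {0..t}))"
    using s c by (intro hull_area_ge_cross2) (auto simp: borel_compact)
  also have "\<dots> = ennreal (hull_area w t)"
    unfolding hull_area_def using fin by (intro emeasure_eq_ennreal_measure) auto
  finally have "\<bar>cross2 (w \<beta> - w \<alpha>) (w \<gamma> - w \<eta>)\<bar> / 2 \<le> hull_area w t"
    by (subst (asm) ennreal_le_iff) (auto simp: hull_area_def)
  with gt show ?thesis by linarith
qed

lemma measure_hull_affine:
  fixes S :: "(real \<times> real) set"
  assumes S: "finite S"
  shows "measure lborel (convex hull ((\<lambda>x. a + c *\<^sub>R x) ` S)) = c\<^sup>2 * measure lborel (convex hull S)"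
proof -
  have comp: "compact (convex hull S)" using S by (intro compact_convex_hull finite_imp_compact)
  have e: "emeasure lborel X = emeasure lebesgue X" if "compact X" for X :: "(real \<times> real) set"
    using that by (simp add: borel_compact)
  have "emeasure lborel (convex hull ((\<lambda>x. a + c *\<^sub>R x) ` S)) = emeasure lebesgue ((\<lambda>x. a + c *\<^sub>R x) ` (convex hull S))"
    by (subst convex_hull_affinity) (rule e[OF compact_affinity[OF comp]])
  also have "\<dots> = ennreal (c\<^sup>2) * emeasure lborel (convex hull S)"
    using emeasure_lebesgue_affine[of c a "convex hull S"] e[OF comp]
    by (simp add: add.commute ennreal_power power2_eq_square)
  finally show ?thesis
    by (simp add: measure_def enn2real_mult)
qed

section \<open>Approximation of the hull of a path by dyadic times\<close>

lemma dyadic_tendsto: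
  fixes x :: real
  assumes "0 \<le> x"
  shows "(\<lambda>m. real (nat \<lfloor>x * 2 ^ m\<rfloor>) / 2 ^ m) \<longlonglongrightarrow> x"
proof (rule tendsto_sandwich)
  have fl: "real (nat \<lfloor>x * 2 ^ m\<rfloor>) = of_int \<lfloor>x * 2 ^ m\<rfloor>" for m :: nat
    using assms by simp
  show "\<forall>\<^sub>F m in sequentially. x - (1/2) ^ m \<le> real (nat \<lfloor>x * 2 ^ m\<rfloor>) / 2 ^ m"
  proof (intro always_eventually allI)
    fix m :: nat
    have "x * 2 ^ m \<le> of_int \<lfloor>x * 2 ^ m\<rfloor> + 1" using real_of_int_floor_add_one_ge .
    then have "(x * 2 ^ m - 1) / 2 ^ m \<le> of_int \<lfloor>x * 2 ^ m\<rfloor> / 2 ^ m" by (intro divide_right_mono) simp_all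
    then show "x - (1/2) ^ m \<le> real (nat \<lfloor>x * 2 ^ m\<rfloor>) / 2 ^ m"
      unfolding fl by (simp add: diff_divide_distrib power_one_over)
  qed
  show "\<forall>\<^sub>F m in sequentially. real (nat \<lfloor>x * 2 ^ m\<rfloor>) / 2 ^ m \<le> x"
    unfolding fl by (intro always_eventually allI) (simp add: divide_le_eq)
  have "(\<lambda>m. x - (1/2) ^ m) \<longlonglongrightarrow> x - 0"
    by (intro tendsto_intros LIMSEQ_power_zero) simp
  then show "(\<lambda>m. x - (1/2) ^ m) \<longlonglongrightarrow> x" by simp
qed simp

text \<open>The hulls of the dyadic samples increase to a convex set \<open>C\<close>, whose closure
  contains the path by continuity. The frontier of a convex set is null, so the closure adds no
  area; by monotonicity in \<open>m\<close>, a bound for infinitely many \<open>m\<close> is a bound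
  for all.\<close>

lemma hull_area_le_dyadic:
  fixes w :: "real \<Rightarrow> real \<times> real"
  assumes w: "continuous_on {0..} w" and t: "0 < t"
    and inf: "\<exists>\<^sub>F m in sequentially. measure lborel (convex hull ((\<lambda>k. w (real k * (t / 2 ^ m))) ` {..2 ^ m})) \<le> c"
  shows "hull_area w t \<le> c"
proof -
  define G where "G m = (\<lambda>k. w (real k * (t / 2 ^ m))) ` {..(2::nat) ^ m}" for m :: nat
  define H where "H m = convex hull (G m)" for m
  define C where "C = (\<Union>m. H m)"
  have Gsub: "G m \<subseteq> w ` {0..t}" for m
    using t by (auto simp: G_def field_simps intro!: imageI mult_left_mono)
  have Gmono: "G m \<subseteq> G (Suc m)" for m
  proof
    fix x assume "x \<in> G m"
    then obtain k where k: "k \<le> 2 ^ m" "x = w (real k * (t / 2 ^ m))" by (auto simp: G_def)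
    have "x = w (real (2 * k) * (t / 2 ^ Suc m))" using k by simp
    moreover have "2 * k \<le> 2 ^ Suc m" using k by simp
    ultimately show "x \<in> G (Suc m)" unfolding G_def by blast
  qed
  have incH: "incseq H" unfolding H_def by (intro incseq_SucI hull_mono Gmono)
  have comp: "compact (H m)" for m
    unfolding H_def G_def by (intro compact_convex_hull finite_imp_compact) auto
  have [measurable]: "H m \<in> sets borel" for m using comp by (simp add: borel_compact)
  have [measurable]: "C \<in> sets borel" unfolding C_def by measurable
  have fin: "emeasure lborel (H m) < \<infinity>" for m
    using emeasure_bounded_finite[OF compact_imp_bounded[OF comp]] .
  have c0: "0 \<le> c"
    using inf by (auto dest!: frequently_ex intro: order_trans[OF measure_nonneg])
  have le: "emeasure lborel (H m) \<le> ennreal c" for m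
  proof -
    have "\<exists>m'\<ge>m. measure lborel (H m') \<le> c"
      using inf by (simp add: H_def G_def frequently_sequentially)
    then obtain m' where m': "m' \<ge> m" "measure lborel (H m') \<le> c" by blast
    have "emeasure lborel (H m) \<le> emeasure lborel (H m')"
      using incH m' by (intro emeasure_mono) (auto simp: incseq_def)
    also have "\<dots> = ennreal (measure lborel (H m'))"
      using fin[of m'] by (intro emeasure_eq_ennreal_measure) auto
    also have "\<dots> \<le> ennreal c" using m' by (intro ennreal_leI) auto
    finally show ?thesis .
  qed
  have "emeasure lborel C = (SUP m. emeasure lborel (H m))"
    unfolding C_def using incH by (intro SUP_emeasure_incseq[symmetric]) auto
  then have C_le: "emeasure lborel C \<le> ennreal c" using le by (simp add: SUP_least)
  have convC: "convex C"
  proof (rule convexI)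
    fix x y and u v :: real assume xy: "x \<in> C" "y \<in> C" and uv: "0 \<le> u" "0 \<le> v" "u + v = 1"
    obtain i j where "x \<in> H i" "y \<in> H j" using xy by (auto simp: C_def)
    moreover have "H i \<subseteq> H (max i j)" "H j \<subseteq> H (max i j)" using incH by (simp_all add: incseq_def)
    ultimately have "x \<in> H (max i j)" "y \<in> H (max i j)" by auto
    then have "u *\<^sub>R x + v *\<^sub>R y \<in> H (max i j)"
      using uv unfolding H_def by (intro convexD convex_convex_hull)
    then show "u *\<^sub>R x + v *\<^sub>R y \<in> C" unfolding C_def by blast
  qed
  have "w ` {0..t} \<subseteq> closure C"
  proof
    fix y assume "y \<in> w ` {0..t}"
    then obtain s where s: "0 \<le> s" "s \<le> t" "y = w s" by auto
    define r where "r m = real (nat \<lfloor>(s / t) * 2 ^ m\<rfloor>) * (t / 2 ^ m)" for m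
    have "(\<lambda>m. (real (nat \<lfloor>(s / t) * 2 ^ m\<rfloor>) / 2 ^ m) * t) \<longlonglongrightarrow> s / t * t"
      using s t by (intro tendsto_mult dyadic_tendsto tendsto_const) auto
    then have r: "r \<longlonglongrightarrow> s" using t by (simp add: r_def[abs_def])
    have r0: "r m \<in> {0..}" for m using t by (simp add: r_def)
    have "(\<lambda>m. w (r m)) \<longlonglongrightarrow> w s"
      using continuous_on_tendsto_compose[OF w r] s r0 by auto
    moreover have "w (r m) \<in> C" for m
    proof -
      have "(s / t) * 2 ^ m \<le> 1 * 2 ^ m" using s t by (intro mult_right_mono) auto
      then have "nat \<lfloor>(s / t) * 2 ^ m\<rfloor> \<le> 2 ^ m"
        using floor_mono[of "(s / t) * 2 ^ m" "2 ^ m"] by (simp add: nat_le_iff)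
      then have "w (r m) \<in> G m" unfolding G_def r_def by blast
      then show ?thesis unfolding C_def H_def by (auto intro: hull_inc)
    qed
    ultimately show "y \<in> closure C"
      unfolding closure_sequential s(3) by (intro exI[of _ "\<lambda>m. w (r m)"] conjI allI)
  qed
  then have "convex hull (w ` {0..t}) \<subseteq> closure C"
    using convC by (intro hull_minimal convex_closure)
  also have "\<dots> \<subseteq> C \<union> frontier C"
    by (simp add: closure_Un_frontier)
  finally have sub: "convex hull (w ` {0..t}) \<subseteq> C \<union> frontier C" .
  have fr: "frontier C \<in> null_sets lborel"
    using negligible_convex_frontier[OF convC]
    by (auto simp: negligible_iff_null_sets null_sets_def borel_closed frontier_closed)
  have "emeasure lborel (convex hull (w ` {0..t})) \<le> emeasure lborel (C \<union> frontier C)"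
    using sub fr by (intro emeasure_mono) auto
  also have "\<dots> = emeasure lborel C"
    using fr by (intro emeasure_Un_null_set) auto
  also note C_le
  finally have "emeasure lborel (convex hull (w ` {0..t})) \<le> ennreal c" .
  then show ?thesis
    unfolding hull_area_def measure_def using c0 by (simp add: enn2real_leI)
qed

section \<open>The first exit of a coordinate range\<close>

definition box_alive :: "real \<Rightarrow> (nat \<Rightarrow> real \<times> real) \<Rightarrow> nat \<Rightarrow> bool" where
  "box_alive x z k \<longleftrightarrow> (\<forall>i\<le>k. \<forall>j\<le>k. \<bar>fst (psum z i) - fst (psum z j)\<bar> \<le> x \<and> \<bar>snd (psum z i) - snd (psum z j)\<bar> \<le> x)"

text \<open>The mean number of steps until a coordinate range of the walk exceeds \<open>x\<close>.
  By scaling, the mesh enters only through \<open>x = a / sqrt \<delta>\<close>, so the same numbers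
  serve every level \<open>a\<close>.\<close>

definition box_exit_mean :: "real \<Rightarrow> ennreal" where
  "box_exit_mean x = (\<Sum>k. \<integral>\<^sup>+ z. (if box_alive x z k then 1 else 0) \<partial>gauss2_seq k)"

lemma box_alive_antimono: "box_alive x z k \<Longrightarrow> j \<le> k \<Longrightarrow> box_alive x z j"
  by (auto simp: box_alive_def)

lemma box_alive_cong:
  assumes "\<And>i. i < k \<Longrightarrow> z i = z' i"
  shows "box_alive x z k = box_alive x z' k"
proof -
  have "psum z i = psum z' i" if "i \<le> k" for i using assms that by (intro psum_cong) auto
  then show ?thesis unfolding box_alive_def by (intro all_cong) simp
qed

lemma measurable_box_alive[measurable]:
  assumes "k \<le> n"
  shows "Measurable.pred (gauss2_seq n) (\<lambda>z. box_alive x z k)"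
proof -
  have [measurable]: "(\<lambda>z. fst (psum z i)) \<in> borel_measurable (gauss2_seq n)" "(\<lambda>z. snd (psum z i)) \<in> borel_measurable (gauss2_seq n)" if "i \<le> k" for i
    using that assms by (auto intro!: borel_measurable_fst_snd)
  have "Measurable.pred (gauss2_seq n) (\<lambda>z. \<forall>i\<in>{..k}. \<forall>j\<in>{..k}. \<bar>fst (psum z i) - fst (psum z j)\<bar> \<le> x \<and> \<bar>snd (psum z i) - snd (psum z j)\<bar> \<le> x)"
    by measurable
  then show ?thesis by (simp add: box_alive_def)
qed

text \<open>The range of the first coordinate alone takes at least as long to exceed the threshold.
  With \<open>h = b = 1\<close> the constant \<open>K\<close> of \<open>sum_alive_le\<close> is 3,
  and \<open>18 * \<delta> \<le> 1\<close> keeps \<open>1 - 9 * \<delta>\<close> at least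
  1/2.\<close>

lemma box_exit_mean_finite:
  assumes d: "0 < \<delta>" "18 * \<delta> \<le> 1"
  shows "ennreal \<delta> * box_exit_mean (1 / sqrt \<delta>) < \<top>"
proof -
  let ?A = "\<lambda>l z. True \<and> walk_range (proj_steps \<delta> 0 (1, 0) z) l \<le> 1"
  have A[measurable]: "Measurable.pred (gauss2_seq l) (?A l)" for l
    using sum_alive_le(1)[of 1 1 \<delta> 0 "\<lambda>_. True" "\<lambda>_. (1, 0)" l] d by simp
  have "box_exit_mean (1 / sqrt \<delta>) \<le> (\<Sum>l. \<integral>\<^sup>+ z. (if ?A l z then 1 else 0) \<partial>gauss2_seq l)"
    unfolding box_exit_mean_def
  proof (intro suminf_le nn_integral_mono)
    fix l and z :: "nat \<Rightarrow> real \<times> real"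
    have "walk_range (proj_steps \<delta> 0 (1, 0) z) l \<le> 1" if "box_alive (1 / sqrt \<delta>) z l"
    proof -
      obtain i j where ij: "i \<le> l" "j \<le> l" "walk_range (proj_steps \<delta> 0 (1, 0) z) l =
          psum (proj_steps \<delta> 0 (1, 0) z) i - psum (proj_steps \<delta> 0 (1, 0) z) j"
        using walk_range_attained by blast
      have "psum (proj_steps \<delta> 0 (1, 0) z) i = sqrt \<delta> * fst (psum z i)" for i
        by (simp add: psum_def proj_steps_def fst_sum sum_distrib_left)
      then have "walk_range (proj_steps \<delta> 0 (1, 0) z) l = sqrt \<delta> * (fst (psum z i) - fst (psum z j))"
        using ij by (simp add: right_diff_distrib)
      also have "\<dots> \<le> sqrt \<delta> * (1 / sqrt \<delta>)"
        using that ij(1,2) d by (intro mult_left_mono) (auto simp: box_alive_def abs_le_iff)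
      also have "\<dots> = 1" using d by simp
      finally show ?thesis .
    qed
    then show "(if box_alive (1 / sqrt \<delta>) z l then 1 else 0 :: ennreal) \<le> (if ?A l z then 1 else 0)"
      by auto
  qed auto
  also have "ennreal (\<delta> * (1 - 3 * 3 * \<delta>)) * \<dots> \<le> ennreal (exit_potential 1 1 0 0) * 1"
    using sum_alive_le(2)[of 1 1 \<delta> 0 "\<lambda>_. True" "\<lambda>_. (1, 0)"] d by (simp add: gauss2_seq.emeasure_space_1)
  finally have *: "ennreal (\<delta> * (1 - 9 * \<delta>)) * box_exit_mean (1 / sqrt \<delta>) \<le> ennreal (exit_potential 1 1 0 0)"
    by (simp add: mult_left_mono)
  have "ennreal (\<delta> / 2) * box_exit_mean (1 / sqrt \<delta>) \<le> ennreal (\<delta> * (1 - 9 * \<delta>)) * box_exit_mean (1 / sqrt \<delta>)"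
    using d by (intro mult_right_mono ennreal_leI) (auto simp: field_simps)
  also note *
  finally have "ennreal (\<delta> / 2) * box_exit_mean (1 / sqrt \<delta>) < \<top>"
    using le_less_trans ennreal_less_top by blast
  then show ?thesis
    using d by (auto simp: ennreal_mult_less_top)
qed

section \<open>Grid exit times and their convergence to the exit time of the path\<close>

context standard_planar_brownian_motion
begin

definition continuous_path :: "'a \<Rightarrow> bool" where
  "continuous_path \<omega> \<longleftrightarrow> continuous_on {0..} (\<lambda>t. W t \<omega>)"

lemma AE_continuous_path: "AE \<omega> in M. continuous_path \<omega>"
  using fst.continuous_paths snd.continuous_paths
proof eventually_elim
  case (elim \<omega>)
  then have "continuous_on {0..} (\<lambda>t. (fst (W t \<omega>), snd (W t \<omega>)))"
    by (intro continuous_on_Pair)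
  then show ?case by (simp add: continuous_path_def)
qed

lemma box_alive_incr:
  assumes "0 < \<delta>"
  shows "box_alive (a / sqrt \<delta>) (incr \<delta> \<omega>) k \<longleftrightarrow>
    (\<forall>i\<le>k. \<forall>j\<le>k. \<bar>fst (W (real i * \<delta>) \<omega>) - fst (W (real j * \<delta>) \<omega>)\<bar> \<le> a \<and> \<bar>snd (W (real i * \<delta>) \<omega>) - snd (W (real j * \<delta>) \<omega>)\<bar> \<le> a)"
proof -
  have "\<bar>sqrt \<delta> * x - sqrt \<delta> * y\<bar> \<le> a \<longleftrightarrow> \<bar>x - y\<bar> \<le> a / sqrt \<delta>" for x y
  proof -
    have "\<bar>sqrt \<delta> * x - sqrt \<delta> * y\<bar> = \<bar>x - y\<bar> * sqrt \<delta>"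
      using assms by (subst right_diff_distrib[symmetric]) (simp add: abs_mult)
    then show ?thesis using assms by (simp only: pos_le_divide_eq real_sqrt_gt_zero)
  qed
  then show ?thesis
    by (simp only: box_alive_def W_grid[OF assms] fst_add snd_add fst_scaleR snd_scaleR real_scaleR_def add_diff_cancel_left)
qed

lemma nn_integral_tally_box_alive:
  assumes d: "0 < \<delta>"
  shows "(\<integral>\<^sup>+ \<omega>. tally (box_alive x (incr \<delta> \<omega>)) \<partial>M) = box_exit_mean x"
    and "(\<lambda>\<omega>. tally (box_alive x (incr \<delta> \<omega>))) \<in> borel_measurable M"
proof -
  have 1: "(\<integral>\<^sup>+ \<omega>. (if box_alive x (incr \<delta> \<omega>) k then 1 else 0) \<partial>M) = (\<integral>\<^sup>+ z. (if box_alive x z k then 1 else 0) \<partial>gauss2_seq k)"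
    and 2: "(\<lambda>\<omega>. (if box_alive x (incr \<delta> \<omega>) k then 1 else 0 :: ennreal)) \<in> borel_measurable M" for k
  proof -
    have m: "(\<lambda>z. if box_alive x z k then 1 else 0 :: ennreal) \<in> borel_measurable (gauss2_seq k)" by measurable
    show "(\<integral>\<^sup>+ \<omega>. (if box_alive x (incr \<delta> \<omega>) k then 1 else 0) \<partial>M) = (\<integral>\<^sup>+ z. (if box_alive x z k then 1 else 0) \<partial>gauss2_seq k)"
      by (rule nn_integral_incr'(1)[OF d m]) (rule if_cong[OF box_alive_cong refl refl])
    show "(\<lambda>\<omega>. (if box_alive x (incr \<delta> \<omega>) k then 1 else 0 :: ennreal)) \<in> borel_measurable M"
      by (rule nn_integral_incr'(2)[OF d m]) (rule if_cong[OF box_alive_cong refl refl])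
  qed
  show "(\<integral>\<^sup>+ \<omega>. tally (box_alive x (incr \<delta> \<omega>)) \<partial>M) = box_exit_mean x"
    unfolding tally_def box_exit_mean_def using 2 by (subst nn_integral_suminf) (simp_all add: 1)
  show "(\<lambda>\<omega>. tally (box_alive x (incr \<delta> \<omega>))) \<in> borel_measurable M"
    unfolding tally_def using 2 by (rule borel_measurable_suminf_order)
qed

definition min_range_time :: "'a \<Rightarrow> ennreal" where
  "min_range_time \<omega> = min (range_time (\<lambda>t \<omega>. fst (W t \<omega>)) \<omega>) (range_time (\<lambda>t \<omega>. snd (W t \<omega>)) \<omega>)"

text \<open>The first time on the grid of mesh \<open>(1/2) ^ n\<close> at which the sampled path
  has a coordinate range above 1. Halving the mesh makes the grids nested.\<close>

definition grid_exit :: "nat \<Rightarrow> 'a \<Rightarrow> ennreal" where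
  "grid_exit n \<omega> = ennreal ((1/2) ^ n) * tally (box_alive (1 / sqrt ((1/2) ^ n)) (incr ((1/2) ^ n) \<omega>))"

lemma continuous_coords:
  assumes "continuous_path \<omega>"
  shows "continuous_on {0..} (\<lambda>t. fst (W t \<omega>))" "continuous_on {0..} (\<lambda>t. snd (W t \<omega>))"
  using assms unfolding continuous_path_def by (auto intro: continuous_on_fst continuous_on_snd)

lemma of_nat_mult_ennreal: "0 \<le> x \<Longrightarrow> ennreal x * of_nat K = ennreal (real K * x)"
  by (simp add: ennreal_of_nat_eq_real_of_nat ennreal_mult[symmetric] mult.commute)

text \<open>At the first failing grid step two sampled positions differ by more than 1 in a
  coordinate, so the range of the path itself exceeds 1 by then.\<close>

lemma min_range_time_le:
  assumes c: "continuous_path \<omega>"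
  shows "min_range_time \<omega> \<le> grid_exit n \<omega>"
proof (cases "\<forall>k. box_alive (1 / sqrt ((1/2) ^ n)) (incr ((1/2) ^ n) \<omega>) k")
  case True
  then show ?thesis by (simp add: grid_exit_def tally_top ennreal_mult_top)
next
  case False
  define d where "d = (1/2 :: real) ^ n"
  have d: "0 < d" by (simp add: d_def)
  obtain K where K: "\<not> box_alive (1 / sqrt d) (incr d \<omega>) K" "\<And>j. j < K \<Longrightarrow> box_alive (1 / sqrt d) (incr d \<omega>) j"
    using False least_failure[of "box_alive (1 / sqrt d) (incr d \<omega>)"] unfolding d_def by blast
  obtain i j where ij: "i \<le> K" "j \<le> K" and
    "1 < \<bar>fst (W (real i * d) \<omega>) - fst (W (real j * d) \<omega>)\<bar> \<or> 1 < \<bar>snd (W (real i * d) \<omega>) - snd (W (real j * d) \<omega>)\<bar>"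
    using K(1) unfolding box_alive_incr[OF d] by (auto simp: not_le)
  then have "1 < fst (W (real i * d) \<omega>) - fst (W (real j * d) \<omega>) \<or> 1 < fst (W (real j * d) \<omega>) - fst (W (real i * d) \<omega>)
    \<or> 1 < snd (W (real i * d) \<omega>) - snd (W (real j * d) \<omega>) \<or> 1 < snd (W (real j * d) \<omega>) - snd (W (real i * d) \<omega>)"
    by linarith
  moreover have m: "real i * d \<in> {0..real K * d}" "real j * d \<in> {0..real K * d}"
    using ij d by auto
  ultimately have "1 < path_range (\<lambda>t. fst (W t \<omega>)) (real K * d) \<or> 1 < path_range (\<lambda>t. snd (W t \<omega>)) (real K * d)"
    using path_range_gt[OF continuous_coords(1)[OF c]] path_range_gt[OF continuous_coords(2)[OF c]] by blast
  then have "min_range_time \<omega> \<le> ennreal (real K * d)"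
    unfolding min_range_time_def range_time_def min_le_iff_disj
    using d by (auto intro: exceed_one_time_le)
  also have "\<dots> = ennreal d * of_nat K" using d by (simp add: of_nat_mult_ennreal)
  also have "\<dots> \<le> grid_exit n \<omega>"
    unfolding grid_exit_def d_def[symmetric] by (intro mult_left_mono tally_ge K(2)) auto
  finally show ?thesis .
qed

text \<open>The coarse grid consists of the even points of the fine one: a violation within
  \<open>K\<close> coarse steps is a violation within \<open>2 * K\<close> fine steps.\<close>

lemma grid_exit_decreasing: "grid_exit (Suc n) \<omega> \<le> grid_exit n \<omega>"
proof (cases "\<forall>k. box_alive (1 / sqrt ((1/2) ^ n)) (incr ((1/2) ^ n) \<omega>) k")
  case True
  then show ?thesis by (simp add: grid_exit_def[of n] tally_top ennreal_mult_top)
next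
  case False
  define d where "d = (1/2 :: real) ^ n"
  have d: "0 < d" "0 < d / 2" by (simp_all add: d_def)
  obtain K where K: "\<not> box_alive (1 / sqrt d) (incr d \<omega>) K" "\<And>j. j < K \<Longrightarrow> box_alive (1 / sqrt d) (incr d \<omega>) j"
    using False least_failure[of "box_alive (1 / sqrt d) (incr d \<omega>)"] unfolding d_def by blast
  have e: "real (2 * i) * (d / 2) = real i * d" for i by simp
  have "\<not> box_alive (1 / sqrt (d / 2)) (incr (d / 2) \<omega>) (2 * K)"
  proof
    assume al: "box_alive (1 / sqrt (d / 2)) (incr (d / 2) \<omega>) (2 * K)"
    have "box_alive (1 / sqrt d) (incr d \<omega>) K"
      unfolding box_alive_incr[OF d(1)]
    proof (intro allI impI)
      fix i j assume "i \<le> K" "j \<le> K"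
      then have "2 * i \<le> 2 * K" "2 * j \<le> 2 * K" by simp_all
      then show "\<bar>fst (W (real i * d) \<omega>) - fst (W (real j * d) \<omega>)\<bar> \<le> 1 \<and> \<bar>snd (W (real i * d) \<omega>) - snd (W (real j * d) \<omega>)\<bar> \<le> 1"
        using al unfolding box_alive_incr[OF d(2)] e[symmetric] by blast
    qed
    with K(1) show False ..
  qed
  then have "\<not> box_alive (1 / sqrt (d / 2)) (incr (d / 2) \<omega>) k" if "2 * K \<le> k" for k
    using box_alive_antimono that by blast
  then have "tally (box_alive (1 / sqrt (d / 2)) (incr (d / 2) \<omega>)) \<le> of_nat (2 * K)"
    by (rule tally_le)
  then have "grid_exit (Suc n) \<omega> \<le> ennreal (d / 2) * of_nat (2 * K)"
    unfolding grid_exit_def power_Suc2 by (simp add: d_def[symmetric] mult_left_mono)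
  also have "\<dots> = ennreal d * of_nat K" using d by (simp add: of_nat_mult_ennreal del: of_nat_mult)
  also have "\<dots> \<le> grid_exit n \<omega>"
    unfolding grid_exit_def d_def[symmetric] by (intro mult_left_mono tally_ge K(2)) auto
  finally show ?thesis .
qed

text \<open>\<open>w\<close> stands for either coordinate. Rounding the two extremal times down to
  dyadic points keeps them in \<open>[0, t]\<close> and, by continuity, keeps the difference above 1
  on a fine enough grid.\<close>

lemma grid_exit_le:
  assumes w: "continuous_on {0..} w" and t: "0 \<le> t" and gt: "1 < path_range w t"
    and dead: "\<And>i j n. 1 < w (real i * (1/2) ^ n) - w (real j * (1/2) ^ n) \<Longrightarrow>
      \<not> box_alive (1 / sqrt ((1/2) ^ n)) (incr ((1/2) ^ n) \<omega>) (max i j)"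
  shows "(INF n. grid_exit n \<omega>) \<le> ennreal t"
proof -
  obtain s s' where s: "s \<in> {0..t}" "s' \<in> {0..t}" "1 < w s - w s'"
    using path_range_gtD[OF w t gt] by blast
  define r where "r x n = real (nat \<lfloor>x * 2 ^ n\<rfloor>) * (1/2) ^ n" for x :: real and n :: nat
  have r_lim: "(\<lambda>n. w (r x n)) \<longlonglongrightarrow> w x" if "0 \<le> x" for x
  proof -
    have "r x \<longlonglongrightarrow> x"
      using dyadic_tendsto[OF that] by (simp add: r_def[abs_def] power_one_over)
    then show ?thesis
      by (rule continuous_on_tendsto_compose[OF w]) (use that in \<open>auto simp: r_def\<close>)
  qed
  have "(\<lambda>n. w (r s n) - w (r s' n)) \<longlonglongrightarrow> w s - w s'"
    using s by (intro tendsto_diff r_lim) auto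
  then have "\<forall>\<^sub>F n in sequentially. 1 < w (r s n) - w (r s' n)"
    using s(3) by (rule order_tendstoD)
  then obtain n where n: "1 < w (r s n) - w (r s' n)"
    by (auto simp: eventually_sequentially)
  define d where "d = (1/2 :: real) ^ n"
  define K where "K = max (nat \<lfloor>s * 2 ^ n\<rfloor>) (nat \<lfloor>s' * 2 ^ n\<rfloor>)"
  have "\<not> box_alive (1 / sqrt d) (incr d \<omega>) K"
    unfolding K_def d_def using n unfolding r_def by (rule dead)
  then have "\<not> box_alive (1 / sqrt d) (incr d \<omega>) k" if "K \<le> k" for k
    using box_alive_antimono that by blast
  then have "tally (box_alive (1 / sqrt d) (incr d \<omega>)) \<le> of_nat K" by (rule tally_le)
  then have "grid_exit n \<omega> \<le> ennreal d * of_nat K"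
    unfolding grid_exit_def d_def[symmetric] by (intro mult_left_mono) auto
  also have "\<dots> = ennreal (real K * d)" by (rule of_nat_mult_ennreal) (simp add: d_def)
  also have "\<dots> \<le> ennreal t"
  proof (rule ennreal_leI)
    have "real (nat \<lfloor>x * 2 ^ n\<rfloor>) * d \<le> t" if "x \<in> {0..t}" for x
    proof -
      have "real (nat \<lfloor>x * 2 ^ n\<rfloor>) * d \<le> (x * 2 ^ n) * d"
        using that by (intro mult_right_mono) (auto simp: d_def)
      also have "\<dots> = x" by (simp add: d_def power_one_over)
      finally show ?thesis using that by simp
    qed
    from this[OF s(1)] this[OF s(2)] show "real K * d \<le> t"
      by (simp add: K_def max_def)
  qed
  finally show ?thesis by (rule INF_lower2[OF UNIV_I])
qed

lemma INF_grid_exit_le: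
  assumes c: "continuous_path \<omega>"
  shows "(INF n. grid_exit n \<omega>) \<le> min_range_time \<omega>"
  unfolding min_range_time_def range_time_def exceed_one_time_def
proof (intro min.boundedI INF_greatest)
  fix t assume "t \<in> {t. 0 \<le> t \<and> 1 < path_range (\<lambda>t. fst (W t \<omega>)) t}"
  then have t: "0 \<le> t" "1 < path_range (\<lambda>t. fst (W t \<omega>)) t" by auto
  show "(INF n. grid_exit n \<omega>) \<le> ennreal t"
  proof (rule grid_exit_le[OF continuous_coords(1)[OF c] t])
    fix i j n assume gt: "1 < fst (W (real i * (1/2) ^ n) \<omega>) - fst (W (real j * (1/2) ^ n) \<omega>)"
    have d: "0 < (1/2 :: real) ^ n" by simp
    show "\<not> box_alive (1 / sqrt ((1/2) ^ n)) (incr ((1/2) ^ n) \<omega>) (max i j)"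
      unfolding box_alive_incr[OF d] using gt max.cobounded1[of i j] max.cobounded2[of j i] by fastforce
  qed
next
  fix t assume "t \<in> {t. 0 \<le> t \<and> 1 < path_range (\<lambda>t. snd (W t \<omega>)) t}"
  then have t: "0 \<le> t" "1 < path_range (\<lambda>t. snd (W t \<omega>)) t" by auto
  show "(INF n. grid_exit n \<omega>) \<le> ennreal t"
  proof (rule grid_exit_le[OF continuous_coords(2)[OF c] t])
    fix i j n assume gt: "1 < snd (W (real i * (1/2) ^ n) \<omega>) - snd (W (real j * (1/2) ^ n) \<omega>)"
    have d: "0 < (1/2 :: real) ^ n" by simp
    show "\<not> box_alive (1 / sqrt ((1/2) ^ n)) (incr ((1/2) ^ n) \<omega>) (max i j)"
      unfolding box_alive_incr[OF d] using gt max.cobounded1[of i j] max.cobounded2[of j i] by fastforce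
  qed
qed

text \<open>The grid exit times decrease to the exit time of the path, and monotone convergence from
  above applies once one of the means is finite.\<close>

lemma box_exit_mean_tendsto:
  "(\<lambda>n. ennreal ((1/2) ^ n) * box_exit_mean (1 / sqrt ((1/2) ^ n))) \<longlonglongrightarrow> ennreal (mean_min_range_time M W)"
proof -
  define E where "E n = ennreal ((1/2) ^ n) * box_exit_mean (1 / sqrt ((1/2) ^ n))" for n :: nat
  have meas: "grid_exit n \<in> borel_measurable M" for n
  proof -
    have "(\<lambda>\<omega>. grid_exit n \<omega>) \<in> borel_measurable M"
      unfolding grid_exit_def by (intro borel_measurable_times_ennreal nn_integral_tally_box_alive(2)) auto
    then show ?thesis .
  qed
  have E: "(\<integral>\<^sup>+ \<omega>. grid_exit n \<omega> \<partial>M) = E n" for n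
    unfolding grid_exit_def E_def
    by (subst nn_integral_cmult) (auto simp: nn_integral_tally_box_alive)
  \<comment> \<open>5 is the first \<open>n\<close> with
    \<open>18 * (1/2) ^ n \<le> 1\<close>.\<close>
  have fin: "E 5 < \<top>"
    unfolding E_def by (rule box_exit_mean_finite) (auto simp: power_one_over)
  have "(INF n. E n) = (\<integral>\<^sup>+ \<omega>. (INF n. grid_exit n \<omega>) \<partial>M)"
    unfolding E[symmetric] using fin
    by (intro nn_integral_monotone_convergence_INF_AE[where i = 5, symmetric] AE_I2 grid_exit_decreasing meas) (simp add: E)
  also have "\<dots> = (\<integral>\<^sup>+ \<omega>. min_range_time \<omega> \<partial>M)"
  proof (rule nn_integral_cong_AE)
    show "AE \<omega> in M. (INF n. grid_exit n \<omega>) = min_range_time \<omega>"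
      using AE_continuous_path
      by eventually_elim (intro antisym INF_grid_exit_le INF_greatest min_range_time_le)
  qed
  finally have inf: "(INF n. E n) = (\<integral>\<^sup>+ \<omega>. min_range_time \<omega> \<partial>M)" .
  have "(INF n. E n) \<le> E 5" by (rule INF_lower) simp
  \<comment> \<open>Finiteness makes the conversion \<open>enn2real\<close> inside
    \<open>mean_min_range_time\<close> lossless.\<close>
  then have "(INF n. E n) < \<top>" using fin by (rule le_less_trans)
  then have "(INF n. E n) = ennreal (mean_min_range_time M W)"
    unfolding mean_min_range_time_def min_range_time_def[symmetric] inf[symmetric] by simp
  moreover have "decseq E"
    unfolding E[symmetric] by (intro decseq_SucI nn_integral_mono grid_exit_decreasing)
  then have "E \<longlonglongrightarrow> (INF n. E n)" by (rule LIMSEQ_INF)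
  ultimately show ?thesis by (simp add: E_def[abs_def])
qed

end

section \<open>Upper bound for the mean exceedance time of the area\<close>

definition far :: "real \<Rightarrow> (nat \<Rightarrow> real \<times> real) \<Rightarrow> nat \<Rightarrow> nat \<Rightarrow> bool" where
  "far x z i m \<longleftrightarrow> x < \<bar>fst (psum z i) - fst (psum z m)\<bar> \<or> x < \<bar>snd (psum z i) - snd (psum z m)\<bar>"

text \<open>The walk leaves the box at step \<open>m\<close>, and \<open>i\<close> is the earliest
  position far from the one at \<open>m\<close>. Taking the earliest makes the pair
  \<open>(m, i)\<close> unique, hence the events disjoint, and keeps each event determined by the
  first \<open>m\<close> increments.\<close>

definition first_exit :: "real \<Rightarrow> nat \<Rightarrow> nat \<Rightarrow> (nat \<Rightarrow> real \<times> real) \<Rightarrow> bool" where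
  "first_exit x m i z \<longleftrightarrow> i < m \<and> (\<forall>k<m. box_alive x z k) \<and> far x z i m \<and> (\<forall>i'<i. \<not> far x z i' m)"

definition chord_normal :: "nat \<Rightarrow> nat \<Rightarrow> (nat \<Rightarrow> real \<times> real) \<Rightarrow> real \<times> real" where
  "chord_normal m i z = (1 / norm (psum z i - psum z m)) *\<^sub>R (- snd (psum z i - psum z m), fst (psum z i - psum z m))"

text \<open>Survival in the second stage, the search for width \<open>h\<close> orthogonal to the
  chord; \<open>l\<close> is counted from the exit step \<open>m\<close>.\<close>

definition width_alive :: "real \<Rightarrow> real \<Rightarrow> real \<Rightarrow> nat \<Rightarrow> nat \<Rightarrow> nat \<Rightarrow> (nat \<Rightarrow> real \<times> real) \<Rightarrow> bool" where
  "width_alive x \<delta> h m i l z \<longleftrightarrow> first_exit x m i z \<and> walk_range (proj_steps \<delta> m (chord_normal m i z) z) l \<le> h"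

lemma first_exit_not_alive: "first_exit x m i z \<Longrightarrow> \<not> box_alive x z m"
  unfolding first_exit_def far_def box_alive_def by (metis less_imp_le not_le order_refl)

text \<open>Any two positions before step \<open>m\<close> are within \<open>x\<close> of each other
  in both coordinates, so a violation at \<open>m\<close> involves the position at \<open>m\<close>
  itself. The least partner is then chosen.\<close>

lemma first_exit_exists:
  assumes "\<not> box_alive x z m" "\<And>k. k < m \<Longrightarrow> box_alive x z k" "0 \<le> x"
  shows "\<exists>i. first_exit x m i z"
proof -
  obtain i j where ij: "i \<le> m" "j \<le> m" and
    *: "x < \<bar>fst (psum z i) - fst (psum z j)\<bar> \<or> x < \<bar>snd (psum z i) - snd (psum z j)\<bar>"
    using assms(1) unfolding box_alive_def by (meson not_le)
  have "i = m \<or> j = m"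
  proof (rule ccontr)
    assume "\<not> (i = m \<or> j = m)"
    then have "max i j < m" using ij by simp
    then have "box_alive x z (max i j)" by (rule assms(2))
    then show False using * unfolding box_alive_def by (meson max.cobounded1 max.cobounded2 not_le)
  qed
  moreover have "i \<noteq> j" using * assms(3) by auto
  ultimately have "\<exists>i<m. far x z i m"
    using * ij unfolding far_def by (metis abs_minus_commute le_neq_implies_less)
  then obtain i0 where i0: "i0 < m" "far x z i0 m" by blast
  define I where "I = (LEAST i. far x z i m)"
  have "far x z I m" unfolding I_def using i0(2) by (rule LeastI)
  moreover have "I \<le> i0" unfolding I_def using i0(2) by (rule Least_le)
  moreover have "\<not> far x z i' m" if "i' < I" for i' using not_less_Least[OF that[unfolded I_def]] .
  ultimately have "first_exit x m I z" using i0(1) assms(2) by (simp add: first_exit_def)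
  then show ?thesis ..
qed

lemma first_exit_unique:
  assumes "first_exit x m i z" "first_exit x m' i' z"
  shows "m = m' \<and> i = i'"
proof -
  have m: "m = m'"
    using assms first_exit_not_alive[OF assms(1)] first_exit_not_alive[OF assms(2)]
    by (metis first_exit_def linorder_neqE_nat)
  with assms have "i = i'" unfolding first_exit_def by (metis linorder_neqE_nat)
  with m show ?thesis ..
qed

text \<open>The events are disjoint over all pairs \<open>(m, i)\<close>, so decomposing by exit
  step and chord costs no factor.\<close>

lemma sum_first_exit_le:
  "(\<Sum>m. \<Sum>i<m. if first_exit x m i z then 1 else 0) \<le> (1 :: ennreal)"
proof (cases "\<exists>m i. first_exit x m i z")
  case True
  then obtain m i where mi: "first_exit x m i z" by blast
  then have im: "i < m" by (simp add: first_exit_def)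
  have iff: "first_exit x m' i' z \<longleftrightarrow> m' = m \<and> i' = i" for m' i'
    using mi first_exit_unique by blast
  have "(\<Sum>m. \<Sum>i<m. if first_exit x m i z then 1 else 0 :: ennreal) = (\<Sum>m'\<in>{m}. \<Sum>i<m'. if first_exit x m' i z then 1 else 0)"
    by (rule suminf_finite) (auto simp: iff)
  also have "\<dots> = 1" using im by (simp add: iff)
  finally show ?thesis by simp
qed simp

lemma first_exit_norm:
  assumes "first_exit x m i z" "0 \<le> x"
  shows "x < norm (psum z i - psum z m)"
proof -
  define d where "d = psum z i - psum z m"
  have "x < \<bar>fst d\<bar> \<or> x < \<bar>snd d\<bar>" using assms(1) by (simp add: first_exit_def far_def d_def)
  moreover have "\<bar>fst d\<bar> \<le> norm d" "\<bar>snd d\<bar> \<le> norm d"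
    using norm_fst_le[of "fst d" "snd d"] norm_snd_le[of "snd d" "fst d"] by auto
  ultimately show ?thesis unfolding d_def[symmetric] by linarith
qed

lemma chord_normal_unit:
  assumes "first_exit x m i z" "0 \<le> x"
  shows "(fst (chord_normal m i z))\<^sup>2 + (snd (chord_normal m i z))\<^sup>2 = 1"
proof -
  define d where "d = psum z i - psum z m"
  have d: "0 < norm d" using first_exit_norm[OF assms] assms(2) unfolding d_def by linarith
  have n: "(norm d)\<^sup>2 = (fst d)\<^sup>2 + (snd d)\<^sup>2"
    by (simp add: norm_prod_def)
  have "(fst (chord_normal m i z))\<^sup>2 + (snd (chord_normal m i z))\<^sup>2 = ((fst d)\<^sup>2 + (snd d)\<^sup>2) / (norm d)\<^sup>2"
    unfolding chord_normal_def d_def[symmetric] by (simp add: power_divide add_divide_distrib)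
  also have "\<dots> = 1" unfolding n[symmetric] using d by simp
  finally show ?thesis .
qed

lemma first_exit_cong:
  assumes "\<And>k. k < m \<Longrightarrow> z k = z' k"
  shows "first_exit x m i z = first_exit x m i z' \<and> chord_normal m i z = chord_normal m i z' \<or> \<not> i < m"
proof -
  have p: "psum z k = psum z' k" if "k \<le> m" for k using assms that by (intro psum_cong) auto
  have b: "box_alive x z k = box_alive x z' k" if "k < m" for k using assms that by (intro box_alive_cong) auto
  show ?thesis
    using p b by (auto simp: first_exit_def far_def chord_normal_def)
qed

lemma measurable_first_exit:
  assumes "i < m"
  shows "Measurable.pred (gauss2_seq m) (first_exit x m i)" and "chord_normal m i \<in> borel_measurable (gauss2_seq m)"
proof -
  have f[measurable]: "(\<lambda>z. fst (psum z k)) \<in> borel_measurable (gauss2_seq m)" "(\<lambda>z. snd (psum z k)) \<in> borel_measurable (gauss2_seq m)" if "k \<le> m" for k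
    using that by (auto intro!: borel_measurable_fst_snd)
  have far[measurable]: "Measurable.pred (gauss2_seq m) (\<lambda>z. far x z k m)" if "k \<le> m" for k
    using that unfolding far_def by measurable
  have b[measurable]: "Measurable.pred (gauss2_seq m) (\<lambda>z. box_alive x z k)" if "k \<le> m" for k
    using that by (rule measurable_box_alive)
  have "Measurable.pred (gauss2_seq m) (\<lambda>z. (\<forall>k\<in>{..<m}. box_alive x z k) \<and> far x z i m \<and> (\<forall>i'\<in>{..<i}. \<not> far x z i' m))"
    by (intro pred_intros_logic pred_intros_finite far b) (use assms in auto)
  then show "Measurable.pred (gauss2_seq m) (first_exit x m i)"
    using assms by (simp add: first_exit_def[abs_def])
  have ps: "(\<lambda>z. psum z k) \<in> borel_measurable (gauss2_seq m)" if "k \<le> m" for k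
    using that by (rule measurable_psum(2))
  have "(\<lambda>z. chord_normal m i z) \<in> borel_measurable (gauss2_seq m)"
    unfolding chord_normal_def
    using assms by (intro borel_measurable_scaleR borel_measurable_divide borel_measurable_const borel_measurable_norm
      borel_measurable_Pair borel_measurable_uminus borel_measurable_fst_snd borel_measurable_diff ps) auto
  then show "chord_normal m i \<in> borel_measurable (gauss2_seq m)" .
qed

text \<open>\<open>first_exit\<close> and \<open>chord_normal\<close> are decided by the first
  \<open>m\<close> increments, so the restart estimate applies in the random direction orthogonal to
  the chord.\<close>

lemma sum_width_alive_le:
  assumes x: "0 \<le> x" and h: "0 \<le> h" and b: "0 < b" and \<delta>: "0 < \<delta>" and i: "i < m"
  defines "K \<equiv> 2 / b\<^sup>2 + h / b ^ 3"
  assumes \<delta>K: "3 * K * \<delta> \<le> 1"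
  shows "Measurable.pred (gauss2_seq (m + l)) (width_alive x \<delta> h m i l)"
    and "ennreal (\<delta> * (1 - 3 * K * \<delta>)) * (\<Sum>l. \<integral>\<^sup>+ z. (if width_alive x \<delta> h m i l z then 1 else 0) \<partial>gauss2_seq (m + l))
    \<le> ennreal (exit_potential h b 0 0) * (\<integral>\<^sup>+ z. (if first_exit x m i z then 1 else 0) \<partial>gauss2_seq m)"
proof -
  have cong: "first_exit x m i z = first_exit x m i z' \<and> chord_normal m i z = chord_normal m i z'"
    if "\<And>i. i < m \<Longrightarrow> z i = z' i" for z z'
    using first_exit_cong[of m z z' x i] that i by blast
  note * = sum_alive_le[OF h b \<delta> \<delta>K[unfolded K_def], of m "first_exit x m i" "chord_normal m i",
      OF cong measurable_first_exit(1)[OF i] measurable_first_exit(2)[OF i] chord_normal_unit[OF _ x]]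
  show "Measurable.pred (gauss2_seq (m + l)) (width_alive x \<delta> h m i l)"
    unfolding width_alive_def[abs_def] by (rule *(1))
  show "ennreal (\<delta> * (1 - 3 * K * \<delta>)) * (\<Sum>l. \<integral>\<^sup>+ z. (if width_alive x \<delta> h m i l z then 1 else 0) \<partial>gauss2_seq (m + l))
    \<le> ennreal (exit_potential h b 0 0) * (\<integral>\<^sup>+ z. (if first_exit x m i z then 1 else 0) \<partial>gauss2_seq m)"
    unfolding width_alive_def K_def by (rule *(2))
qed

lemma width_alive_cong:
  assumes "\<And>k. k < m + l \<Longrightarrow> z k = z' k" "i < m"
  shows "width_alive x \<delta> h m i l z = width_alive x \<delta> h m i l z'"
proof -
  have c: "first_exit x m i z = first_exit x m i z'" "chord_normal m i z = chord_normal m i z'"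
    using first_exit_cong[of m z z' x i] assms by auto
  have "walk_range (proj_steps \<delta> m u z) l = walk_range (proj_steps \<delta> m u z') l" for u
    by (rule walk_range_cong) (simp add: proj_steps_def assms)
  then show ?thesis unfolding width_alive_def c by simp
qed

lemma psum_proj_steps:
  "psum (proj_steps \<delta> m u z) k = sqrt \<delta> * (fst u * fst (psum z (m + k) - psum z m) + snd u * snd (psum z (m + k) - psum z m))"
  by (induction k) (simp_all add: psum_Suc proj_steps_def algebra_simps)

section \<open>From the two-stage comparison on a single path to the mean\<close>

context standard_planar_brownian_motion
begin

text \<open>The box fails first at step \<open>m\<close>, and the range orthogonal to the chord
  first exceeds \<open>2 / a\<close> after \<open>L\<close> further steps. In the units of the path
  the chord is longer than \<open>a\<close>, so chord times width exceeds 2 and the hull has area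
  above 1 at time \<open>(m + L) * \<delta>\<close>. The two tallies bound \<open>m\<close> and
  \<open>L\<close>.\<close>

lemma area_time_le:
  assumes c: "continuous_path \<omega>" and a: "0 < a" and \<delta>: "0 < \<delta>"
  defines "Z \<equiv> incr \<delta> \<omega>"
  shows "area_time W \<omega> \<le> ennreal \<delta> * (tally (box_alive (a / sqrt \<delta>) Z) + (\<Sum>m. \<Sum>i<m. tally (\<lambda>l. width_alive (a / sqrt \<delta>) \<delta> (2 / a) m i l Z)))"
    (is "_ \<le> ennreal \<delta> * (?c1 + ?c2)")
proof (cases "?c1 + ?c2 = \<top>")
  case True
  show ?thesis unfolding True using \<delta> by (simp add: ennreal_mult_top)
next
  case False
  define x where "x = a / sqrt \<delta>"
  have x: "0 < x" using a \<delta> by (simp add: x_def)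
  have "\<exists>k. \<not> box_alive x Z k" using False tally_top[of "box_alive x Z"] by (auto simp: x_def)
  then obtain k where "\<not> box_alive x Z k" ..
  from least_failure[of "box_alive x Z", OF this] obtain m where m: "\<not> box_alive x Z m" "\<And>j. j < m \<Longrightarrow> box_alive x Z j"
    by blast
  obtain i where i: "first_exit x m i Z" using first_exit_exists[OF m] x by auto
  then have im: "i < m" by (simp add: first_exit_def)
  let ?w = "\<lambda>l. width_alive x \<delta> (2 / a) m i l Z"
  have "tally ?w \<le> (\<Sum>i<m. tally (\<lambda>l. width_alive x \<delta> (2 / a) m i l Z))"
    using im by (intro member_le_sum) auto
  also have "\<dots> \<le> (\<Sum>m. \<Sum>i<m. tally (\<lambda>l. width_alive x \<delta> (2 / a) m i l Z))"
    using sum_le_suminf[of "\<lambda>m. \<Sum>i<m. tally (\<lambda>l. width_alive x \<delta> (2 / a) m i l Z)" "{m}"] by simp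
  finally have w_le: "tally ?w \<le> ?c2" by (simp add: x_def)
  then have "tally ?w \<noteq> \<top>" using False by (auto simp: top_unique)
  then have "\<exists>l. \<not> ?w l" using tally_top[of ?w] by blast
  then obtain l where "\<not> ?w l" ..
  from least_failure[of ?w, OF this] obtain L where L: "\<not> ?w L" "\<And>j. j < L \<Longrightarrow> ?w j" by blast
  define d where "d = psum Z i - psum Z m"
  have nd: "x < norm d" unfolding d_def using first_exit_norm[OF i] x by simp
  have d0: "0 < norm d" using nd x by linarith
  have "2 / a < walk_range (proj_steps \<delta> m (chord_normal m i Z) Z) L"
    using L(1) i by (simp add: width_alive_def)
  then obtain p q where pq: "p \<le> L" "q \<le> L" and
    gt: "2 / a < psum (proj_steps \<delta> m (chord_normal m i Z) Z) p - psum (proj_steps \<delta> m (chord_normal m i Z) Z) q"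
    using walk_range_attained by metis
  define e where "e = psum Z (m + p) - psum Z (m + q)"
  have "psum (proj_steps \<delta> m (chord_normal m i Z) Z) p - psum (proj_steps \<delta> m (chord_normal m i Z) Z) q
    = sqrt \<delta> * (fst (chord_normal m i Z) * fst e + snd (chord_normal m i Z) * snd e)"
    unfolding psum_proj_steps e_def by (simp add: algebra_simps)
  \<comment> \<open>The inner product with the unit normal of the chord is the cross product with
    the chord, divided by its length.\<close>
  also have "\<dots> = sqrt \<delta> * (cross2 d e / norm d)"
    unfolding chord_normal_def d_def[symmetric] cross2_def by (simp add: diff_divide_distrib)
  finally have gt2: "2 / a < sqrt \<delta> * (cross2 d e / norm d)" using gt by simp
  then have "2 / a * norm d < sqrt \<delta> * cross2 d e"
    using d0 by (simp add: pos_less_divide_eq)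
  moreover have "2 / a * x \<le> 2 / a * norm d" using nd a by (intro mult_left_mono) auto
  moreover have "2 / a * x = 2 / sqrt \<delta>" using a by (simp add: x_def)
  ultimately have "2 / sqrt \<delta> < sqrt \<delta> * cross2 d e" by linarith
  then have "2 < sqrt \<delta> * cross2 d e * sqrt \<delta>"
    using \<delta> by (simp add: pos_divide_less_eq)
  also have "\<dots> = (sqrt \<delta> * sqrt \<delta>) * cross2 d e" by (simp only: mult_ac)
  also have "sqrt \<delta> * sqrt \<delta> = \<delta>" using \<delta> by simp
  finally have big: "2 < \<delta> * cross2 d e" .
  have diffs: "W (real i * \<delta>) \<omega> - W (real m * \<delta>) \<omega> = sqrt \<delta> *\<^sub>R d"
    "W (real (m + p) * \<delta>) \<omega> - W (real (m + q) * \<delta>) \<omega> = sqrt \<delta> *\<^sub>R e"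
    unfolding W_grid[OF \<delta>] by (simp_all add: d_def e_def Z_def scaleR_diff_right)
  have cr: "cross2 (W (real i * \<delta>) \<omega> - W (real m * \<delta>) \<omega>) (W (real (m + p) * \<delta>) \<omega> - W (real (m + q) * \<delta>) \<omega>) = \<delta> * cross2 d e"
  proof -
    have "sqrt \<delta> * sqrt \<delta> = \<delta>" using \<delta> by simp
    moreover have "cross2 (sqrt \<delta> *\<^sub>R d) (sqrt \<delta> *\<^sub>R e) = (sqrt \<delta> * sqrt \<delta>) * cross2 d e"
      unfolding cross2_def fst_scaleR snd_scaleR real_scaleR_def by (simp only: right_diff_distrib mult_ac)
    ultimately show ?thesis unfolding diffs by simp
  qed
  have "1 < hull_area (\<lambda>t. W t \<omega>) (real (m + L) * \<delta>)"
  proof (rule hull_area_gt)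
    show "continuous_on {0..} (\<lambda>t. W t \<omega>)" using c by (simp add: continuous_path_def)
    show "2 < \<bar>cross2 (W (real i * \<delta>) \<omega> - W (real m * \<delta>) \<omega>) (W (real (m + p) * \<delta>) \<omega> - W (real (m + q) * \<delta>) \<omega>)\<bar>"
      unfolding cr using big by linarith
  qed (use \<delta> im pq in \<open>auto intro!: mult_right_mono\<close>)
  then have "area_time W \<omega> \<le> ennreal (real (m + L) * \<delta>)"
    unfolding area_time_def using \<delta> by (intro exceed_one_time_le) auto
  also have "\<dots> = ennreal \<delta> * (of_nat m + of_nat L)"
    using \<delta> of_nat_mult_ennreal[of \<delta> "m + L"] by simp
  also have "\<dots> \<le> ennreal \<delta> * (?c1 + ?c2)"
  proof (intro mult_left_mono add_mono)
    show "of_nat m \<le> ?c1" using m(2) unfolding x_def by (rule tally_ge)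
    have "of_nat L \<le> tally ?w" using L(2) by (rule tally_ge)
    also note w_le
    finally show "of_nat L \<le> ?c2" .
  qed simp
  finally show ?thesis .
qed

text \<open>Given any event \<open>first_exit x m i\<close> of positive probability, the second
  stage lasts on average at most \<open>U / (\<delta> * \<kappa>)\<close> steps, and the
  probabilities of these events sum to at most 1. The factor \<open>\<kappa>\<close> is the loss by
  discretisation and tends to 1 with the mesh.\<close>

lemma nn_integral_area_time_grid:
  assumes a: "0 < a" and b: "0 < b" and \<delta>: "0 < \<delta>"
  defines "K \<equiv> 2 / b\<^sup>2 + (2 / a) / b ^ 3"
  assumes \<delta>K: "3 * K * \<delta> < 1"
  shows "(\<integral>\<^sup>+ \<omega>. area_time W \<omega> \<partial>M) \<le> ennreal \<delta> * box_exit_mean (a / sqrt \<delta>)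
     + ennreal (exit_potential (2 / a) b 0 0 / (1 - 3 * K * \<delta>))"
proof -
  define x where "x = a / sqrt \<delta>"
  have x: "0 \<le> x" using a \<delta> by (simp add: x_def)
  define h where "h = 2 / a"
  have h: "0 \<le> h" using a by (simp add: h_def)
  define U where "U = exit_potential h b 0 0"
  have U: "0 \<le> U" unfolding U_def using h b by (intro exit_potential_nonneg) auto
  define \<kappa> where "\<kappa> = 1 - 3 * K * \<delta>"
  have \<kappa>: "0 < \<kappa>" using \<delta>K by (simp add: \<kappa>_def)
  have \<delta>K': "3 * (2 / b\<^sup>2 + h / b ^ 3) * \<delta> \<le> 1" using \<delta>K by (simp add: K_def h_def)
  define wa where "wa m i l z = (if width_alive x \<delta> h m i l z then 1 else 0 :: ennreal)" for m i l z
  define fe where "fe m i z = (if first_exit x m i z then 1 else 0 :: ennreal)" for m i z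
  have wa: "(\<integral>\<^sup>+ \<omega>. wa m i l (incr \<delta> \<omega>) \<partial>M) = (\<integral>\<^sup>+ z. wa m i l z \<partial>gauss2_seq (m + l))"
    "(\<lambda>\<omega>. wa m i l (incr \<delta> \<omega>)) \<in> borel_measurable M" if i: "i < m" for m i l
  proof -
    have [measurable]: "Measurable.pred (gauss2_seq (m + l)) (width_alive x \<delta> h m i l)"
      by (rule sum_width_alive_le(1)[OF x h b \<delta> i \<delta>K'])
    have m: "wa m i l \<in> borel_measurable (gauss2_seq (m + l))" unfolding wa_def[abs_def] by measurable
    have cong: "wa m i l z = wa m i l z'" if "\<And>k. k < m + l \<Longrightarrow> z k = z' k" for z z'
      unfolding wa_def using width_alive_cong[OF that i] by simp
    show "(\<integral>\<^sup>+ \<omega>. wa m i l (incr \<delta> \<omega>) \<partial>M) = (\<integral>\<^sup>+ z. wa m i l z \<partial>gauss2_seq (m + l))"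
      by (rule nn_integral_incr'(1)[OF \<delta> m cong])
    show "(\<lambda>\<omega>. wa m i l (incr \<delta> \<omega>)) \<in> borel_measurable M"
      by (rule nn_integral_incr'(2)[OF \<delta> m cong])
  qed
  have fe: "(\<integral>\<^sup>+ \<omega>. fe m i (incr \<delta> \<omega>) \<partial>M) = (\<integral>\<^sup>+ z. fe m i z \<partial>gauss2_seq m)"
    "(\<lambda>\<omega>. fe m i (incr \<delta> \<omega>)) \<in> borel_measurable M" if i: "i < m" for m i
  proof -
    have [measurable]: "Measurable.pred (gauss2_seq m) (first_exit x m i)"
      by (rule measurable_first_exit(1)[OF i])
    have m: "fe m i \<in> borel_measurable (gauss2_seq m)" unfolding fe_def[abs_def] by measurable
    have cong: "fe m i z = fe m i z'" if "\<And>k. k < m \<Longrightarrow> z k = z' k" for z z'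
      unfolding fe_def using first_exit_cong[of m z z' x i] that i by auto
    show "(\<integral>\<^sup>+ \<omega>. fe m i (incr \<delta> \<omega>) \<partial>M) = (\<integral>\<^sup>+ z. fe m i z \<partial>gauss2_seq m)"
      by (rule nn_integral_incr'(1)[OF \<delta> m cong])
    show "(\<lambda>\<omega>. fe m i (incr \<delta> \<omega>)) \<in> borel_measurable M"
      by (rule nn_integral_incr'(2)[OF \<delta> m cong])
  qed
  have cw: "tally (\<lambda>l. width_alive x \<delta> h m i l z) = (\<Sum>l. wa m i l z)" for m i z
    by (simp add: tally_def wa_def)
  have cm: "(\<lambda>\<omega>. \<Sum>l. wa m i l (incr \<delta> \<omega>)) \<in> borel_measurable M" if "i < m" for m i
    using wa(2)[OF that] by (rule borel_measurable_suminf_order)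
  define G where "G = (\<integral>\<^sup>+ \<omega>. (\<Sum>m. \<Sum>i<m. \<Sum>l. wa m i l (incr \<delta> \<omega>)) \<partial>M)"
  have G: "G = (\<Sum>m. \<Sum>i<m. \<Sum>l. \<integral>\<^sup>+ z. wa m i l z \<partial>gauss2_seq (m + l))"
  proof -
    have "G = (\<Sum>m. \<integral>\<^sup>+ \<omega>. (\<Sum>i<m. \<Sum>l. wa m i l (incr \<delta> \<omega>)) \<partial>M)"
      unfolding G_def by (intro nn_integral_suminf borel_measurable_sum cm) simp
    also have "\<dots> = (\<Sum>m. \<Sum>i<m. \<integral>\<^sup>+ \<omega>. (\<Sum>l. wa m i l (incr \<delta> \<omega>)) \<partial>M)"
      by (intro suminf_cong nn_integral_sum cm) simp
    also have "\<dots> = (\<Sum>m. \<Sum>i<m. \<Sum>l. \<integral>\<^sup>+ \<omega>. wa m i l (incr \<delta> \<omega>) \<partial>M)"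
      by (intro suminf_cong sum.cong refl nn_integral_suminf wa(2)) simp
    also have "\<dots> = (\<Sum>m. \<Sum>i<m. \<Sum>l. \<integral>\<^sup>+ z. wa m i l z \<partial>gauss2_seq (m + l))"
      by (intro suminf_cong sum.cong refl wa(1)) simp
    finally show ?thesis .
  qed
  have "ennreal (\<delta> * \<kappa>) * G = (\<Sum>m. \<Sum>i<m. ennreal (\<delta> * \<kappa>) * (\<Sum>l. \<integral>\<^sup>+ z. wa m i l z \<partial>gauss2_seq (m + l)))"
    unfolding G ennreal_suminf_cmult[symmetric] sum_distrib_left ..
  also have "\<dots> \<le> (\<Sum>m. \<Sum>i<m. ennreal U * (\<integral>\<^sup>+ z. fe m i z \<partial>gauss2_seq m))"
  proof (intro suminf_le sum_mono)
    fix m i :: nat assume "i \<in> {..<m}"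
    then have i: "i < m" by simp
    show "ennreal (\<delta> * \<kappa>) * (\<Sum>l. \<integral>\<^sup>+ z. wa m i l z \<partial>gauss2_seq (m + l)) \<le> ennreal U * (\<integral>\<^sup>+ z. fe m i z \<partial>gauss2_seq m)"
      using sum_width_alive_le(2)[OF x h b \<delta> i \<delta>K']
      unfolding wa_def fe_def U_def \<kappa>_def K_def h_def .
  qed auto
  also have "\<dots> = ennreal U * (\<Sum>m. \<Sum>i<m. (\<integral>\<^sup>+ z. fe m i z \<partial>gauss2_seq m))"
    unfolding ennreal_suminf_cmult[symmetric] sum_distrib_left ..
  also have "(\<Sum>m. \<Sum>i<m. (\<integral>\<^sup>+ z. fe m i z \<partial>gauss2_seq m)) = (\<Sum>m. \<Sum>i<m. (\<integral>\<^sup>+ \<omega>. fe m i (incr \<delta> \<omega>) \<partial>M))"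
    by (intro suminf_cong sum.cong refl fe(1)[symmetric]) simp
  also have "\<dots> = (\<Sum>m. \<integral>\<^sup>+ \<omega>. (\<Sum>i<m. fe m i (incr \<delta> \<omega>)) \<partial>M)"
    by (intro suminf_cong nn_integral_sum[symmetric] fe(2)) simp
  also have "\<dots> = (\<integral>\<^sup>+ \<omega>. (\<Sum>m. \<Sum>i<m. fe m i (incr \<delta> \<omega>)) \<partial>M)"
    by (intro nn_integral_suminf[symmetric] borel_measurable_sum fe(2)) simp
  also have "\<dots> \<le> (\<integral>\<^sup>+ \<omega>. 1 \<partial>M)"
    unfolding fe_def by (intro nn_integral_mono sum_first_exit_le)
  also have "\<dots> = 1" by (simp add: emeasure_space_1)
  finally have le: "ennreal (\<delta> * \<kappa>) * G \<le> ennreal U"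
    by (simp add: mult_left_mono)
  have "ennreal \<delta> * G = ennreal (1 / \<kappa>) * (ennreal (\<delta> * \<kappa>) * G)"
    using \<kappa> \<delta> by (simp add: mult.assoc[symmetric] ennreal_mult[symmetric])
  also have "\<dots> \<le> ennreal (1 / \<kappa>) * ennreal U" using le by (rule mult_left_mono) simp
  also have "\<dots> = ennreal (U / \<kappa>)" using \<kappa> U by (simp add: ennreal_mult[symmetric])
  finally have G_le: "ennreal \<delta> * G \<le> ennreal (U / \<kappa>)" .
  have "(\<integral>\<^sup>+ \<omega>. area_time W \<omega> \<partial>M) \<le> (\<integral>\<^sup>+ \<omega>. ennreal \<delta> * (tally (box_alive x (incr \<delta> \<omega>)) + (\<Sum>m. \<Sum>i<m. \<Sum>l. wa m i l (incr \<delta> \<omega>))) \<partial>M)"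
  proof (rule nn_integral_mono_AE, rule AE_mp[OF AE_continuous_path], intro AE_I2 impI)
    fix \<omega> assume "continuous_path \<omega>"
    from area_time_le[OF this a \<delta>]
    show "area_time W \<omega> \<le> ennreal \<delta> * (tally (box_alive x (incr \<delta> \<omega>)) + (\<Sum>m. \<Sum>i<m. \<Sum>l. wa m i l (incr \<delta> \<omega>)))"
      by (simp add: x_def cw[symmetric] h_def)
  qed
  also have "\<dots> = ennreal \<delta> * (\<integral>\<^sup>+ \<omega>. tally (box_alive x (incr \<delta> \<omega>)) + (\<Sum>m. \<Sum>i<m. \<Sum>l. wa m i l (incr \<delta> \<omega>)) \<partial>M)"
    by (intro nn_integral_cmult borel_measurable_add nn_integral_tally_box_alive(2) \<delta> borel_measurable_suminf_order borel_measurable_sum wa(2)) auto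
  also have "(\<integral>\<^sup>+ \<omega>. tally (box_alive x (incr \<delta> \<omega>)) + (\<Sum>m. \<Sum>i<m. \<Sum>l. wa m i l (incr \<delta> \<omega>)) \<partial>M)
     = box_exit_mean x + G"
    unfolding G_def nn_integral_tally_box_alive(1)[OF \<delta>, of x, symmetric]
    by (intro nn_integral_add nn_integral_tally_box_alive(2) \<delta> borel_measurable_suminf_order borel_measurable_sum wa(2)) auto
  also have "ennreal \<delta> * (box_exit_mean x + G) \<le> ennreal \<delta> * box_exit_mean x + ennreal (U / \<kappa>)"
    unfolding distrib_left by (intro add_left_mono G_le)
  finally show ?thesis by (simp add: x_def U_def h_def \<kappa>_def)
qed

text \<open>The mesh tends to 0 at a fixed margin \<open>b\<close>, which removes the error term
  with \<open>K\<close>. Then \<open>b\<close> tends to 0 and the initial potential becomes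
  \<open>(2 / a)\<^sup>2 / 2\<close>.\<close>

lemma nn_integral_area_time_le:
  assumes a: "0 < a"
  shows "(\<integral>\<^sup>+ \<omega>. area_time W \<omega> \<partial>M) \<le> ennreal (a\<^sup>2 * mean_min_range_time M W + 2 / a\<^sup>2)"
proof -
  define E where "E = (\<integral>\<^sup>+ \<omega>. area_time W \<omega> \<partial>M)"
  define r where "r = mean_min_range_time M W"
  have r: "0 \<le> r" by (simp add: r_def mean_min_range_time_def)
  have step: "E \<le> ennreal (a\<^sup>2 * r + exit_potential (2 / a) b 0 0)" if b: "0 < b" for b
  proof -
    define K where "K = 2 / b\<^sup>2 + (2 / a) / b ^ 3"
    define U where "U = exit_potential (2 / a) b 0 0"
    have U: "0 \<le> U" unfolding U_def using a b by (intro exit_potential_nonneg) auto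
    \<comment> \<open>The factor \<open>a\<^sup>2\<close> turns the threshold
      \<open>a / sqrt (\<delta> n)\<close> into the one of \<open>box_exit_mean_tendsto\<close>, and
      reappears as the factor of \<open>r\<close>.\<close>
    define \<delta> where "\<delta> n = a\<^sup>2 * (1/2) ^ n" for n :: nat
    have \<delta>0: "0 < \<delta> n" for n using a by (simp add: \<delta>_def)
    have \<delta>_lim: "\<delta> \<longlonglongrightarrow> 0"
      unfolding \<delta>_def by (intro tendsto_mult_right_zero LIMSEQ_power_zero) simp
    have small: "\<forall>\<^sub>F n in sequentially. 3 * K * \<delta> n < 1"
    proof -
      have "(\<lambda>n. 3 * K * \<delta> n) \<longlonglongrightarrow> 3 * K * 0" by (intro tendsto_intros \<delta>_lim)
      then show ?thesis by (intro order_tendstoD) auto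
    qed
    define S where "S n = ennreal (a\<^sup>2) * (ennreal ((1/2) ^ n) * box_exit_mean (1 / sqrt ((1/2) ^ n))) + ennreal (U / (1 - 3 * K * \<delta> n))" for n
    have "\<forall>\<^sub>F n in sequentially. E \<le> S n"
      using small
    proof eventually_elim
      case (elim n)
      have q: "a / sqrt (\<delta> n) = 1 / sqrt ((1/2) ^ n)"
        using a by (simp add: \<delta>_def real_sqrt_mult)
      have "ennreal (\<delta> n) * box_exit_mean (a / sqrt (\<delta> n)) = ennreal (a\<^sup>2) * (ennreal ((1/2) ^ n) * box_exit_mean (1 / sqrt ((1/2) ^ n)))"
        unfolding q unfolding \<delta>_def by (subst ennreal_mult) (auto simp: mult.assoc)
      then show ?case
        using nn_integral_area_time_grid[OF a b \<delta>0, of n] elim unfolding S_def E_def U_def K_def by simp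
    qed
    moreover have "S \<longlonglongrightarrow> ennreal (a\<^sup>2) * ennreal r + ennreal (U / (1 - 3 * K * 0))"
      unfolding S_def[abs_def] r_def
      by (intro tendsto_add ennreal_tendsto_cmult box_exit_mean_tendsto tendsto_ennrealI tendsto_intros \<delta>_lim) auto
    ultimately have "E \<le> ennreal (a\<^sup>2) * ennreal r + ennreal (U / (1 - 3 * K * 0))"
      by (intro tendsto_lowerbound[where F = sequentially]) auto
    also have "\<dots> = ennreal (a\<^sup>2 * r + U)"
      using r U by (simp add: ennreal_mult)
    finally show ?thesis by (simp add: U_def)
  qed
  have "(\<lambda>n. exit_potential (2 / a) ((1/2) ^ n) 0 0) \<longlonglongrightarrow> exit_potential (2 / a) 0 0 0"
    unfolding exit_potential_def by (intro tendsto_intros LIMSEQ_power_zero) auto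
  then have "(\<lambda>n. ennreal (a\<^sup>2 * r + exit_potential (2 / a) ((1/2) ^ n) 0 0)) \<longlonglongrightarrow> ennreal (a\<^sup>2 * r + exit_potential (2 / a) 0 0 0)"
    by (intro tendsto_ennrealI tendsto_add tendsto_const)
  then have "E \<le> ennreal (a\<^sup>2 * r + exit_potential (2 / a) 0 0 0)"
    by (rule tendsto_lowerbound) (auto intro!: always_eventually step)
  also have "exit_potential (2 / a) 0 0 0 = 2 / a\<^sup>2"
    by (simp add: exit_potential_def power_divide)
  finally show ?thesis by (simp add: E_def r_def)
qed

end

section \<open>Lower bound for the mean exceedance time of the area\<close>

text \<open>The count is a Riemann sum for the length of the set of times t with
  \<open>t * \<alpha> \<le> 1\<close>, that is for \<open>1 / \<alpha>\<close>, with error at most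
  \<open>\<Delta>\<close>. The linear function is the tangent to \<open>1 / \<alpha>\<close> at
  \<open>\<alpha> = pi / 2\<close>, the bound for the mean area at time 1. Its value never exceeds
  \<open>4 / pi\<close>, so a mesh that reaches this far suffices even when
  \<open>1 / \<alpha>\<close> is larger.\<close>

lemma mesh_count_ge:
  fixes \<Delta> \<alpha> :: real
  assumes \<Delta>: "0 < \<Delta>" and J: "4 / pi \<le> real J * \<Delta>" and \<alpha>: "0 \<le> \<alpha>"
  shows "4 / pi \<le> \<Delta> * real (card {j\<in>{1..J}. real j * \<Delta> * \<alpha> \<le> 1}) + 4 / pi\<^sup>2 * \<alpha> + \<Delta>"
proof (cases "real J * \<Delta> * \<alpha> \<le> 1")
  case True
  have "real j * \<Delta> * \<alpha> \<le> 1" if "j \<le> J" for j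
  proof -
    have "real j * \<Delta> * \<alpha> \<le> real J * \<Delta> * \<alpha>" using that \<Delta> \<alpha> by (intro mult_right_mono) auto
    with True show ?thesis by simp
  qed
  then have "{j\<in>{1..J}. real j * \<Delta> * \<alpha> \<le> 1} = {1..J}" by auto
  then have "\<Delta> * real (card {j\<in>{1..J}. real j * \<Delta> * \<alpha> \<le> 1}) = real J * \<Delta>" by simp
  moreover have "0 \<le> 4 / pi\<^sup>2 * \<alpha>" using \<alpha> by simp
  ultimately show ?thesis using J \<Delta> by linarith
next
  case False
  then have \<alpha>0: "0 < \<alpha>" using \<alpha> by (cases "\<alpha> = 0") auto
  define y where "y = 1 / (\<Delta> * \<alpha>)"
  have y: "0 \<le> y" "y < real J" "\<Delta> * y = 1 / \<alpha>"
    using False \<Delta> \<alpha>0 by (auto simp: y_def divide_less_eq mult.assoc)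
  define K where "K = nat \<lfloor>y\<rfloor>"
  have K: "real K \<le> y" "y < real K + 1"
    using y(1) by (simp_all add: K_def)
  have "{1..K} \<subseteq> {j\<in>{1..J}. real j * \<Delta> * \<alpha> \<le> 1}"
  proof
    fix j assume "j \<in> {1..K}"
    then have j: "1 \<le> j" "real j \<le> y" using K by auto
    then have "real j * (\<Delta> * \<alpha>) \<le> y * (\<Delta> * \<alpha>)" using \<Delta> \<alpha> by (intro mult_right_mono) auto
    also have "\<dots> = 1" using \<Delta> \<alpha>0 by (simp add: y_def)
    finally have "real j * \<Delta> * \<alpha> \<le> 1" by (simp add: mult.assoc)
    moreover have "j \<le> J" using j(2) y(2) by linarith
    ultimately show "j \<in> {j\<in>{1..J}. real j * \<Delta> * \<alpha> \<le> 1}" using j by simp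
  qed
  then have "card {1..K} \<le> card {j\<in>{1..J}. real j * \<Delta> * \<alpha> \<le> 1}" by (intro card_mono) auto
  then have "y - 1 \<le> real (card {j\<in>{1..J}. real j * \<Delta> * \<alpha> \<le> 1})" using K by simp
  then have "\<Delta> * (y - 1) \<le> \<Delta> * real (card {j\<in>{1..J}. real j * \<Delta> * \<alpha> \<le> 1})"
    using \<Delta> by (intro mult_left_mono) auto
  then have 1: "1 / \<alpha> - \<Delta> \<le> \<Delta> * real (card {j\<in>{1..J}. real j * \<Delta> * \<alpha> \<le> 1})"
    using y(3) by (simp add: right_diff_distrib)
  \<comment> \<open>Convexity of the reciprocal in explicit form: the gap to the tangent is a square
    over a positive number.\<close>
  have "0 \<le> (pi - 2 * \<alpha>)\<^sup>2 / (pi\<^sup>2 * \<alpha>)" using \<alpha>0 by simp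
  also have "(pi - 2 * \<alpha>)\<^sup>2 / (pi\<^sup>2 * \<alpha>) = 1 / \<alpha> + 4 / pi\<^sup>2 * \<alpha> - 4 / pi"
    using \<alpha>0 by (simp add: power2_eq_square field_simps)
  finally show ?thesis using 1 by linarith
qed

context standard_planar_brownian_motion
begin

text \<open>A majorant for the hull area of the path sampled at \<open>2 ^ m + 1\<close> equidistant
  times in \<open>[0, t]\<close>, measurable by construction. For fixed \<open>m\<close> its law is
  \<open>t\<close> times a law free of \<open>t\<close>.\<close>

definition dyadic_bound :: "nat \<Rightarrow> real \<Rightarrow> 'a \<Rightarrow> real" where
  "dyadic_bound m t \<omega> = t / 2 ^ m * hull_bound (2 ^ m) (\<lambda>k\<in>{..<2 ^ m}. incr (t / 2 ^ m) \<omega> k)"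

lemma dyadic_hull_le:
  assumes t: "0 < t"
  shows "measure lborel (convex hull ((\<lambda>k. W (real k * (t / 2 ^ m)) \<omega>) ` {..2 ^ m})) \<le> dyadic_bound m t \<omega>"
proof -
  define \<delta> where "\<delta> = t / 2 ^ m"
  have \<delta>: "0 < \<delta>" using t by (simp add: \<delta>_def)
  define z where "z = (\<lambda>k\<in>{..<2 ^ m}. incr \<delta> \<omega> k)"
  have "psum z k = psum (incr \<delta> \<omega>) k" if "k \<le> 2 ^ m" for k
    unfolding z_def using that by (intro psum_cong) auto
  then have "(\<lambda>k. W (real k * \<delta>) \<omega>) ` {..2 ^ m} = (\<lambda>x. W 0 \<omega> + sqrt \<delta> *\<^sub>R x) ` (psum z ` {..2 ^ m})"
    unfolding W_grid[OF \<delta>] image_image by (intro image_cong) auto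
  then have "measure lborel (convex hull ((\<lambda>k. W (real k * \<delta>) \<omega>) ` {..2 ^ m})) = \<delta> * measure lborel (convex hull (psum z ` {..2 ^ m}))"
    using \<delta> by (simp add: measure_hull_affine)
  also have "\<dots> \<le> \<delta> * hull_bound (2 ^ m) z"
    using \<delta> by (intro mult_left_mono hull_bound(1)) auto
  finally show ?thesis by (simp add: \<delta>_def z_def dyadic_bound_def)
qed

lemma measurable_dyadic_bound[measurable]:
  assumes "0 < t"
  shows "dyadic_bound m t \<in> borel_measurable M"
proof -
  have "(\<lambda>\<omega>. hull_bound (2 ^ m) (\<lambda>k\<in>{..<2 ^ m}. incr (t / 2 ^ m) \<omega> k)) \<in> borel_measurable M"
    using assms by (intro measurable_compose[OF measurable_incr measurable_hull_bound]) simp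
  then have "(\<lambda>\<omega>. dyadic_bound m t \<omega>) \<in> borel_measurable M"
    unfolding dyadic_bound_def by simp
  then show ?thesis .
qed

text \<open>If the bound at time \<open>j * \<Delta>\<close> is at most 1 for infinitely many
  \<open>m\<close>, the hull has area at most 1 at that time, and the exceedance comes no earlier.
  The number of such \<open>j\<close> is at most the largest of them, and for large \<open>m\<close>
  no others are counted.\<close>

lemma area_time_ge:
  assumes c: "continuous_path \<omega>" and \<Delta>: "0 < \<Delta>"
  shows "limsup (\<lambda>m. ennreal \<Delta> * of_nat (card {j\<in>{1..J}. dyadic_bound m (real j * \<Delta>) \<omega> \<le> 1})) \<le> area_time W \<omega>"
proof -
  have w: "continuous_on {0..} (\<lambda>t. W t \<omega>)" using c by (simp add: continuous_path_def)
  define S where "S = {j\<in>{1..J}. \<exists>\<^sub>F m in sequentially. dyadic_bound m (real j * \<Delta>) \<omega> \<le> 1}"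
  have finS: "finite S" by (simp add: S_def)
  have "\<forall>\<^sub>F m in sequentially. \<forall>j\<in>{1..J} - S. \<not> dyadic_bound m (real j * \<Delta>) \<omega> \<le> 1"
    by (intro eventually_ball_finite) (auto simp: S_def not_frequently)
  then have "\<forall>\<^sub>F m in sequentially. ennreal \<Delta> * of_nat (card {j\<in>{1..J}. dyadic_bound m (real j * \<Delta>) \<omega> \<le> 1}) \<le> ennreal \<Delta> * of_nat (card S)"
  proof eventually_elim
    case (elim m)
    then have "{j\<in>{1..J}. dyadic_bound m (real j * \<Delta>) \<omega> \<le> 1} \<subseteq> S" by blast
    then have "card {j\<in>{1..J}. dyadic_bound m (real j * \<Delta>) \<omega> \<le> 1} \<le> card S" using finS by (rule card_mono[rotated])
    then show ?case by (intro mult_left_mono of_nat_mono) auto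
  qed
  then have "limsup (\<lambda>m. ennreal \<Delta> * of_nat (card {j\<in>{1..J}. dyadic_bound m (real j * \<Delta>) \<omega> \<le> 1})) \<le> ennreal \<Delta> * of_nat (card S)"
    by (rule Limsup_bounded)
  also have "\<dots> \<le> area_time W \<omega>"
  proof (cases "S = {}")
    case False
    define j where "j = Max S"
    have j: "j \<in> S" unfolding j_def using finS False by (rule Max_in)
    have "S \<subseteq> {1..j}" unfolding j_def using finS by (auto simp: S_def)
    then have "card S \<le> card {1..j}" by (intro card_mono) auto
    then have "ennreal \<Delta> * of_nat (card S) \<le> ennreal \<Delta> * of_nat j"
      by (intro mult_left_mono of_nat_mono) auto
    also have "\<dots> = ennreal (real j * \<Delta>)" using \<Delta> by (simp add: of_nat_mult_ennreal)
    also have "\<dots> \<le> area_time W \<omega>"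
      unfolding area_time_def
    proof (rule exceed_one_time_ge)
      fix s :: real assume s: "0 \<le> s" "1 < hull_area (\<lambda>t. W t \<omega>) s"
      have t: "0 < real j * \<Delta>" using j \<Delta> by (auto simp: S_def)
      have "\<exists>\<^sub>F m in sequentially. dyadic_bound m (real j * \<Delta>) \<omega> \<le> 1"
        using j by (simp add: S_def)
      then have "\<exists>\<^sub>F m in sequentially. measure lborel (convex hull ((\<lambda>k. W (real k * (real j * \<Delta> / 2 ^ m)) \<omega>) ` {..2 ^ m})) \<le> 1"
        by (rule frequently_elim1) (rule order_trans[OF dyadic_hull_le[OF t]])
      then have "hull_area (\<lambda>t. W t \<omega>) (real j * \<Delta>) \<le> 1"
        by (rule hull_area_le_dyadic[OF w t])
      then show "real j * \<Delta> \<le> s"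
        using hull_area_mono[OF w, of s "real j * \<Delta>"] s by linarith
    qed
    finally show ?thesis .
  qed simp
  finally show ?thesis .
qed

text \<open>Each \<open>j\<close> has its own mesh, but the normalised increments have the same law
  for all of them, and a mean count depends only on the individual laws. All walks may thus be
  replaced by a single sequence \<open>z\<close>, to which \<open>mesh_count_ge\<close> applies.
  This is the form in which the exceedance time is traded for the reciprocal of the area at time
  1.\<close>

lemma nn_integral_mesh_count:
  assumes \<Delta>: "0 < \<Delta>" and J: "4 / pi \<le> real J * \<Delta>"
  shows "ennreal (2 / pi - \<Delta>) \<le> (\<integral>\<^sup>+ \<omega>. ennreal \<Delta> * of_nat (card {j\<in>{1..J}. dyadic_bound m (real j * \<Delta>) \<omega> \<le> 1}) \<partial>M)"
    (is "_ \<le> ?I")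
proof -
  define N where "N = (2 :: nat) ^ m"
  have N: "0 < N" "real N = 2 ^ m" by (simp_all add: N_def)
  define \<alpha> where "\<alpha> z = hull_bound N z / real N" for z
  have \<alpha>0: "0 \<le> \<alpha> z" for z
    unfolding \<alpha>_def using order_trans[OF measure_nonneg hull_bound(1)] by simp
  have [measurable]: "\<alpha> \<in> borel_measurable (gauss2_seq N)" unfolding \<alpha>_def by measurable
  have card: "of_nat (card {j\<in>{1..J}. P j}) = (\<Sum>j\<in>{1..J}. if P j then 1 else 0 :: ennreal)" for P
    by (simp add: sum.If_cases Int_def)
  have \<alpha>_eq: "dyadic_bound m (real j * \<Delta>) \<omega> = real j * \<Delta> * \<alpha> (\<lambda>k\<in>{..<N}. incr (real j * \<Delta> / 2 ^ m) \<omega> k)" for j \<omega>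
    by (simp add: dyadic_bound_def \<alpha>_def N_def)
  have "?I = ennreal \<Delta> * (\<Sum>j\<in>{1..J}. \<integral>\<^sup>+ \<omega>. (if dyadic_bound m (real j * \<Delta>) \<omega> \<le> 1 then 1 else 0) \<partial>M)"
  proof -
    have [measurable]: "(\<lambda>\<omega>. if dyadic_bound m (real j * \<Delta>) \<omega> \<le> 1 then 1 else 0 :: ennreal) \<in> borel_measurable M" if "j \<in> {1..J}" for j
    proof -
      have [measurable]: "dyadic_bound m (real j * \<Delta>) \<in> borel_measurable M"
        using that \<Delta> by (intro measurable_dyadic_bound) auto
      show ?thesis by measurable
    qed
    show ?thesis
      unfolding card by (subst nn_integral_cmult; (subst nn_integral_sum)?) auto
  qed
  also have "\<dots> = ennreal \<Delta> * (\<Sum>j\<in>{1..J}. \<integral>\<^sup>+ z. (if real j * \<Delta> * \<alpha> z \<le> 1 then 1 else 0) \<partial>gauss2_seq N)"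
  proof (intro arg_cong2[of _ _ _ _ "(*)"] refl sum.cong)
    fix j assume "j \<in> {1..J}"
    then have d: "0 < real j * \<Delta> / 2 ^ m" using \<Delta> by simp
    show "(\<integral>\<^sup>+ \<omega>. (if dyadic_bound m (real j * \<Delta>) \<omega> \<le> 1 then 1 else 0) \<partial>M) = (\<integral>\<^sup>+ z. (if real j * \<Delta> * \<alpha> z \<le> 1 then 1 else 0) \<partial>gauss2_seq N)"
      unfolding \<alpha>_eq by (rule nn_integral_incr[OF d]) measurable
  qed
  also have "\<dots> = (\<integral>\<^sup>+ z. ennreal \<Delta> * of_nat (card {j\<in>{1..J}. real j * \<Delta> * \<alpha> z \<le> 1}) \<partial>gauss2_seq N)"
    unfolding card by (subst nn_integral_cmult; (subst nn_integral_sum)?) auto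
  finally have I: "?I = (\<integral>\<^sup>+ z. ennreal \<Delta> * of_nat (card {j\<in>{1..J}. real j * \<Delta> * \<alpha> z \<le> 1}) \<partial>gauss2_seq N)" .
  have [measurable]: "(\<lambda>z. of_nat (card {j\<in>{1..J}. real j * \<Delta> * \<alpha> z \<le> 1}) :: ennreal) \<in> borel_measurable (gauss2_seq N)"
    unfolding card by measurable
  have "(\<integral>\<^sup>+ z. ennreal (\<alpha> z) \<partial>gauss2_seq N) \<le> ennreal (pi / 2)"
  proof -
    have "(\<integral>\<^sup>+ z. ennreal (\<alpha> z) \<partial>gauss2_seq N) = (\<integral>\<^sup>+ z. ennreal (1 / real N) * ennreal (hull_bound N z) \<partial>gauss2_seq N)"
      by (intro nn_integral_cong) (simp add: \<alpha>_def ennreal_mult'[symmetric])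
    also have "\<dots> = ennreal (1 / real N) * (\<integral>\<^sup>+ z. ennreal (hull_bound N z) \<partial>gauss2_seq N)"
      by (rule nn_integral_cmult) measurable
    also have "\<dots> \<le> ennreal (1 / real N) * ennreal (pi / 2 * real N)"
      by (intro mult_left_mono nn_integral_hull_bound) simp
    also have "\<dots> = ennreal (pi / 2)" using N(1) by (subst ennreal_mult[symmetric]) auto
    finally show ?thesis .
  qed
  then have \<alpha>_le: "ennreal (4 / pi\<^sup>2) * (\<integral>\<^sup>+ z. ennreal (\<alpha> z) \<partial>gauss2_seq N) \<le> ennreal (2 / pi)"
  proof -
    assume *: "(\<integral>\<^sup>+ z. ennreal (\<alpha> z) \<partial>gauss2_seq N) \<le> ennreal (pi / 2)"
    have "ennreal (4 / pi\<^sup>2) * (\<integral>\<^sup>+ z. ennreal (\<alpha> z) \<partial>gauss2_seq N) \<le> ennreal (4 / pi\<^sup>2) * ennreal (pi / 2)"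
      using * by (rule mult_left_mono) simp
    also have "\<dots> = ennreal (2 / pi)"
      by (subst ennreal_mult[symmetric]) (auto simp: power2_eq_square)
    finally show ?thesis .
  qed
  have "ennreal (4 / pi) = (\<integral>\<^sup>+ z. ennreal (4 / pi) \<partial>gauss2_seq N)"
    by (simp add: gauss2_seq.emeasure_space_1)
  also have "\<dots> \<le> (\<integral>\<^sup>+ z. ennreal \<Delta> * of_nat (card {j\<in>{1..J}. real j * \<Delta> * \<alpha> z \<le> 1}) + (ennreal (4 / pi\<^sup>2) * ennreal (\<alpha> z) + ennreal \<Delta>) \<partial>gauss2_seq N)"
  proof (rule nn_integral_mono)
    fix z
    define c where "c = real (card {j\<in>{1..J}. real j * \<Delta> * \<alpha> z \<le> 1})"
    have "ennreal (4 / pi) \<le> ennreal (\<Delta> * c + (4 / pi\<^sup>2 * \<alpha> z + \<Delta>))"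
      using mesh_count_ge[OF \<Delta> J \<alpha>0[of z]] by (intro ennreal_leI) (simp add: c_def add.assoc)
    also have "\<dots> = ennreal (\<Delta> * c) + (ennreal (4 / pi\<^sup>2 * \<alpha> z) + ennreal \<Delta>)"
      using \<Delta> \<alpha>0[of z] by (simp only: c_def ennreal_plus mult_nonneg_nonneg add_nonneg_nonneg of_nat_0_le_iff
        less_imp_le divide_nonneg_nonneg zero_le_power2 zero_le_numeral)
    also have "\<dots> = ennreal \<Delta> * of_nat (card {j\<in>{1..J}. real j * \<Delta> * \<alpha> z \<le> 1}) + (ennreal (4 / pi\<^sup>2) * ennreal (\<alpha> z) + ennreal \<Delta>)"
    proof -
      have "ennreal (\<Delta> * c) = ennreal \<Delta> * of_nat (card {j\<in>{1..J}. real j * \<Delta> * \<alpha> z \<le> 1})"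
        using \<Delta> unfolding c_def ennreal_of_nat_eq_real_of_nat by (intro ennreal_mult) auto
      moreover have "ennreal (4 / pi\<^sup>2 * \<alpha> z) = ennreal (4 / pi\<^sup>2) * ennreal (\<alpha> z)"
        using \<alpha>0[of z] by (intro ennreal_mult) auto
      ultimately show ?thesis by (simp only:)
    qed
    finally show "ennreal (4 / pi) \<le> ennreal \<Delta> * of_nat (card {j\<in>{1..J}. real j * \<Delta> * \<alpha> z \<le> 1}) + (ennreal (4 / pi\<^sup>2) * ennreal (\<alpha> z) + ennreal \<Delta>)" .
  qed
  also have "\<dots> = ?I + (ennreal (4 / pi\<^sup>2) * (\<integral>\<^sup>+ z. ennreal (\<alpha> z) \<partial>gauss2_seq N) + ennreal \<Delta>)"
  proof -
    have "(\<integral>\<^sup>+ z. ennreal (4 / pi\<^sup>2) * ennreal (\<alpha> z) + ennreal \<Delta> \<partial>gauss2_seq N)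
       = (\<integral>\<^sup>+ z. ennreal (4 / pi\<^sup>2) * ennreal (\<alpha> z) \<partial>gauss2_seq N) + (\<integral>\<^sup>+ z. ennreal \<Delta> \<partial>gauss2_seq N)"
      by (rule nn_integral_add) measurable
    also have "\<dots> = ennreal (4 / pi\<^sup>2) * (\<integral>\<^sup>+ z. ennreal (\<alpha> z) \<partial>gauss2_seq N) + ennreal \<Delta>"
      by (subst nn_integral_cmult) (measurable, simp add: gauss2_seq.emeasure_space_1)
    finally have 2: "(\<integral>\<^sup>+ z. ennreal (4 / pi\<^sup>2) * ennreal (\<alpha> z) + ennreal \<Delta> \<partial>gauss2_seq N)
       = ennreal (4 / pi\<^sup>2) * (\<integral>\<^sup>+ z. ennreal (\<alpha> z) \<partial>gauss2_seq N) + ennreal \<Delta>" .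
    show ?thesis
      unfolding I 2[symmetric] by (rule nn_integral_add) measurable
  qed
  also have "\<dots> \<le> ?I + (ennreal (2 / pi) + ennreal \<Delta>)"
    by (intro add_left_mono add_right_mono \<alpha>_le)
  finally have le: "ennreal (4 / pi) \<le> ?I + ennreal (2 / pi + \<Delta>)"
    using \<Delta> by simp
  show ?thesis
  proof (cases ?I)
    case (real I')
    then have "ennreal (4 / pi) \<le> ennreal (I' + (2 / pi + \<Delta>))" using le \<Delta> by simp
    then have "4 / pi \<le> I' + (2 / pi + \<Delta>)" using real \<Delta> by (subst (asm) ennreal_le_iff) auto
    then have "2 / pi - \<Delta> \<le> I'" by (simp add: field_simps)
    then show ?thesis unfolding real by (rule ennreal_leI)
  qed simp
qed

text \<open>The reverse Fatou lemma, with the constant majorant \<open>\<Delta> * J\<close>, moves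
  the upper limit in \<open>m\<close> inside the mean; letting \<open>\<Delta>\<close> tend to 0
  removes the mesh error.\<close>

lemma nn_integral_area_time_ge: "ennreal (2 / pi) \<le> (\<integral>\<^sup>+ \<omega>. area_time W \<omega> \<partial>M)"
proof -
  have step: "ennreal (2 / pi - \<Delta>) \<le> (\<integral>\<^sup>+ \<omega>. area_time W \<omega> \<partial>M)" if \<Delta>: "0 < \<Delta>" for \<Delta>
  proof -
    obtain J :: nat where *: "4 / pi / \<Delta> \<le> real J" using real_arch_simple by blast
    have J: "4 / pi \<le> real J * \<Delta>" using mult_right_mono[OF *, of \<Delta>] \<Delta> by simp
    define Y where "Y m \<omega> = ennreal \<Delta> * of_nat (card {j\<in>{1..J}. dyadic_bound m (real j * \<Delta>) \<omega> \<le> 1})" for m \<omega>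
    have card: "of_nat (card {j\<in>{1..J}. P j}) = (\<Sum>j\<in>{1..J}. if P j then 1 else 0 :: ennreal)" for P
      by (simp add: sum.If_cases Int_def)
    have Y[measurable]: "Y m \<in> borel_measurable M" for m
    proof -
      have [measurable]: "(\<lambda>\<omega>. if dyadic_bound m (real j * \<Delta>) \<omega> \<le> 1 then 1 else 0 :: ennreal) \<in> borel_measurable M" if "j \<in> {1..J}" for j
      proof -
        have [measurable]: "dyadic_bound m (real j * \<Delta>) \<in> borel_measurable M"
          using that \<Delta> by (intro measurable_dyadic_bound) auto
        show ?thesis by measurable
      qed
      have "(\<lambda>\<omega>. Y m \<omega>) \<in> borel_measurable M" unfolding Y_def card by measurable
      then show ?thesis .
    qed
    have Y_le: "Y m \<omega> \<le> ennreal \<Delta> * of_nat J" for m \<omega>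
    proof -
      have "card {j\<in>{1..J}. dyadic_bound m (real j * \<Delta>) \<omega> \<le> 1} \<le> card {1..J}" by (intro card_mono) auto
      then show ?thesis unfolding Y_def by (intro mult_left_mono of_nat_mono) auto
    qed
    have "ennreal (2 / pi - \<Delta>) \<le> limsup (\<lambda>m. \<integral>\<^sup>+ \<omega>. Y m \<omega> \<partial>M)"
      unfolding Y_def
      by (intro le_Limsup always_eventually allI nn_integral_mesh_count \<Delta> J) simp
    also have "\<dots> \<le> (\<integral>\<^sup>+ \<omega>. limsup (\<lambda>m. Y m \<omega>) \<partial>M)"
      using Y_le
      by (intro nn_integral_limsup[where w = "\<lambda>_. ennreal \<Delta> * of_nat J"])
         (auto simp: emeasure_space_1 ennreal_mult_less_top of_nat_less_top)
    also have "\<dots> \<le> (\<integral>\<^sup>+ \<omega>. area_time W \<omega> \<partial>M)"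
      unfolding Y_def
    proof (rule nn_integral_mono_AE, rule AE_mp[OF AE_continuous_path], intro AE_I2 impI)
      fix \<omega> assume "continuous_path \<omega>"
      then show "limsup (\<lambda>m. ennreal \<Delta> * of_nat (card {j\<in>{1..J}. dyadic_bound m (real j * \<Delta>) \<omega> \<le> 1})) \<le> area_time W \<omega>"
        using \<Delta> by (rule area_time_ge)
    qed
    finally show ?thesis .
  qed
  have "(\<lambda>n. ennreal (2 / pi - (1/2) ^ n)) \<longlonglongrightarrow> ennreal (2 / pi - 0)"
    by (intro tendsto_ennrealI tendsto_intros LIMSEQ_power_zero) simp
  then have "ennreal (2 / pi - 0) \<le> (\<integral>\<^sup>+ \<omega>. area_time W \<omega> \<partial>M)"
    by (rule tendsto_upperbound) (auto intro!: always_eventually step)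
  then show ?thesis by simp
qed

end

theorem proposition1p8:
  fixes M :: "'a measure" and W :: "real \<Rightarrow> 'a \<Rightarrow> real \<times> real"
  assumes "standard_planar_brownian_motion M W"
  shows "ennreal (2 / pi) \<le> (\<integral>\<^sup>+ \<omega>. area_time W \<omega> \<partial>M)
    \<and> (\<integral>\<^sup>+ \<omega>. area_time W \<omega> \<partial>M) \<le> ennreal (2 * sqrt (2 * mean_min_range_time M W))"
proof
  interpret standard_planar_brownian_motion M W by fact
  show lower: "ennreal (2 / pi) \<le> (\<integral>\<^sup>+ \<omega>. area_time W \<omega> \<partial>M)"
    by (rule nn_integral_area_time_ge)
  define r where "r = mean_min_range_time M W"
  have "0 \<le> r" by (simp add: r_def mean_min_range_time_def)
  \<comment> \<open>With \<open>r = 0\<close> the upper estimate at \<open>a = 2\<close> would be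
    1/2, which lies below the lower bound \<open>2 / pi\<close>. Positivity of \<open>r\<close> is
    what allows the optimal \<open>a\<close> to be chosen.\<close>
  moreover have "r \<noteq> 0"
  proof
    assume "r = 0"
    then have "ennreal (2 / pi) \<le> ennreal (2 / 2\<^sup>2)"
      using order_trans[OF lower nn_integral_area_time_le[of 2]] by (simp add: r_def)
    then have "2 / pi \<le> 1 / 2" by (subst (asm) ennreal_le_iff) auto
    then show False using pi_less_4 by (simp add: divide_le_eq)
  qed
  ultimately have r: "0 < r" by simp
  \<comment> \<open>This is the solution of \<open>a ^ 4 = 2 / r\<close>, for which the terms
    \<open>a\<^sup>2 * r\<close> and \<open>2 / a\<^sup>2\<close> coincide and their sum is
    minimal.\<close>
  define a where "a = sqrt (sqrt (2 / r))"
  have a: "0 < a" "a\<^sup>2 = sqrt (2 / r)" using r by (simp_all add: a_def)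
  define q where "q = sqrt r"
  have q: "0 < q" "r = q * q" using r by (simp_all add: q_def)
  have sqrts: "sqrt (2 / r) = sqrt 2 / q" "sqrt (2 * r) = sqrt 2 * q"
    by (simp_all add: q_def real_sqrt_divide real_sqrt_mult)
  have "a\<^sup>2 * r = sqrt (2 * r)"
    unfolding a sqrts using q by simp
  moreover have "2 / a\<^sup>2 = sqrt (2 * r)"
  proof -
    have *: "(c * c) / (c / q) = c * q" if "0 < c" for c using q(1) that by (simp add: field_simps)
    have "2 / (sqrt 2 / q) = (sqrt 2 * sqrt 2) / (sqrt 2 / q)" by simp
    also have "\<dots> = sqrt 2 * q" by (rule *) simp
    finally show ?thesis by (simp only: a sqrts)
  qed
  ultimately show "(\<integral>\<^sup>+ \<omega>. area_time W \<omega> \<partial>M) \<le> ennreal (2 * sqrt (2 * mean_min_range_time M W))"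
    using nn_integral_area_time_le[OF a(1)] by (simp add: r_def)
qed

end
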